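(* Let $\Omega\subset\mathbb{C}^n$ be a bounded domain, $0<T<\infty$, $\Omega_T=(0,T)\times\Omega$. Let $F:\overline{\Omega}\times\mathbb{R}\to\mathbb{R}$, $(z,r)\mapsto F(z,r)$, be continuous and non-decreasing in $r$; let $f\ge0$ be a bounded continuous function on $\Omega$ and $\mu=f(z)\,dV$; let $\varphi$ be continuous on $\partial\Omega$; let $u_0\in C(\overline{\Omega})$ be plurisubharmonic in $\Omega$ with $u_0=\varphi$ on $\partial\Omega$ (so $\mu$, $F$ and $\varphi$ are independent of $t$). If the problem $$\begin{cases} e^{\partial_t u+F(z,u)}\mu(z)=(dd^c u)^n & \text{in }\Omega_T,\\ u(t,z)=\varphi(z) & \text{on }[0,T)\times\partial\Omega,\\ u(0,z)=u_0(z) & \text{in }\overline{\Omega},\end{cases}$$ admits a viscosity solution $u$, then for every $0<t<T$ there exists $C_t>0$ such that $(dd^cu(t,z))^n\le C_t\,\mu(z)$ in the viscosity sense in $\Omega$. In particular, $(u_0,\mu)$ is admissible.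
   Context: $dV$ is the standard volume form on $\mathbb{C}^n$; top-degree forms are compared through their densities with respect to $dV$. Elliptic viscosity inequality: for a function $w$ on $\Omega$ and $C>0$, $(dd^cw)^n\le C\mu$ in the viscosity sense in $\Omega$ means: for every $z_0\in\Omega$ and every $C^2$ function $q$ near $z_0$ with $q(z_0)=w(z_0)$, $q\le w$ near $z_0$ and $dd^cq(z_0)\ge0$, one has $(dd^cq)^n(z_0)\le C\mu(z_0)$. Admissibility. $(u_0,\mu)$ is admissible if for every $\epsilon>0$ there exist $u_\epsilon\in C(\overline{\Omega})$ and $C_\epsilon>0$ such that $u_0\le u_\epsilon\le u_0+\epsilon$ and $(dd^cu_\epsilon)^n\le e^{C_\epsilon}\mu$ in the viscosity sense in $\Omega$. Test functions. For $w$ defined near $(t_0,z_0)\in\Omega_T$, an upper (resp. lower) test function for $w$ at $(t_0,z_0)$ is a function $q$, of class $C^1$ in $t$ and $C^2$ in $z$ near $(t_0,z_0)$, with $w(t_0,z_0)=q(t_0,z_0)$ and $w\le q$ (resp. $w\ge q$) near $(t_0,z_0)$. Viscosity subsolution of the parabolic equation: a function $u:[0,T)\times\overline{\Omega}\to\mathbb{R}$, upper semicontinuous on $[0,T)\times\overline\Omega$, such that for every $(t_0,z_0)\in\Omega_T$ and every upper test function $q$ for $u$ at $(t_0,z_0)$, $(dd^c q(t_0,\cdot))^n(z_0)\ge e^{\partial_t q(t_0,z_0)+F(z_0,q(t_0,z_0))}\mu(z_0)$. It is a subsolution of the problem if moreover $u\le\varphi$ on $[0,T)\times\partial\Omega$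 and $u(0,\cdot)\le u_0$ in $\Omega$. Viscosity supersolution of the parabolic equation: $v:[0,T)\times\overline{\Omega}\to\mathbb{R}$, lower semicontinuous on $[0,T)\times\overline\Omega$, such that for every $(t_0,z_0)\in\Omega_T$ and every lower test function $q$ for $v$ at $(t_0,z_0)$ with $dd^cq(t_0,\cdot)(z_0)\ge 0$, $(dd^c q(t_0,\cdot))^n(z_0)\le e^{\partial_t q(t_0,z_0)+F(z_0,q(t_0,z_0))}\mu(z_0)$. It is a supersolution of the problem if moreover $v\ge\varphi$ on $[0,T)\times\partial\Omega$ and $v(0,\cdot)\ge u_0$ in $\Omega$. A viscosity solution of the problem is a function that is both a subsolution and a supersolution of it. *)

theory Defs
  imports "HOL-Analysis.Analysis"
begin

section \<open>Semicontinuity and plurisubharmonicity\<close>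

definition usc_on :: "'a::topological_space set \<Rightarrow> ('a \<Rightarrow> real) \<Rightarrow> bool" where
  "usc_on S g \<longleftrightarrow> (\<forall>x\<in>S. \<forall>c. g x < c \<longrightarrow> (\<forall>\<^sub>F y in at x within S. g y < c))"

definition lsc_on :: "'a::topological_space set \<Rightarrow> ('a \<Rightarrow> real) \<Rightarrow> bool" where
  "lsc_on S g \<longleftrightarrow> (\<forall>x\<in>S. \<forall>c. c < g x \<longrightarrow> (\<forall>\<^sub>F y in at x within S. c < g y))"

text \<open>Sub-mean value inequality on closed complex discs. For a real-valued (hence nowhere
  \<open>-\<infinity>\<close>) upper semicontinuous function the inequality forces integrability on the circles,
  so integrability is part of the condition.\<close>

definition plurisubharmonic_on :: "(complex ^ 'n) set \<Rightarrow> (complex ^ 'n \<Rightarrow> real) \<Rightarrow> bool" where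
  "plurisubharmonic_on \<Omega> u \<longleftrightarrow> usc_on \<Omega> u \<and>
     (\<forall>a b. (\<forall>\<zeta>. cmod \<zeta> \<le> 1 \<longrightarrow> a + \<zeta> *s b \<in> \<Omega>) \<longrightarrow>
        (\<lambda>\<theta>. u (a + cis \<theta> *s b)) absolutely_integrable_on {0..2 * pi} \<and>
        u a \<le> integral {0..2 * pi} (\<lambda>\<theta>. u (a + cis \<theta> *s b)) / (2 * pi))"

section \<open>The complex Monge--Ampere operator on functions of class C2\<close>

definition C2_near :: "(complex ^ 'n \<Rightarrow> real) \<Rightarrow> complex ^ 'n \<Rightarrow> bool" where
  "C2_near q z0 \<longleftrightarrow> (\<exists>U D H. open U \<and> z0 \<in> U \<and>
     (\<forall>z\<in>U. (q has_derivative D z) (at z) \<and>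
            (\<forall>v. ((\<lambda>x. D x v) has_derivative H z v) (at z))) \<and>
     (\<forall>v w. continuous_on U (\<lambda>z. H z v w)))"

text \<open>\<open>dz j\<close> is \<open>\<partial>/\<partial>z\<^sub>j = (\<partial>/\<partial>x\<^sub>j - \<i> \<partial>/\<partial>y\<^sub>j)/2\<close> and \<open>dzbar k\<close> is its conjugate operator.\<close>

definition dz :: "'n \<Rightarrow> (complex ^ 'n \<Rightarrow> complex) \<Rightarrow> complex ^ 'n \<Rightarrow> complex" where
  "dz j g z = (frechet_derivative g (at z) (axis j 1)
               - \<i> * frechet_derivative g (at z) (axis j \<i>)) / 2"

definition dzbar :: "'n \<Rightarrow> (complex ^ 'n \<Rightarrow> complex) \<Rightarrow> complex ^ 'n \<Rightarrow> complex" where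
  "dzbar k g z = (frechet_derivative g (at z) (axis k 1)
                  + \<i> * frechet_derivative g (at z) (axis k \<i>)) / 2"

definition complex_hessian :: "(complex ^ 'n \<Rightarrow> real) \<Rightarrow> complex ^ 'n \<Rightarrow> complex ^ 'n ^ 'n" where
  "complex_hessian q z = (\<chi> j k. dz j (dzbar k (\<lambda>x. complex_of_real (q x))) z)"

text \<open>Positivity of the real (1,1)-form \<open>dd\<^sup>cq(z)\<close>. The Hermitian form below is real-valued when
  \<open>q\<close> is C2 near \<open>z\<close>, so \<open>Re\<close> only changes the type.\<close>

definition ddc_nonneg :: "(complex ^ 'n \<Rightarrow> real) \<Rightarrow> complex ^ 'n \<Rightarrow> bool" where
  "ddc_nonneg q z \<longleftrightarrow>
     (\<forall>\<xi> :: complex ^ 'n. 0 \<le> Re (\<Sum>j\<in>UNIV. \<Sum>k\<in>UNIV. complex_hessian q z $ j $ k * \<xi> $ j * cnj (\<xi> $ k)))"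

text \<open>The density of \<open>(dd\<^sup>cq)\<^sup>n\<close> with respect to \<open>dV\<close>, for the normalization
  \<open>d = \<partial> + \<delta>\<close>, \<open>d\<^sup>c = \<i>(\<delta> - \<partial>)\<close>, where \<open>\<delta>\<close> is the Cauchy-Riemann operator (the conjugate of \<open>\<partial>\<close>).
  With \<open>\<omega>\<^sub>j\<^sub>k\<close> the wedge product of the 1-form \<open>dz\<^sub>j\<close> and the conjugate of \<open>dz\<^sub>k\<close>, and \<open>(q\<^sub>j\<^sub>k)\<close> the
  complex Hessian, \<open>dd\<^sup>cq = 2\<i> \<Sum>\<^sub>j\<^sub>k q\<^sub>j\<^sub>k \<omega>\<^sub>j\<^sub>k\<close>. As \<open>dV\<close> is the wedge product of the forms \<open>(\<i>/2) \<omega>\<^sub>j\<^sub>j\<close>,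
  the \<open>n\<close>-th exterior power of \<open>dd\<^sup>cq\<close> is \<open>4\<^sup>n n! det (q\<^sub>j\<^sub>k) dV\<close>. The determinant is real, the Hessian
  of a C2 function being Hermitian.\<close>

definition ma_density :: "(complex ^ 'n \<Rightarrow> real) \<Rightarrow> complex ^ 'n \<Rightarrow> real" where
  "ma_density q z = 4 ^ CARD('n) * fact CARD('n) * Re (det (complex_hessian q z))"

section \<open>The elliptic viscosity inequality and admissibility\<close>

text \<open>The measure \<open>\<mu> = f dV\<close> is represented throughout by its density \<open>f\<close>.\<close>

definition elliptic_visc_le ::
    "(complex ^ 'n) set \<Rightarrow> (complex ^ 'n \<Rightarrow> real) \<Rightarrow> real \<Rightarrow> (complex ^ 'n \<Rightarrow> real) \<Rightarrow> bool" where
  "elliptic_visc_le \<Omega> w C f \<longleftrightarrow>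
     (\<forall>z0\<in>\<Omega>. \<forall>q. C2_near q z0 \<and> q z0 = w z0 \<and> (\<forall>\<^sub>F z in nhds z0. q z \<le> w z) \<and> ddc_nonneg q z0
        \<longrightarrow> ma_density q z0 \<le> C * f z0)"

definition admissible ::
    "(complex ^ 'n) set \<Rightarrow> (complex ^ 'n \<Rightarrow> real) \<Rightarrow> (complex ^ 'n \<Rightarrow> real) \<Rightarrow> bool" where
  "admissible \<Omega> u0 f \<longleftrightarrow>
     (\<forall>\<epsilon>>0. \<exists>ue Ce. Ce > 0 \<and> continuous_on (closure \<Omega>) ue \<and>
        (\<forall>z\<in>closure \<Omega>. u0 z \<le> ue z \<and> ue z \<le> u0 z + \<epsilon>) \<and>
        elliptic_visc_le \<Omega> ue (exp Ce) f)"

section \<open>Viscosity solutions of the parabolic problem\<close>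

text \<open>Class C1 in \<open>t\<close> and C2 in \<open>z\<close>, in the parabolic sense: the derivatives \<open>\<partial>\<^sub>t q\<close>, \<open>D\<^sub>z q\<close>
  and \<open>D\<^sub>z\<^sup>2 q\<close> exist and are jointly continuous near \<open>(t0, z0)\<close>.\<close>

definition C12_near :: "(real \<Rightarrow> complex ^ 'n \<Rightarrow> real) \<Rightarrow> real \<Rightarrow> complex ^ 'n \<Rightarrow> bool" where
  "C12_near q t0 z0 \<longleftrightarrow> (\<exists>U qt D H. open U \<and> (t0, z0) \<in> U \<and>
     (\<forall>(t, z)\<in>U. ((\<lambda>s. q s z) has_real_derivative qt (t, z)) (at t) \<and>
            (q t has_derivative D (t, z)) (at z) \<and>
            (\<forall>v. ((\<lambda>x. D (t, x) v) has_derivative H (t, z) v) (at z))) \<and>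
     continuous_on U qt \<and>
     (\<forall>v. continuous_on U (\<lambda>p. D p v)) \<and>
     (\<forall>v w. continuous_on U (\<lambda>p. H p v w)))"

definition upper_test ::
    "(real \<Rightarrow> complex ^ 'n \<Rightarrow> real) \<Rightarrow> (real \<Rightarrow> complex ^ 'n \<Rightarrow> real) \<Rightarrow> real \<Rightarrow> complex ^ 'n \<Rightarrow> bool" where
  "upper_test q w t0 z0 \<longleftrightarrow> C12_near q t0 z0 \<and> w t0 z0 = q t0 z0 \<and>
     (\<forall>\<^sub>F (t, z) in nhds (t0, z0). w t z \<le> q t z)"

definition lower_test ::
    "(real \<Rightarrow> complex ^ 'n \<Rightarrow> real) \<Rightarrow> (real \<Rightarrow> complex ^ 'n \<Rightarrow> real) \<Rightarrow> real \<Rightarrow> complex ^ 'n \<Rightarrow> bool" where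
  "lower_test q w t0 z0 \<longleftrightarrow> C12_near q t0 z0 \<and> w t0 z0 = q t0 z0 \<and>
     (\<forall>\<^sub>F (t, z) in nhds (t0, z0). q t z \<le> w t z)"

definition visc_subsolution_eq ::
    "(complex ^ 'n) set \<Rightarrow> real \<Rightarrow> (complex ^ 'n \<Rightarrow> real \<Rightarrow> real) \<Rightarrow> (complex ^ 'n \<Rightarrow> real) \<Rightarrow>
     (real \<Rightarrow> complex ^ 'n \<Rightarrow> real) \<Rightarrow> bool" where
  "visc_subsolution_eq \<Omega> T F f u \<longleftrightarrow>
     usc_on ({0..<T} \<times> closure \<Omega>) (\<lambda>(t, z). u t z) \<and>
     (\<forall>t0\<in>{0<..<T}. \<forall>z0\<in>\<Omega>. \<forall>q. upper_test q u t0 z0 \<longrightarrow>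
        ma_density (q t0) z0 \<ge> exp (deriv (\<lambda>t. q t z0) t0 + F z0 (q t0 z0)) * f z0)"

definition visc_supersolution_eq ::
    "(complex ^ 'n) set \<Rightarrow> real \<Rightarrow> (complex ^ 'n \<Rightarrow> real \<Rightarrow> real) \<Rightarrow> (complex ^ 'n \<Rightarrow> real) \<Rightarrow>
     (real \<Rightarrow> complex ^ 'n \<Rightarrow> real) \<Rightarrow> bool" where
  "visc_supersolution_eq \<Omega> T F f v \<longleftrightarrow>
     lsc_on ({0..<T} \<times> closure \<Omega>) (\<lambda>(t, z). v t z) \<and>
     (\<forall>t0\<in>{0<..<T}. \<forall>z0\<in>\<Omega>. \<forall>q. lower_test q v t0 z0 \<and> ddc_nonneg (q t0) z0 \<longrightarrow>
        ma_density (q t0) z0 \<le> exp (deriv (\<lambda>t. q t z0) t0 + F z0 (q t0 z0)) * f z0)"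

definition visc_subsolution ::
    "(complex ^ 'n) set \<Rightarrow> real \<Rightarrow> (complex ^ 'n \<Rightarrow> real \<Rightarrow> real) \<Rightarrow> (complex ^ 'n \<Rightarrow> real) \<Rightarrow>
     (complex ^ 'n \<Rightarrow> real) \<Rightarrow> (complex ^ 'n \<Rightarrow> real) \<Rightarrow> (real \<Rightarrow> complex ^ 'n \<Rightarrow> real) \<Rightarrow> bool" where
  "visc_subsolution \<Omega> T F f \<phi> u0 u \<longleftrightarrow> visc_subsolution_eq \<Omega> T F f u \<and>
     (\<forall>t\<in>{0..<T}. \<forall>z\<in>frontier \<Omega>. u t z \<le> \<phi> z) \<and> (\<forall>z\<in>\<Omega>. u 0 z \<le> u0 z)"

definition visc_supersolution ::
    "(complex ^ 'n) set \<Rightarrow> real \<Rightarrow> (complex ^ 'n \<Rightarrow> real \<Rightarrow> real) \<Rightarrow> (complex ^ 'n \<Rightarrow> real) \<Rightarrow>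
     (complex ^ 'n \<Rightarrow> real) \<Rightarrow> (complex ^ 'n \<Rightarrow> real) \<Rightarrow> (real \<Rightarrow> complex ^ 'n \<Rightarrow> real) \<Rightarrow> bool" where
  "visc_supersolution \<Omega> T F f \<phi> u0 v \<longleftrightarrow> visc_supersolution_eq \<Omega> T F f v \<and>
     (\<forall>t\<in>{0..<T}. \<forall>z\<in>frontier \<Omega>. v t z \<ge> \<phi> z) \<and> (\<forall>z\<in>\<Omega>. v 0 z \<ge> u0 z)"

definition visc_solution ::
    "(complex ^ 'n) set \<Rightarrow> real \<Rightarrow> (complex ^ 'n \<Rightarrow> real \<Rightarrow> real) \<Rightarrow> (complex ^ 'n \<Rightarrow> real) \<Rightarrow>
     (complex ^ 'n \<Rightarrow> real) \<Rightarrow> (complex ^ 'n \<Rightarrow> real) \<Rightarrow> (real \<Rightarrow> complex ^ 'n \<Rightarrow> real) \<Rightarrow> bool" where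
  "visc_solution \<Omega> T F f \<phi> u0 u \<longleftrightarrow>
     visc_subsolution \<Omega> T F f \<phi> u0 u \<and> visc_supersolution \<Omega> T F f \<phi> u0 u"

end

theory Submission
  imports Defs
begin

text \<open>
  A solution \<open>u\<close> is compared with its time rescaling \<open>u(l t, z) / l\<close>, \<open>l > 1\<close>. This gives
  \<open>u(l t, z) - u(t, z) \<le> C (l - 1)\<close>, so \<open>\<partial>\<^sub>t u\<close> is bounded above on \<open>[\<delta>, T - \<delta>]\<close> and the
  supersolution inequality at a fixed time becomes the elliptic one. Admissibility follows by taking
  \<open>u(t, \<cdot>) + \<epsilon>/2\<close> for small \<open>t\<close>.

  For the comparison only the time variable is doubled: at a maximum of the doubled function,
  partial maximization in time leaves an elliptic subsolution \<open>g\<close> with constant right-hand side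
  and an elliptic supersolution \<open>w\<close> near a point. Since \<open>det\<^sup>1\<^sup>/\<^sup>n\<close> is an infimum of the linear functionals
  \<open>tr (A P A\<^sup>*)\<close>, suitably normalized, \<open>g\<close> is a viscosity subsolution of a family of Poisson
  equations with constant coefficients. These pass to convolutions (by comparison with harmonic
  polynomials on small ellipsoids), so the convolutions of \<open>g\<close> are classical subsolutions and can
  serve as test functions for \<open>w\<close>. This replaces the Jensen--Ishii maximum principle.
\<close>

subsection \<open>Harmonic polynomials\<close>

text \<open>The supersolution inequality bounds the Monge-Ampere density by \<open>exp\<close> of
  the time derivative, so an upper bound on that derivative is enough. Rescaling yields one because
  \<open>F\<close>, \<open>f\<close> and the boundary values do not depend on time, and because
  dividing by \<open>l\<close> keeps the time derivative equal to that of \<open>u\<close> at time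
  \<open>l t\<close>. Two difficulties shape the comparison. The density \<open>f\<close> may
  vanish, so strictness cannot be produced on the right-hand side; it comes from adding
  \<open>\<kappa> |z|^2\<close> to the subsolution, since
  \<open>det (P + c I) \<ge> det P + c^n\<close> for positive semidefinite \<open>P\<close>, even
  when \<open>det P = 0\<close>. And after the maximization in time both functions are merely
  continuous in \<open>z\<close>, so the subsolution has to be smoothed. Convolution respects linear
  inequalities but not, directly, a determinant bound; hence the passage to trace inequalities,
  which together, over all invertible \<open>A\<close>, give the determinant bound back. Harmonic
  polynomials are explicit solutions of the Dirichlet problem on a ball, for a dense set of boundary
  data.\<close>

definition pd :: "'a::real_normed_vector \<Rightarrow> ('a \<Rightarrow> real) \<Rightarrow> 'a \<Rightarrow> real" where
  "pd v p x = frechet_derivative p (at x) v"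

definition laplacian :: "('a::euclidean_space \<Rightarrow> real) \<Rightarrow> 'a \<Rightarrow> real" where
  "laplacian p x = (\<Sum>b\<in>Basis. pd b (pd b p) x)"

lemmas rpf_linear = real_polynomial_function.intros(1)
  and rpf_const = real_polynomial_function.intros(2)
  and rpf_add = real_polynomial_function.intros(3)
  and rpf_mult = real_polynomial_function.intros(4)

lemma pd_eqI:
  assumes "\<And>x. (p has_derivative D x) (at x)"
  shows "pd v p = (\<lambda>x. D x v)"
  using frechet_derivative_at[OF assms] by (auto simp: pd_def fun_eq_iff)

lemma rpf_derivative:
  assumes "real_polynomial_function p"
  shows "\<exists>D. (\<forall>x. (p has_derivative (\<lambda>v. D v x)) (at x)) \<and> (\<forall>v. real_polynomial_function (D v))"
  using assms
proof induction
  case (linear f)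
  then show ?case
    by (intro exI[of _ "\<lambda>v x. f v"]) (auto intro: bounded_linear_imp_has_derivative)
next
  case (const c)
  then show ?case by (intro exI[of _ "\<lambda>v x. 0"]) auto
next
  case (add f g)
  then obtain D1 D2 where
    "\<And>x. (f has_derivative (\<lambda>v. D1 v x)) (at x)" "\<And>v. real_polynomial_function (D1 v)"
    "\<And>x. (g has_derivative (\<lambda>v. D2 v x)) (at x)" "\<And>v. real_polynomial_function (D2 v)"
    by blast
  then show ?case
    by (intro exI[of _ "\<lambda>v x. D1 v x + D2 v x"]) (auto intro!: has_derivative_add)
next
  case (mult f g)
  then obtain D1 D2 where
    D: "\<And>x. (f has_derivative (\<lambda>v. D1 v x)) (at x)" "\<And>v. real_polynomial_function (D1 v)"
    "\<And>x. (g has_derivative (\<lambda>v. D2 v x)) (at x)" "\<And>v. real_polynomial_function (D2 v)"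
    by blast
  have "((\<lambda>x. f x * g x) has_derivative (\<lambda>v. f x * D2 v x + D1 v x * g x)) (at x)" for x
    using has_derivative_mult[OF D(1)[of x] D(3)[of x]] .
  then show ?case
    using D mult.hyps
    by (intro exI[of _ "\<lambda>v x. f x * D2 v x + D1 v x * g x"]) (auto intro!: rpf_add rpf_mult)
qed

lemma rpf_has_derivative:
  assumes "real_polynomial_function p"
  shows "(p has_derivative (\<lambda>v. pd v p x)) (at x)"
proof -
  obtain D where D: "\<And>x. (p has_derivative (\<lambda>v. D v x)) (at x)"
    using rpf_derivative[OF assms] by blast
  show ?thesis using D[of x] pd_eqI[of p "\<lambda>x v. D v x", OF D] by simp
qed

lemma rpf_pd:
  assumes "real_polynomial_function p"
  shows "real_polynomial_function (pd v p)"
proof -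
  obtain D where D: "\<And>x. (p has_derivative (\<lambda>v. D v x)) (at x)" "\<And>v. real_polynomial_function (D v)"
    using rpf_derivative[OF assms] by blast
  show ?thesis using D(2)[of v] pd_eqI[of p "\<lambda>x v. D v x", OF D(1)] by simp
qed

lemma linear_pd:
  assumes "real_polynomial_function p"
  shows "linear (\<lambda>v. pd v p x)"
  using rpf_has_derivative[OF assms] by (rule has_derivative_linear)

lemma pd_const: "pd v (\<lambda>x. c) = (\<lambda>x. 0)"
  by (rule pd_eqI) auto

lemma pd_linear:
  assumes "bounded_linear f"
  shows "pd v f = (\<lambda>x. f v)"
  by (rule pd_eqI) (rule bounded_linear_imp_has_derivative[OF assms])

lemma pd_add:
  assumes "real_polynomial_function f" "real_polynomial_function g"
  shows "pd v (\<lambda>x. f x + g x) = (\<lambda>x. pd v f x + pd v g x)"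
  by (rule pd_eqI) (intro has_derivative_add rpf_has_derivative assms)

lemma pd_mult:
  assumes "real_polynomial_function f" "real_polynomial_function g"
  shows "pd v (\<lambda>x. f x * g x) = (\<lambda>x. f x * pd v g x + pd v f x * g x)"
  by (rule pd_eqI) (intro has_derivative_mult rpf_has_derivative assms)

lemma pd_cmult:
  assumes "real_polynomial_function g"
  shows "pd v (\<lambda>x. c * g x) = (\<lambda>x. c * pd v g x)"
  using pd_mult[OF rpf_const assms] by (simp add: pd_const)

lemma pd_sum:
  assumes "finite I" "\<And>i. i \<in> I \<Longrightarrow> real_polynomial_function (f i)"
  shows "pd v (\<lambda>x. \<Sum>i\<in>I. f i x) = (\<lambda>x. \<Sum>i\<in>I. pd v (f i) x)"
  by (rule pd_eqI) (intro has_derivative_sum rpf_has_derivative assms)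

text \<open>Induction on the structure of the polynomial; in the product case both sides expand to
  the same four terms.\<close>

lemma pd_commute:
  assumes "real_polynomial_function p"
  shows "pd a (pd b p) = pd b (pd a p)"
  using assms
  by induction (simp_all add: pd_linear pd_const pd_add pd_mult rpf_pd rpf_mult
      fun_eq_iff algebra_simps)

lemma laplacian_add:
  assumes "real_polynomial_function f" "real_polynomial_function g"
  shows "laplacian (\<lambda>x. f x + g x) = (\<lambda>x. laplacian f x + laplacian g x)"
  using assms by (simp add: laplacian_def[abs_def] pd_add rpf_pd sum.distrib)

lemma laplacian_cmult:
  assumes "real_polynomial_function g"
  shows "laplacian (\<lambda>x. c * g x) = (\<lambda>x. c * laplacian g x)"
  using assms by (simp add: laplacian_def[abs_def] pd_cmult rpf_pd sum_distrib_left)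

lemma laplacian_const: "laplacian (\<lambda>x. c) = (\<lambda>x. 0)"
  by (simp add: laplacian_def[abs_def] pd_const)

lemma laplacian_sum:
  assumes "finite I" "\<And>i. i \<in> I \<Longrightarrow> real_polynomial_function (f i)"
  shows "laplacian (\<lambda>x. \<Sum>i\<in>I. f i x) = (\<lambda>x. \<Sum>i\<in>I. laplacian (f i) x)"
  using assms
  by (simp add: laplacian_def[abs_def] pd_sum rpf_pd sum.swap[of _ I])

lemma rpf_inner: "real_polynomial_function (\<lambda>x. x \<bullet> i)"
  by (rule rpf_linear) (rule bounded_linear_inner_left)

lemma pd_inner: "pd v (\<lambda>x. x \<bullet> i) = (\<lambda>x. v \<bullet> i)"
  by (rule pd_linear) (rule bounded_linear_inner_left)

lemma rpf_inner_self: "real_polynomial_function (\<lambda>x. x \<bullet> (x::'a::euclidean_space))"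
  by (subst euclidean_inner)
    (intro real_polynomial_function_sum finite_Basis rpf_mult rpf_inner)

lemma pd_inner_self: "pd v (\<lambda>x. x \<bullet> x) = (\<lambda>x::'a::euclidean_space. 2 * (x \<bullet> v))"
proof -
  have "((\<lambda>x. x \<bullet> x) has_derivative (\<lambda>v. x \<bullet> v + v \<bullet> x)) (at x)" for x :: 'a
    by (rule has_derivative_inner[OF has_derivative_ident has_derivative_ident])
  from pd_eqI[OF this] show ?thesis by (simp add: inner_commute fun_eq_iff)
qed

lemma laplacian_inner_self: "laplacian (\<lambda>x. x \<bullet> x) = (\<lambda>x::'a::euclidean_space. 2 * DIM('a))"
  by (simp add: laplacian_def[abs_def] pd_inner_self pd_cmult[OF rpf_inner] pd_inner fun_eq_iff)

lemma laplacian_inner: "laplacian (\<lambda>x. x \<bullet> i) = (\<lambda>x. 0)"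
  by (simp add: laplacian_def[abs_def] pd_inner pd_const)

lemma laplacian_mult:
  assumes "real_polynomial_function f" "real_polynomial_function g"
  shows "laplacian (\<lambda>x. f x * g x) x = f x * laplacian g x + 2 * (\<Sum>b\<in>Basis. pd b f x * pd b g x)
      + laplacian f x * g x"
  using assms
  by (simp add: laplacian_def pd_mult pd_add rpf_pd rpf_mult sum.distrib
      sum_distrib_left sum_distrib_right algebra_simps)

lemma pd_expand:
  fixes x :: "'a::euclidean_space"
  assumes "real_polynomial_function p"
  shows "pd v p x = (\<Sum>b\<in>Basis. (v \<bullet> b) * pd b p x)"
proof -
  have "pd v p x = pd (\<Sum>b\<in>Basis. (v \<bullet> b) *\<^sub>R b) p x" by (simp add: euclidean_representation)
  also have "\<dots> = (\<Sum>b\<in>Basis. pd ((v \<bullet> b) *\<^sub>R b) p x)"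
    using linear_sum[OF linear_pd[OF assms]] by (simp add: o_def)
  finally show ?thesis using linear_scale[OF linear_pd[OF assms]] by simp
qed

text \<open>Homogeneity of degree \<open>k\<close> is expressed by Euler's identity.\<close>

definition homog_harmonic :: "real \<Rightarrow> ('a::euclidean_space \<Rightarrow> real) \<Rightarrow> bool" where
  "homog_harmonic k h \<longleftrightarrow> real_polynomial_function h \<and> (\<forall>x. laplacian h x = 0) \<and> (\<forall>x. pd x h x
      = k * h x)"

text \<open>Differentiating Euler's identity in direction \<open>i\<close> produces one extra copy
  of \<open>pd i h\<close>, hence the degree drops by one. The Laplacian commutes with
  \<open>pd i\<close> because mixed derivatives of polynomials do.\<close>

lemma homog_harmonic_pd:
  fixes h :: "'a::euclidean_space \<Rightarrow> real"
  assumes "homog_harmonic k h"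
  shows "homog_harmonic (k - 1) (pd i h)"
proof -
  have h: "real_polynomial_function h" and l: "laplacian h = (\<lambda>x. 0)" and e: "\<And>x. pd x h x
      = k * h x"
    using assms by (auto simp: homog_harmonic_def)
  have "laplacian (pd i h) = pd i (laplacian h)"
  proof -
    have "pd b (pd b (pd i h)) = pd i (pd b (pd b h))" for b
      by (simp only: pd_commute[OF h, of b i] pd_commute[OF rpf_pd[OF h], of b i])
    then show ?thesis
      unfolding laplacian_def[abs_def] by (subst pd_sum) (auto intro!: rpf_pd h)
  qed
  then have 1: "laplacian (pd i h) = (\<lambda>x. 0)" by (simp add: l pd_const)
  have "(\<lambda>x. pd x h x) = (\<lambda>x. \<Sum>b\<in>Basis. (x \<bullet> b) * pd b h x)"
    by (rule ext) (rule pd_expand[OF h])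
  then have "pd i (\<lambda>x. k * h x) = pd i (\<lambda>x. \<Sum>b\<in>Basis. (x \<bullet> b) * pd b h x)"
    by (simp only: e)
  also have "\<dots> = (\<lambda>x. \<Sum>b\<in>Basis. (x \<bullet> b) * pd i (pd b h) x + (i \<bullet> b) * pd b h x)"
    by (simp add: pd_sum pd_mult rpf_pd h rpf_inner rpf_mult pd_inner)
  finally have "pd i (\<lambda>x. k * h x) x
      = (\<Sum>b\<in>Basis. (x \<bullet> b) * pd i (pd b h) x + (i \<bullet> b) * pd b h x)" for x
    by (rule fun_cong)
  moreover have "pd i (\<lambda>x. k * h x) x = k * pd i h x" for x by (simp add: pd_cmult h)
  moreover have "pd i (pd b h) x = pd b (pd i h) x" for b x by (simp only: pd_commute[OF h, of i b])
  ultimately have "k * pd i h x = (\<Sum>b\<in>Basis. (x \<bullet> b) * pd b (pd i h) x) + (\<Sum>b\<in>Basis. (i \<bullet> b) * pd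
      b h x)" for x
    by (simp only: sum.distrib)
  then have "k * pd i h x = pd x (pd i h) x + pd i h x" for x
    by (simp only: pd_expand[OF rpf_pd[OF h], symmetric] pd_expand[OF h, symmetric])
  then have "pd x (pd i h) x = (k - 1) * pd i h x" for x by (simp add: algebra_simps)
  then show ?thesis using 1 by (simp add: homog_harmonic_def rpf_pd h)
qed

text \<open>Degrees are real numbers, so the derivative of a function of degree \<open>0\<close>
  formally has degree \<open>-1\<close>. Such a function vanishes because
  \<open>t * h (t *\<^sub>R x)\<close> has zero derivative in \<open>t\<close> by Euler's identity
  and is \<open>0\<close> at \<open>t = 0\<close>.\<close>

lemma homog_harmonic_minus_one:
  assumes "homog_harmonic (- 1) h"
  shows "h = (\<lambda>x. 0)"
proof
  fix x
  have h: "real_polynomial_function h" and e: "\<And>x. pd x h x = - h x"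
    using assms by (auto simp: homog_harmonic_def)
  have "((\<lambda>t. t * h (t *\<^sub>R x)) has_derivative (\<lambda>s. 0)) (at t)" for t :: real
  proof -
    have "((\<lambda>t. h (t *\<^sub>R x)) has_derivative (\<lambda>s. pd (s *\<^sub>R x) h (t *\<^sub>R x))) (at t)"
      by (rule has_derivative_compose[of "\<lambda>t. t *\<^sub>R x" "\<lambda>s. s *\<^sub>R x" t UNIV h])
        (auto intro!: derivative_eq_intros rpf_has_derivative h)
    from has_derivative_mult[OF has_derivative_ident this]
    have d: "((\<lambda>t. t * h (t *\<^sub>R x)) has_derivative (\<lambda>s. t * pd (s *\<^sub>R x) h (t *\<^sub>R x) + s * h (t
        *\<^sub>R x))) (at t)" .
    have "t * pd (s *\<^sub>R x) h (t *\<^sub>R x) = s * pd (t *\<^sub>R x) h (t *\<^sub>R x)" for s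
      using linear_scale[OF linear_pd[OF h]] by simp
    with d e show ?thesis by simp
  qed
  then have "(\<lambda>t. t * h (t *\<^sub>R x)) 1 = (\<lambda>t. t * h (t *\<^sub>R x)) 0"
    by (intro has_derivative_zero_unique[of UNIV]) (auto simp: has_derivative_at_withinI)
  then show "h x = 0" by simp
qed

text \<open>The denominator in \<open>c\<close> vanishes only for dimension \<open>2\<close> and \<open>k = 0\<close>, when \<open>pd i h = 0\<close>.\<close>

lemma homog_harmonic_raise:
  fixes h :: "'a::euclidean_space \<Rightarrow> real"
  assumes hh: "homog_harmonic (real k) h" and i: "i \<in> Basis" and m: "DIM('a) \<ge> 2"
  defines "c \<equiv> 1 / (DIM('a) + 2 * (real k - 1))"
  shows "homog_harmonic (real (Suc k)) (\<lambda>x. (x \<bullet> i) * h x + (- c) * ((x \<bullet> x) * pd i h x))"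
proof -
  have h: "real_polynomial_function h" and l: "\<And>x. laplacian h x = 0" and e: "\<And>x. pd x h x
      = k * h x"
    using hh by (auto simp: homog_harmonic_def)
  define g where "g = pd i h"
  have "homog_harmonic (real k - 1) g" unfolding g_def by (rule homog_harmonic_pd[OF hh])
  then have g: "real_polynomial_function g" and lg: "\<And>x. laplacian g x = 0"
    and eg: "\<And>x. pd x g x = (real k - 1) * g x"
    by (auto simp: homog_harmonic_def)
  have g0: "g = (\<lambda>x. 0)" if "k = 0"
    using homog_harmonic_minus_one \<open>homog_harmonic (real k - 1) g\<close> that by simp
  \<comment> \<open>\<open>c\<close> is chosen so that the Laplacians of the two summands,
    \<open>2 * g\<close> and the multiple of \<open>g\<close> computed in facts \<open>1\<close> and
    \<open>2\<close> below, cancel.\<close>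
  have c: "c * (2 * DIM('a) + 4 * (real k - 1)) * g x = 2 * g x" for x
  proof (cases "k = 0")
    case False
    then have "DIM('a) + 2 * (real k - 1) > 0" using m by simp
    then show ?thesis by (simp add: c_def field_simps)
  qed (simp add: g0)
  note p = rpf_add rpf_mult rpf_const
    rpf_inner rpf_inner_self g h
  have 1: "laplacian (\<lambda>x. (x \<bullet> i) * h x) x = 2 * g x" for x
  proof -
    have "(\<Sum>b\<in>Basis. (b \<bullet> i) * pd b h x) = (\<Sum>b\<in>Basis. if b = i then pd b h x else 0)"
      using i by (intro sum.cong) (auto simp: inner_Basis)
    then show ?thesis using i by (simp add: laplacian_mult p l laplacian_inner pd_inner g_def)
  qed
  have 2: "laplacian (\<lambda>x. (x \<bullet> x) * g x) x = (2 * DIM('a) + 4 * (real k - 1)) * g x" for x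
  proof -
    have "laplacian (\<lambda>x. (x \<bullet> x) * g x) x = 2 * (\<Sum>b\<in>Basis. 2 * (x \<bullet> b) * pd b g x) + 2 * DIM('a) *
        g x"
      by (simp add: laplacian_mult p lg laplacian_inner_self pd_inner_self)
    also have "(\<Sum>b\<in>Basis. 2 * (x \<bullet> b) * pd b g x) = 2 * pd x g x"
      by (simp add: pd_expand[OF g, of x] sum_distrib_left mult.assoc)
    finally show ?thesis by (simp add: eg algebra_simps)
  qed
  have "laplacian (\<lambda>x. (x \<bullet> i) * h x + (- c) * ((x \<bullet> x) * g x)) x = 0" for x
    using c[of x] by (simp only: laplacian_add laplacian_cmult p 1 2)
  moreover have "pd x (\<lambda>x. (x \<bullet> i) * h x + (- c) * ((x \<bullet> x) * g x)) x
      = real (Suc k) * ((x \<bullet> i) * h x + (- c) * ((x \<bullet> x) * g x))" for x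
    by (simp only: pd_add pd_cmult pd_mult p pd_inner pd_inner_self e eg) (simp add: algebra_simps)
  moreover have "real_polynomial_function (\<lambda>x. (x \<bullet> i) * h x + (- c) * ((x \<bullet> x) * g x))"
    by (intro p)
  ultimately show ?thesis unfolding homog_harmonic_def g_def[symmetric] by blast
qed

text \<open>Pieces of different degrees are kept apart in the generation of sums, because Euler's
  identity, on which the raising step rests, holds only for each homogeneous piece.\<close>

inductive harmonic_span :: "('a::euclidean_space \<Rightarrow> real) \<Rightarrow> bool" where
  homog: "homog_harmonic (real k) h \<Longrightarrow> harmonic_span h"
| add: "harmonic_span f \<Longrightarrow> harmonic_span g \<Longrightarrow> harmonic_span (\<lambda>x. f x + g x)"

lemma homog_harmonic_const: "homog_harmonic 0 (\<lambda>x. c)"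
  by (simp add: homog_harmonic_def laplacian_const pd_const rpf_const)

lemma homog_harmonic_cmult: "homog_harmonic k h \<Longrightarrow> homog_harmonic k (\<lambda>x. c * h x)"
  by (simp add: homog_harmonic_def laplacian_cmult pd_cmult rpf_mult rpf_const)

lemma harmonic_span_const: "harmonic_span (\<lambda>x. c)"
  by (rule harmonic_span.homog[of 0]) (simp add: homog_harmonic_const)

lemma harmonic_span_cmult: "harmonic_span h \<Longrightarrow> harmonic_span (\<lambda>x. c * h x)"
  by (induction rule: harmonic_span.induct)
    (auto simp: distrib_left intro: harmonic_span.intros homog_harmonic_cmult)

lemma harmonic_span_sum:
  assumes "finite I" "\<And>i. i \<in> I \<Longrightarrow> harmonic_span (f i)"
  shows "harmonic_span (\<lambda>x. \<Sum>i\<in>I. f i x)"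
  using assms by (induction) (auto intro: harmonic_span.intros harmonic_span_const)

lemma harmonic_span_imp:
  assumes "harmonic_span h"
  shows "real_polynomial_function h" "\<forall>x. laplacian h x = 0"
  using assms by induction (auto simp: homog_harmonic_def laplacian_add rpf_add)

text \<open>For homogeneous \<open>h\<close>, the product \<open>(x \<bullet> i) * h x\<close> is
  the harmonic polynomial of \<open>homog_harmonic_raise\<close> plus
  \<open>c * (x \<bullet> x) * pd i h x\<close>. On the unit sphere
  \<open>x \<bullet> x = 1\<close>, so the second part may be replaced by the harmonic function
  \<open>c * pd i h x\<close>.\<close>

lemma harmonic_span_mult_coordinate:
  fixes h :: "'a::euclidean_space \<Rightarrow> real"
  assumes "harmonic_span h" "i \<in> Basis" "DIM('a) \<ge> 2"
  shows "\<exists>h'. harmonic_span h' \<and> (\<forall>x. norm x = 1 \<longrightarrow> h' x = (x \<bullet> i) * h x)"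
  using assms(1)
proof induction
  case (homog k h)
  define c where "c = 1 / (DIM('a) + 2 * (real k - 1))"
  have g: "harmonic_span (pd i h)"
  proof (cases k)
    case 0
    then have "pd i h = (\<lambda>x. 0)"
      using homog_harmonic_minus_one[of "pd i h"] homog_harmonic_pd[OF homog] by simp
    then show ?thesis by (simp add: harmonic_span_const)
  next
    case (Suc j)
    then show ?thesis using homog_harmonic_pd[OF homog, of i] by (intro harmonic_span.homog[of j])
        simp
  qed
  have "harmonic_span (\<lambda>x. ((x \<bullet> i) * h x + (- c) * ((x \<bullet> x) * pd i h x)) + c * pd i h x)"
    unfolding c_def
    by (intro harmonic_span.add harmonic_span.homog[OF homog_harmonic_raise] homog assms g
        harmonic_span_cmult)
  moreover have "((x \<bullet> i) * h x + (- c) * ((x \<bullet> x) * pd i h x)) + c * pd i h x = (x \<bullet> i) * h x"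
    if "norm x = 1" for x using that by (simp add: dot_square_norm)
  ultimately show ?case by blast
next
  case (add f g)
  then obtain f' g' where "harmonic_span f'" "harmonic_span g'"
    "\<And>x. norm x = 1 \<Longrightarrow> f' x = (x \<bullet> i) * f x" "\<And>x. norm x = 1 \<Longrightarrow> g' x = (x \<bullet> i) * g x" by blast
  then show ?case
    by (intro exI[of _ "\<lambda>x. f' x + g' x"]) (simp add: harmonic_span.add distrib_left)
qed

text \<open>Multiplying an arbitrary \<open>h\<close>, rather than extending \<open>p\<close> alone,
  is what lets the induction pass through products: the factor \<open>g\<close> is absorbed first,
  then \<open>f\<close>.\<close>

lemma harmonic_span_mult_polynomial:
  fixes h :: "'a::euclidean_space \<Rightarrow> real"
  assumes "real_polynomial_function p" "harmonic_span h" "DIM('a) \<ge> 2"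
  shows "\<exists>h'. harmonic_span h' \<and> (\<forall>x. norm x = 1 \<longrightarrow> h' x = p x * h x)"
  using assms(1,2)
proof (induction arbitrary: h)
  case (linear f)
  have "\<forall>i\<in>Basis. \<exists>h'. harmonic_span h' \<and> (\<forall>x. norm x = 1 \<longrightarrow> h' x = (x \<bullet> i) * h x)"
    using harmonic_span_mult_coordinate linear assms(3) by blast
  then obtain H where H: "\<And>i. i \<in> Basis \<Longrightarrow> harmonic_span (H i)"
    "\<And>i x. i \<in> Basis \<Longrightarrow> norm x = 1 \<Longrightarrow> H i x = (x \<bullet> i) * h x"
    by metis
  have f: "f x = (\<Sum>i\<in>Basis. (x \<bullet> i) * f i)" for x
  proof -
    have "f x = f (\<Sum>b\<in>Basis. (x \<bullet> b) *\<^sub>R b)" by (simp add: euclidean_representation)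
    then show ?thesis
      using linear_sum[of f "\<lambda>b. (x \<bullet> b) *\<^sub>R b" Basis] linear(1)
      by (simp add: bounded_linear.linear linear_scale)
  qed
  have "(\<Sum>i\<in>Basis. f i * H i x) = f x * h x" if "norm x = 1" for x
    using H(2) that by (simp add: f[of x] sum_distrib_right mult.assoc mult.left_commute)
  then show ?case
    by (intro exI[of _ "\<lambda>x. \<Sum>i\<in>Basis. f i * H i x"])
      (auto intro!: harmonic_span_sum harmonic_span_cmult H)
next
  case (const c)
  then show ?case by (intro exI[of _ "\<lambda>x. c * h x"]) (simp add: harmonic_span_cmult)
next
  case (add f g)
  then obtain f' g' where "harmonic_span f'" "harmonic_span g'"
    "\<And>x. norm x = 1 \<Longrightarrow> f' x = f x * h x" "\<And>x. norm x = 1 \<Longrightarrow> g' x = g x * h x" by blast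
  then show ?case
    by (intro exI[of _ "\<lambda>x. f' x + g' x"]) (simp add: harmonic_span.add distrib_right)
next
  case (mult f g)
  then obtain g' where g: "harmonic_span g'" "\<And>x. norm x = 1 \<Longrightarrow> g' x = g x * h x" by blast
  then obtain f' where "harmonic_span f'" "\<And>x. norm x = 1 \<Longrightarrow> f' x = f x * g' x" using mult by blast
  with g show ?case by (intro exI[of _ f']) simp
qed

lemma harmonic_on_sphere:
  fixes p :: "'a::euclidean_space \<Rightarrow> real"
  assumes "real_polynomial_function p" "DIM('a) \<ge> 2"
  obtains h where "real_polynomial_function h" "\<And>x. laplacian h x = 0" "\<And>x. norm x = 1 \<Longrightarrow> h x = p x"
  using harmonic_span_mult_polynomial[OF assms(1) harmonic_span_const[of 1] assms(2)]
    harmonic_span_imp by auto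

subsection \<open>Averages of viscosity subsolutions of the Poisson equation\<close>

text \<open>Polynomial tests suffice for the comparison with polynomial solutions of the Poisson
  equation, and after an affine change of variables they are still smooth tests for
  \<open>visc_ma_ge\<close>.\<close>

definition visc_laplacian_ge :: "'a::euclidean_space set \<Rightarrow> real \<Rightarrow> ('a \<Rightarrow> real) \<Rightarrow> bool" where
  "visc_laplacian_ge S c v \<longleftrightarrow> (\<forall>x\<in>S. \<forall>q. real_polynomial_function q \<and> v x = q x \<and>
     (\<forall>\<^sub>F y in nhds x. v y \<le> q y) \<longrightarrow> c \<le> laplacian q x)"

text \<open>On the unit sphere \<open>q\<close> equals \<open>h\<close>, while
  \<open>v 0 - q 0 = t > 0\<close>. So \<open>v - q\<close> has an interior maximum, where a
  vertical shift of \<open>q\<close> touches \<open>v\<close> from above although its Laplacian is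
  less than \<open>c\<close>.\<close>

lemma visc_laplacian_comparison:
  fixes v :: "'a::euclidean_space \<Rightarrow> real"
  assumes v: "visc_laplacian_ge (ball 0 1) c v" "continuous_on (cball 0 1) v"
    and h: "real_polynomial_function h" "\<And>x. laplacian h x = c" "\<And>x. norm x = 1 \<Longrightarrow> v x \<le> h x"
  shows "v 0 \<le> h 0"
proof (rule ccontr)
  assume "\<not> v 0 \<le> h 0"
  define t where "t = (v 0 - h 0) / 2"
  have t: "t > 0" using \<open>\<not> v 0 \<le> h 0\<close> by (simp add: t_def)
  define q where "q x = (h x + t) + (- t) * (x \<bullet> x)" for x
  have rq: "real_polynomial_function q"
    unfolding q_def[abs_def] by (intro rpf_add rpf_mult rpf_const rpf_inner_self h)
  have lq: "laplacian q x = c - 2 * t * DIM('a)" for x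
    unfolding q_def[abs_def]
    by (simp only: laplacian_add laplacian_cmult laplacian_const laplacian_inner_self
        rpf_add rpf_mult rpf_const rpf_inner_self h)
  have "continuous_on (cball 0 1) (\<lambda>x. v x - q x)"
    by (intro continuous_intros v continuous_on_polymonial_function rq[unfolded
        real_polynomial_function_eq])
  then obtain x where x: "x \<in> cball 0 1" "\<And>y. y \<in> cball 0 1 \<Longrightarrow> v y - q y \<le> v x - q x"
    using continuous_attains_sup[of "cball (0::'a) 1" "\<lambda>x. v x - q x"] by auto
  have "v 0 - q 0 = t" by (simp add: q_def t_def field_simps)
  then have "t \<le> v x - q x" using x(2)[of 0] by simp
  moreover have "v x - q x \<le> 0" if "norm x = 1"
    using h(3)[OF that] that by (simp add: q_def dot_square_norm)
  ultimately have xb: "x \<in> ball 0 1" using x(1) t by (cases "norm x = 1") auto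
  have "\<forall>\<^sub>F y in nhds x. y \<in> ball 0 1" using xb by (intro eventually_nhds_in_open) auto
  then have "\<forall>\<^sub>F y in nhds x. v y \<le> q y + (v x - q x)"
    by (rule eventually_mono) (use x(2) in \<open>force simp: algebra_simps\<close>)
  moreover have "real_polynomial_function (\<lambda>y. q y + (v x - q x))" by (intro rpf_add rq rpf_const)
  ultimately have "c \<le> laplacian (\<lambda>y. q y + (v x - q x)) x"
    using v(1) xb unfolding visc_laplacian_ge_def by fastforce
  then have "c \<le> laplacian q x" by (simp only: laplacian_add rq rpf_const laplacian_const)
  moreover have "0 < t * DIM('a)" using t by simp
  ultimately show False using lq[of x] by simp
qed

lemma poisson_majorant_on_sphere:
  fixes v :: "'a::euclidean_space \<Rightarrow> real"
  assumes v: "continuous_on (cball 0 1) v" and m: "DIM('a) \<ge> 2" and e: "e > 0"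
  obtains h where "real_polynomial_function h" "\<And>x. laplacian h x = c"
    "\<And>x. norm x = 1 \<Longrightarrow> v x \<le> h x" "\<And>x. norm x = 1 \<Longrightarrow> h x \<le> v x + e"
proof -
  have "continuous_on (sphere 0 1) v" using v by (rule continuous_on_subset) auto
  from Stone_Weierstrass_real_polynomial_function[OF compact_sphere this, of "e/2"] e
  obtain p where p: "real_polynomial_function p" "\<And>x. x \<in> sphere 0 1 \<Longrightarrow> \<bar>v x - p x\<bar> < e/2" by auto
  obtain h where h: "real_polynomial_function h" "\<And>x. laplacian h x = 0" "\<And>x. norm x = 1 \<Longrightarrow> h x
      = p x"
    using harmonic_on_sphere[OF p(1) m] by blast
  define k where "k = c / (2 * DIM('a))"
  \<comment> \<open>On the unit sphere \<open>k * (x \<bullet> x)\<close> cancels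
    \<open>- k\<close>, so \<open>H\<close> exceeds the harmonic extension of \<open>p\<close> by
    exactly \<open>e/2\<close>, the error of the polynomial approximation; the value of
    \<open>k\<close> makes the Laplacian equal to \<open>c\<close>.\<close>
  define H where "H x = (h x + (e/2 - k)) + k * (x \<bullet> x)" for x
  have "real_polynomial_function H"
    unfolding H_def[abs_def] by (intro rpf_add rpf_mult rpf_const rpf_inner_self h)
  moreover have "laplacian H x = c" for x
    unfolding H_def[abs_def]
    by (simp only: laplacian_add laplacian_cmult laplacian_const laplacian_inner_self
        rpf_add rpf_mult rpf_const rpf_inner_self h) (simp add: k_def)
  moreover have "v x \<le> H x \<and> H x \<le> v x + e" if "norm x = 1" for x
    proof -
    have "\<bar>v x - p x\<bar> < e / 2" "H x = p x + e / 2"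
      using p(2)[of x] h(3)[OF that] that by (auto simp: H_def dot_square_norm)
    then show ?thesis by linarith
  qed
  ultimately show ?thesis using that by blast
qed

text \<open>On the line through \<open>x\<close> in direction \<open>b\<close>, a negative second
  derivative would make the first derivative \<open>\<psi>\<close> negative just to the right of
  \<open>0\<close>, and the mean value theorem would give a value below the minimum.
  Differentiability of \<open>\<psi>\<close> is used at \<open>0\<close> only.\<close>

lemma second_derivative_nonneg_at_min:
  fixes f :: "'a::real_normed_vector \<Rightarrow> real"
  assumes U: "open U" "x \<in> U" and min: "\<And>y. y \<in> U \<Longrightarrow> f x \<le> f y"
    and D: "\<And>y. y \<in> U \<Longrightarrow> (f has_derivative D y) (at y)"
    and E: "((\<lambda>y. D y b) has_derivative E) (at x)"
  shows "0 \<le> E b"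
proof (rule ccontr)
  assume neg: "\<not> 0 \<le> E b"
  have "open ((\<lambda>t. x + t *\<^sub>R b) -` U)" using U(1) by (intro open_vimage) (auto intro!:
      continuous_intros)
  moreover have "0 \<in> (\<lambda>t. x + t *\<^sub>R b) -` U" using U(2) by simp
  ultimately obtain d where "d > 0" "ball 0 d \<subseteq> (\<lambda>t. x + t *\<^sub>R b) -` U"
    using open_contains_ball by blast
  then have d: "d > 0" "\<And>t. \<bar>t\<bar> < d \<Longrightarrow> x + t *\<^sub>R b \<in> U"
    by (auto simp: subset_iff)
  define \<psi> where "\<psi> t = D (x + t *\<^sub>R b) b" for t
  have f': "((\<lambda>t. f (x + t *\<^sub>R b)) has_real_derivative \<psi> t) (at t)" if "\<bar>t\<bar> < d" for t
  proof -
    have "((\<lambda>t. f (x + t *\<^sub>R b)) has_derivative (\<lambda>s. D (x + t *\<^sub>R b) (s *\<^sub>R b))) (at t)"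
      by (rule has_derivative_compose[of "\<lambda>t. x + t *\<^sub>R b" "\<lambda>s. s *\<^sub>R b" t UNIV f])
        (auto intro!: derivative_eq_intros D d that)
    moreover have "D (x + t *\<^sub>R b) (s *\<^sub>R b) = s * \<psi> t" for s
      using linear_scale[OF has_derivative_linear[OF D[OF d(2)[OF that]]]] by (simp add: \<psi>_def)
    ultimately show ?thesis by (simp add: has_field_derivative_def mult.commute[of _ "\<psi> t"]
        fun_eq_iff)
  qed
  have "((\<lambda>t. D (x + t *\<^sub>R b) b) has_derivative (\<lambda>s. E (s *\<^sub>R b))) (at 0)"
    by (rule has_derivative_compose[of "\<lambda>t. x + t *\<^sub>R b" "\<lambda>s. s *\<^sub>R b" 0 UNIV "\<lambda>y. D y b"])
      (auto intro!: derivative_eq_intros E)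
  moreover have "E (s *\<^sub>R b) = E b * s" for s
    using linear_scale[OF has_derivative_linear[OF E]] by simp
  ultimately have \<psi>': "(\<psi> has_real_derivative E b) (at 0)"
    by (simp add: has_field_derivative_def \<psi>_def[abs_def])
  have "\<psi> 0 = 0"
    by (rule DERIV_local_min[OF f'[of 0] d(1)]) (use d min in auto)
  obtain d2 where d2: "d2 > 0" "\<And>h. 0 < h \<Longrightarrow> h < d2 \<Longrightarrow> \<psi> h < \<psi> 0"
    using DERIV_neg_dec_right[OF \<psi>'] neg by auto
  define h where "h = min d d2 / 2"
  have h: "0 < h" "h < d" "h < d2" using d d2 by (auto simp: h_def min_def)
  obtain z where z: "0 < z" "z < h" "f (x + h *\<^sub>R b) - f (x + 0 *\<^sub>R b) = (h - 0) * \<psi> z"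
    using MVT2[of 0 h "\<lambda>t. f (x + t *\<^sub>R b)" \<psi>] h f' by (metis abs_of_nonneg order_le_less_trans)
  have "\<psi> z < 0" using d2(2)[of z] z h \<open>\<psi> 0 = 0\<close> by simp
  then have "f (x + h *\<^sub>R b) - f x < 0" using z h by (simp add: mult_less_0_iff)
  then show False using min[OF d(2)[of h]] h by simp
qed

text \<open>A tagged division fine enough for the uniform continuity of \<open>v\<close> works for
  all \<open>x\<close> in \<open>K\<close> at once. The weights are the masses of
  \<open>\<rho>\<close> on the cells, so they are nonnegative and sum to exactly
  \<open>1\<close>.\<close>

lemma average_finite_approximation:
  fixes \<rho> :: "'b::euclidean_space \<Rightarrow> real" and v :: "'b \<Rightarrow> 'a::metric_space \<Rightarrow> real"
  assumes v: "continuous_on (cbox a b \<times> K) (\<lambda>(y, x). v y x)" and K: "compact K"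
    and \<rho>: "continuous_on (cbox a b) \<rho>" "\<And>y. y \<in> cbox a b \<Longrightarrow> 0 \<le> \<rho> y" "integral (cbox a b) \<rho> = 1"
    and e: "e > 0"
  shows "\<exists>(I :: ('b \<times> 'b set) set) w. finite I \<and> (\<forall>i\<in>I. 0 \<le> w i \<and> fst i \<in> cbox a b) \<and> sum w I = 1 \<and>
    (\<forall>x\<in>K. \<bar>integral (cbox a b) (\<lambda>y. \<rho> y * v y x) - (\<Sum>i\<in>I. w i * v (fst i) x)\<bar> \<le> e)"
proof -
  have "uniformly_continuous_on (cbox a b \<times> K) (\<lambda>(y, x). v y x)"
    by (intro compact_uniformly_continuous v compact_Times K compact_cbox)
  then obtain d where d: "d > 0"
    "\<And>y y' x. y \<in> cbox a b \<Longrightarrow> y' \<in> cbox a b \<Longrightarrow> x \<in> K \<Longrightarrow> dist y y' < d \<Longrightarrow> \<bar>v y x - v y' x\<bar> < e"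
    unfolding uniformly_continuous_on_def using e
    by (force simp: dist_Pair_Pair dist_real_def)
  have "gauge (\<lambda>y::'b. ball y d)" using d(1) by (simp add: gauge_ball)
  then obtain p where p: "p tagged_division_of (cbox a b)" "(\<lambda>y. ball y d) fine p"
    using fine_division_exists by blast
  define w where "w = (\<lambda>(y::'b, k). integral k \<rho>)"
  have \<rho>i: "\<rho> integrable_on cbox a b" by (rule integrable_continuous[OF \<rho>(1)])
  have k: "y \<in> cbox a b" "k \<subseteq> cbox a b" "\<exists>s t. k = cbox s t" "k \<subseteq> ball y d" if "(y, k) \<in> p" for y k
    using tagged_division_ofD(2,3,4)[OF p(1) that] p(2) that by (auto simp: fine_def)
  have cv: "continuous_on (cbox a b) (\<lambda>y. v y x)" if "x \<in> K" for x
    by (rule continuous_on_compose2[OF v, of _ "\<lambda>y. (y, x)", simplified])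
      (auto intro!: continuous_intros that)
  have main: "\<bar>integral (cbox a b) (\<lambda>y. \<rho> y * v y x) - (\<Sum>i\<in>p. w i * v (fst i) x)\<bar> \<le> e" if x:
      "x \<in> K" for x
  proof -
    let ?f = "\<lambda>y. \<rho> y * v y x"
    have ci: "continuous_on (cbox a b) ?f" by (intro continuous_intros \<rho> cv x)
    have "integral (cbox a b) ?f = (\<Sum>(y, k)\<in>p. integral k ?f)"
      by (rule integral_combine_tagged_division_topdown[OF integrable_continuous[OF ci] p(1)])
    then have "\<bar>integral (cbox a b) ?f - (\<Sum>i\<in>p. w i * v (fst i) x)\<bar>
        = \<bar>\<Sum>(y, k)\<in>p. integral k ?f - w (y, k) * v y x\<bar>"
      by (simp add: sum_subtractf split_def)
    also have "\<dots> \<le> (\<Sum>(y, k)\<in>p. e * w (y, k))"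
    proof (rule order_trans[OF sum_abs], rule sum_mono, clarify)
      fix y k assume yk: "(y, k) \<in> p"
      obtain s t where st: "k = cbox s t" using k(3)[OF yk] by blast
      have sub: "cbox s t \<subseteq> cbox a b" using k(2)[OF yk] st by simp
      have c1: "continuous_on k ?f" "continuous_on k \<rho>"
        using ci \<rho>(1) sub unfolding st by (auto intro: continuous_on_subset)
      have i: "?f integrable_on k" "\<rho> integrable_on k" using c1 unfolding st by (auto intro:
          integrable_continuous)
      have "integral k ?f - w (y, k) * v y x = integral k (\<lambda>y'. ?f y' - \<rho> y' * v y x)"
        by (simp add: w_def integral_diff[OF i(1) integrable_on_mult_left[OF i(2)]])
      also have "norm \<dots> \<le> integral k (\<lambda>y'. e * \<rho> y')"
      proof (rule integral_norm_bound_integral)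
        show "(\<lambda>y'. ?f y' - \<rho> y' * v y x) integrable_on k" using i by (intro integrable_diff
            integrable_on_mult_left)
        show "(\<lambda>y'. e * \<rho> y') integrable_on k" using i by (intro integrable_on_mult_right)
        fix y' assume y': "y' \<in> k"
        have y'c: "y' \<in> cbox a b" "dist y' y < d" using y' k[OF yk] by (auto simp: dist_commute)
        have "\<bar>v y' x - v y x\<bar> \<le> e" using d(2)[OF y'c(1) k(1)[OF yk] x y'c(2)] by simp
        then have "\<rho> y' * \<bar>v y' x - v y x\<bar> \<le> \<rho> y' * e" by (rule mult_left_mono) (rule \<rho>(2)[OF
            y'c(1)])
        then show "norm (?f y' - \<rho> y' * v y x) \<le> e * \<rho> y'"
          using \<rho>(2)[OF y'c(1)] by (simp add: right_diff_distrib[symmetric] abs_mult mult.commute)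
      qed
      also have "\<dots> = e * w (y, k)" by (simp add: w_def)
      finally show "\<bar>integral k ?f - w (y, k) * v y x\<bar> \<le> e * w (y, k)" by simp
    qed
    also have "\<dots> = e * (\<Sum>(y, k)\<in>p. integral k \<rho>)" by (simp add: w_def sum_distrib_left split_def)
    also have "\<dots> = e" using integral_combine_tagged_division_topdown[OF \<rho>i p(1)] \<rho>(3) by simp
    finally show ?thesis .
  qed
  have "sum w p = 1"
    using integral_combine_tagged_division_topdown[OF \<rho>i p(1)] \<rho>(3) by (simp add: w_def)
  moreover have "0 \<le> w i" if "i \<in> p" for i
  proof -
    obtain y k' where i: "i = (y, k')" by (cases i)
    then have "\<rho> integrable_on k'" using that k[of y k'] \<rho>i integrable_on_subcbox by blast
    then show ?thesis using that k[of y k'] \<rho>(2) by (auto simp: w_def i intro!: integral_nonneg)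
  qed
  moreover have "fst i \<in> cbox a b" if "i \<in> p" for i using k(1)[of "fst i" "snd i"] that by simp
  ultimately show ?thesis
    using main tagged_division_of_finite[OF p(1)] by blast
qed

text \<open>Were the Laplacian at most \<open>c - \<eta>\<close> on the whole ball, let
  \<open>H\<close> be a convex combination of polynomial Poisson majorants of finitely many
  \<open>v y\<close>. Comparison gives \<open>G 0 \<le> H 0 + e\<close>, while
  \<open>H \<le> G + 2 * e\<close> on the sphere. Hence
  \<open>G - H + \<sigma> * (x \<bullet> x)\<close> attains its minimum inside, where its Laplacian
  must be nonnegative.\<close>

lemma laplacian_average_ge:
  fixes \<rho> :: "'b::euclidean_space \<Rightarrow> real" and v :: "'b \<Rightarrow> 'a::euclidean_space \<Rightarrow> real"
  assumes m: "DIM('a) \<ge> 2"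
    and cont: "continuous_on (cbox a b \<times> cball 0 1) (\<lambda>(y, x). v y x)"
    and sub: "\<And>y. y \<in> cbox a b \<Longrightarrow> visc_laplacian_ge (ball 0 1) c (v y)"
    and \<rho>: "continuous_on (cbox a b) \<rho>" "\<And>y. y \<in> cbox a b \<Longrightarrow> 0 \<le> \<rho> y" "integral (cbox a b) \<rho> = 1"
    and G: "\<And>x. x \<in> cball 0 1 \<Longrightarrow> G x = integral (cbox a b) (\<lambda>y. \<rho> y * v y x)"
    and cG: "continuous_on (cball 0 1) G"
    and D: "\<And>x. x \<in> ball 0 1 \<Longrightarrow> (G has_derivative D x) (at x)"
    and E: "\<And>x b. x \<in> ball 0 1 \<Longrightarrow> b \<in> Basis \<Longrightarrow> ((\<lambda>x. D x b) has_derivative E x b) (at x)"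
    and \<eta>: "\<eta> > 0"
  shows "\<exists>x\<in>ball 0 1. c - \<eta> < (\<Sum>b\<in>Basis. E x b b)"
proof (rule ccontr)
  assume "\<not> ?thesis"
  then have le: "(\<Sum>b\<in>Basis. E x b b) \<le> c - \<eta>" if "x \<in> ball 0 1" for x using that by force
  \<comment> \<open>\<open>\<sigma> * (x \<bullet> x)\<close> has Laplacian
    \<open>\<eta> / 2\<close>, half of the assumed deficit. With \<open>e = \<sigma> / 6\<close> the
    lower bound \<open>\<sigma> - 2 * e = 4 * e\<close> on the sphere stays above the value at the
    centre, which is at most \<open>e\<close>.\<close>
  define \<sigma> where "\<sigma> = \<eta> / (4 * DIM('a))"
  have \<sigma>: "\<sigma> > 0" using \<eta> by (simp add: \<sigma>_def)
  define e where "e = \<sigma> / 6"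
  have e: "e > 0" using \<sigma> by (simp add: e_def)
  obtain I and w :: "'b \<times> 'b set \<Rightarrow> real" where I: "finite I" "\<And>i. i \<in> I \<Longrightarrow> 0 \<le> w i"
    "\<And>i. i \<in> I \<Longrightarrow> fst i \<in> cbox a b" "sum w I = 1"
    "\<And>x. x \<in> cball 0 1 \<Longrightarrow> \<bar>integral (cbox a b) (\<lambda>y. \<rho> y * v y x) - (\<Sum>i\<in>I. w i * v (fst i) x)\<bar> \<le> e"
    using average_finite_approximation[OF cont compact_cball \<rho> e] by blast
  have cv: "continuous_on (cball 0 1) (v y)" if "y \<in> cbox a b" for y
    by (rule continuous_on_compose2[OF cont, of _ "\<lambda>x. (y, x)", simplified])
      (auto intro!: continuous_intros that)
  have "\<forall>i\<in>I. \<exists>h. real_polynomial_function h \<and> (\<forall>x. laplacian h x = c) \<and>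
      (\<forall>x. norm x = 1 \<longrightarrow> v (fst i) x \<le> h x \<and> h x \<le> v (fst i) x + e)"
    using poisson_majorant_on_sphere[OF cv m e, of _ c] I(3) by metis
  then obtain h where h: "\<And>i. i \<in> I \<Longrightarrow> real_polynomial_function (h i)"
      "\<And>i x. i \<in> I \<Longrightarrow> laplacian (h i) x = c"
      "\<And>i x. i \<in> I \<Longrightarrow> norm x = 1 \<Longrightarrow> v (fst i) x \<le> h i x"
      "\<And>i x. i \<in> I \<Longrightarrow> norm x = 1 \<Longrightarrow> h i x \<le> v (fst i) x + e" by metis
  define H where "H x = (\<Sum>i\<in>I. w i * h i x)" for x
  have rH: "real_polynomial_function H"
    unfolding H_def[abs_def] by (intro real_polynomial_function_sum rpf_mult rpf_const h I)
  have lH: "laplacian H x = c" for x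
  proof -
    have "laplacian H x = (\<Sum>i\<in>I. w i * c)"
      unfolding H_def[abs_def]
      by (simp add: laplacian_sum I h rpf_mult rpf_const laplacian_cmult)
    then show ?thesis by (simp add: sum_distrib_right[symmetric] I)
  qed
  have Hs: "H x \<le> G x + 2 * e" if "norm x = 1" for x
  proof -
    have "H x \<le> (\<Sum>i\<in>I. w i * (v (fst i) x + e))"
      unfolding H_def using h(4)[OF _ that] I(2) by (intro sum_mono mult_left_mono) auto
    also have "\<dots> = (\<Sum>i\<in>I. w i * v (fst i) x) + e"
      by (simp add: distrib_left sum.distrib sum_distrib_right[symmetric] I)
    also have "\<dots> \<le> G x + 2 * e" using I(5)[of x] G[of x] that by (simp add: abs_le_iff)
    finally show ?thesis .
  qed
  have H0: "G 0 \<le> H 0 + e"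
  proof -
    have "v (fst i) 0 \<le> h i 0" if "i \<in> I" for i
      by (rule visc_laplacian_comparison[OF sub[OF I(3)[OF that]] cv[OF I(3)[OF that]] h(1)[OF
          that]])
        (use h that in auto)
    then have "(\<Sum>i\<in>I. w i * v (fst i) 0) \<le> H 0"
      unfolding H_def by (intro sum_mono mult_left_mono I) auto
    then show ?thesis using I(5)[of 0] G[of 0] by (simp add: abs_le_iff)
  qed
  define q where "q x = (- 1) * H x + \<sigma> * (x \<bullet> x)" for x
  have rq: "real_polynomial_function q"
    unfolding q_def[abs_def] by (intro rpf_add rpf_mult rpf_const rpf_inner_self rH)
  have lq: "laplacian q x = \<eta> / 2 - c" for x
    unfolding q_def[abs_def]
    by (simp only: laplacian_add laplacian_cmult laplacian_inner_self rpf_mult rpf_const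
        rpf_inner_self rH lH)
      (simp add: \<sigma>_def)
  have "continuous_on (cball 0 1) (\<lambda>x. G x + q x)"
    by (intro continuous_intros cG continuous_on_polymonial_function rq[unfolded
        real_polynomial_function_eq])
  then obtain x where x: "x \<in> cball 0 1" "\<And>y. y \<in> cball 0 1 \<Longrightarrow> G x + q x \<le> G y + q y"
    using continuous_attains_inf[of "cball (0::'a) 1" "\<lambda>x. G x + q x"] by auto
  have "G x + q x \<le> e" using x(2)[of 0] H0 by (simp add: q_def)
  moreover have "G x + q x \<ge> \<sigma> - 2 * e" if "norm x = 1"
    using Hs[OF that] that by (simp add: q_def dot_square_norm)
  ultimately have xb: "x \<in> ball 0 1" using x(1) \<sigma> by (cases "norm x = 1") (auto simp: e_def)
  have "0 \<le> E x b b + pd b (pd b q) x" if b: "b \<in> Basis" for b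
  proof (rule second_derivative_nonneg_at_min[of "ball 0 1" x "\<lambda>x. G x + q x"
      "\<lambda>y v. D y v + pd v q y" b
        "\<lambda>v. E x b v + pd v (pd b q) x"])
    show "((\<lambda>x. G x + q x) has_derivative (\<lambda>v. D y v + pd v q y)) (at y)" if "y \<in> ball 0 1" for y
      by (intro has_derivative_add D that rpf_has_derivative rq)
    show "((\<lambda>y. D y b + pd b q y) has_derivative (\<lambda>v. E x b v + pd v (pd b q) x)) (at x)"
      by (intro has_derivative_add E xb b rpf_has_derivative rpf_pd rq)
  qed (use xb x in auto)
  then have "0 \<le> (\<Sum>b\<in>Basis. E x b b + pd b (pd b q) x)" by (rule sum_nonneg)
  also have "\<dots> \<le> (c - \<eta>) + (\<eta> / 2 - c)"
    using le[OF xb] lq[of x] by (simp add: sum.distrib laplacian_def)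
  finally show False using \<eta> by simp
qed

subsection \<open>Hermitian matrices\<close>

definition hermitian :: "complex ^ 'n ^ 'n \<Rightarrow> bool" where
  "hermitian P \<longleftrightarrow> (\<forall>j k. P $ k $ j = cnj (P $ j $ k))"

text \<open>The row index is paired with \<open>\<xi>\<close> and the column index with its
  conjugate, as in \<open>ddc_nonneg\<close>. Consequently \<open>P\<close> acts on row vectors, by
  \<open>x v* P\<close>, and eigenvectors appear as the rows of a matrix.\<close>

definition hform :: "complex ^ 'n ^ 'n \<Rightarrow> complex ^ 'n \<Rightarrow> real" where
  "hform P \<xi> = Re (\<Sum>j\<in>UNIV. \<Sum>k\<in>UNIV. P $ j $ k * \<xi> $ j * cnj (\<xi> $ k))"

definition hdot :: "complex ^ 'n \<Rightarrow> complex ^ 'n \<Rightarrow> complex" where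
  "hdot x y = (\<Sum>i\<in>UNIV. x $ i * cnj (y $ i))"

definition adjoint_matrix :: "complex ^ 'n ^ 'n \<Rightarrow> complex ^ 'n ^ 'n" where
  "adjoint_matrix A = (\<chi> i j. cnj (A $ j $ i))"

definition unitary :: "complex ^ 'n ^ 'n \<Rightarrow> bool" where
  "unitary A \<longleftrightarrow> A ** adjoint_matrix A = mat 1 \<and> adjoint_matrix A ** A = mat 1"

definition diag_conj :: "complex ^ 'n ^ 'n \<Rightarrow> ('n \<Rightarrow> real) \<Rightarrow> complex ^ 'n ^ 'n" where
  "diag_conj A d = adjoint_matrix A ** (\<chi> i j. if i = j then complex_of_real (d i) else 0) ** A"

lemma Re_hdot: "Re (hdot x y) = x \<bullet> y"
  by (simp add: hdot_def inner_vec_def inner_complex_def)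

lemma hdot_add_left: "hdot (x + y) z = hdot x z + hdot y z"
  by (simp add: hdot_def algebra_simps sum.distrib)

lemma hdot_diff_left: "hdot (x - y) z = hdot x z - hdot y z"
  by (simp add: hdot_def algebra_simps sum_subtractf)

lemma hdot_scale_left: "hdot (c *s x) z = c * hdot x z"
  by (simp add: hdot_def algebra_simps sum_distrib_left)

lemma hdot_scale_right: "hdot x (c *s z) = cnj c * hdot x z"
  by (simp add: hdot_def algebra_simps sum_distrib_left)

lemma hdot_commute: "hdot y x = cnj (hdot x y)"
  by (simp add: hdot_def mult.commute)

lemma hdot_self: "hdot x x = complex_of_real (x \<bullet> x)"
proof (rule complex_eqI)
  show "Im (hdot x x) = Im (complex_of_real (x \<bullet> x))"
    by (simp add: hdot_def)
qed (simp add: Re_hdot)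

lemma scaleR_vec_complex: "r *\<^sub>R x = complex_of_real r *s (x :: complex ^ 'n)"
  by (simp add: vec_eq_iff scaleR_conv_of_real[where 'a=complex])

section \<open>The spectral theorem for Hermitian matrices\<close>

lemma linear_coefficient_zero:
  fixes a b :: real
  assumes "\<And>t. 0 \<le> 2 * t * a + t\<^sup>2 * b"
  shows "a = 0"
proof (rule ccontr)
  assume a: "a \<noteq> 0"
  define c where "c = \<bar>b\<bar> + 1"
  have c: "c > 0" by (simp add: c_def)
  have "b < 2 * c" by (simp add: c_def abs_if)
  have "0 \<le> 2 * (- a / c) * a + (- a / c)\<^sup>2 * b" using assms .
  also have "\<dots> = (a / c)\<^sup>2 * (b - 2 * c)" using c by (simp add: power2_eq_square field_simps)
  also have "\<dots> < 0" using a c \<open>b < 2 * c\<close> by (intro mult_pos_neg) auto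
  finally show False by simp
qed

text \<open>Each new eigenvector maximizes the quadratic form on the unit sphere of the complement
  \<open>V\<close> of those already found. The first variation makes
  \<open>\<mu> *\<^sub>R x - T x\<close> orthogonal to \<open>V\<close>; self-adjointness puts this
  vector into \<open>V\<close>, so it is zero. The set \<open>S\<close> grows up to
  \<open>UNIV\<close>, which yields a full basis indexed by \<open>'n\<close>.\<close>

lemma hermitian_eigenbasis:
  fixes P :: "complex ^ 'n ^ 'n" and S :: "'n set"
  assumes P: "hermitian P"
  shows "\<exists>u d. (\<forall>i\<in>S. u i v* P = complex_of_real (d i) *s u i) \<and>
    (\<forall>i\<in>S. \<forall>l\<in>S. hdot (u i) (u l) = (if i = l then 1 else 0))"
proof (induction rule: finite_induct[OF finite[of S]])
  case 1
  then show ?case by simp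
next
  case (2 k S)
  define T where "T x = x v* P" for x
  have Tn: "T x $ k = (\<Sum>j\<in>UNIV. P $ j $ k * x $ j)" for x k
    by (simp add: T_def vector_matrix_mult_def mult.commute)
  have Tadd: "T (x + y) = T x + T y" and Tsc: "T (c *s x) = c *s T x" for x y c
    by (simp_all add: vec_eq_iff Tn algebra_simps sum.distrib sum_distrib_left)
  have hP: "cnj (P $ j $ k) = P $ k $ j" for j k
    using P by (metis hermitian_def)
  have Tself: "hdot (T x) y = hdot x (T y)" for x y
  proof -
    have "hdot (T x) y = (\<Sum>k\<in>UNIV. \<Sum>j\<in>UNIV. P $ j $ k * x $ j * cnj (y $ k))"
      by (simp add: hdot_def Tn sum_distrib_right)
    also have "\<dots> = (\<Sum>j\<in>UNIV. \<Sum>k\<in>UNIV. P $ j $ k * x $ j * cnj (y $ k))" by (rule sum.swap)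
    also have "\<dots> = hdot x (T y)"
      using hP by (simp add: hdot_def Tn sum_distrib_left algebra_simps)
    finally show ?thesis .
  qed
  have Tcont: "continuous_on X T" for X
    unfolding T_def vector_matrix_mult_def by (intro continuous_intros)
  obtain u d where u: "\<And>i. i \<in> S \<Longrightarrow> T (u i) = complex_of_real (d i) *s u i"
    "\<And>i l. i \<in> S \<Longrightarrow> l \<in> S \<Longrightarrow> hdot (u i) (u l) = (if i = l then 1 else 0)"
    using 2(3) unfolding T_def by blast
  define V where "V = {x. \<forall>i\<in>S. hdot x (u i) = 0}"
  \<comment> \<open>Real orthogonality to both \<open>u i\<close> and \<open>\<i> *s u i\<close> is
    the vanishing of the complex number \<open>hdot y (u i)\<close>. The real dimension of the span,
    at most \<open>2 * card S\<close>, is below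
    \<open>DIM(complex ^ 'n) = 2 * CARD('n)\<close>.\<close>
  define B where "B = u ` S \<union> (\<lambda>i. \<i> *s u i) ` S"
  have "card S < CARD('n)" using 2(2) by (metis UNIV_I finite psubsetI psubset_card_mono
      subset_UNIV)
  moreover have "card B \<le> card S + card S"
    unfolding B_def by (rule order_trans[OF card_Un_le add_mono]) (simp_all add: card_image_le)
  moreover have "dim B \<le> card B" by (rule dim_le_card') (simp add: B_def)
  ultimately have "dim B < DIM(complex ^ 'n)" by simp
  then obtain y where y: "y \<noteq> 0" "\<And>x. x \<in> span B \<Longrightarrow> orthogonal y x"
    using orthogonal_to_subspace_exists by blast
  have yV: "y \<in> V"
  proof -
    have "hdot y (u i) = 0" if "i \<in> S" for i
    proof (rule complex_eqI)
      show "Re (hdot y (u i)) = Re 0"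
        using y(2)[OF span_base, of "u i"] that by (simp add: B_def orthogonal_def Re_hdot)
      have "y \<bullet> (\<i> *s u i) = 0"
        using y(2)[OF span_base, of "\<i> *s u i"] that by (simp add: B_def orthogonal_def)
      then have "Re (hdot y (\<i> *s u i)) = 0" by (simp add: Re_hdot)
      then show "Im (hdot y (u i)) = Im 0" by (simp add: hdot_scale_right)
    qed
    then show ?thesis by (simp add: V_def)
  qed
  have Vsc: "c *s x \<in> V" and Vadd: "x + z \<in> V" if "x \<in> V" "z \<in> V" for c x z
    using that by (auto simp: V_def hdot_scale_left hdot_add_left)
  have "closed V"
    unfolding V_def hdot_def Collect_ball_eq by (intro closed_INT ballI closed_Collect_eq
        continuous_intros)
  then have "compact (sphere 0 1 \<inter> V)" by (intro compact_Int_closed) auto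
  moreover have "(1 / norm y) *\<^sub>R y \<in> sphere 0 1 \<inter> V"
    using y(1) Vsc[OF yV yV] by (simp add: scaleR_vec_complex[symmetric] del: scaleR_vec_complex)
      (simp add: scaleR_vec_complex)
  moreover have "continuous_on (sphere 0 1 \<inter> V) (\<lambda>x. T x \<bullet> x)" by (intro continuous_intros Tcont)
  ultimately obtain x where x: "x \<in> sphere 0 1 \<inter> V"
    "\<And>z. z \<in> sphere 0 1 \<inter> V \<Longrightarrow> T z \<bullet> z \<le> T x \<bullet> x"
    using continuous_attains_sup[of "sphere 0 1 \<inter> V" "\<lambda>x. T x \<bullet> x"] by blast
  have xV: "x \<in> V" and xn: "x \<bullet> x = 1" using x(1) by (auto simp: dot_square_norm)
  define \<mu> where "\<mu> = T x \<bullet> x"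
  have le: "T z \<bullet> z \<le> \<mu> * (z \<bullet> z)" if z: "z \<in> V" for z
  proof (cases "z = 0")
    case False
    define z' where "z' = (1 / norm z) *\<^sub>R z"
    have "z' \<in> sphere 0 1 \<inter> V"
      using False Vsc[OF z z] by (simp add: z'_def scaleR_vec_complex[symmetric] del:
          scaleR_vec_complex)
        (simp add: scaleR_vec_complex)
    from x(2)[OF this] have "T z' \<bullet> z' \<le> \<mu>" by (simp add: \<mu>_def)
    moreover have "T z' = (1 / norm z) *\<^sub>R T z" by (simp add: z'_def scaleR_vec_complex Tsc)
    ultimately have "T z \<bullet> z / (norm z)\<^sup>2 \<le> \<mu>" by (simp add: z'_def power2_eq_square)
    then show ?thesis using False by (simp add: dot_square_norm field_simps)
  qed (simp add: T_def)
  have orth: "(\<mu> *\<^sub>R x - T x) \<bullet> z = 0" if z: "z \<in> V" for z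
  proof (rule linear_coefficient_zero[where b="\<mu> * (z \<bullet> z) - T z \<bullet> z"])
    fix t :: real
    have "x + t *\<^sub>R z \<in> V" using Vadd[OF xV Vsc[OF z z]] by (simp add: scaleR_vec_complex)
    from le[OF this] have "T (x + t *\<^sub>R z) \<bullet> (x + t *\<^sub>R z) \<le> \<mu> * ((x + t *\<^sub>R z) \<bullet> (x + t *\<^sub>R z))" .
    moreover have "T (x + t *\<^sub>R z) = T x + t *\<^sub>R T z" by (simp add: scaleR_vec_complex Tadd Tsc)
    moreover have "T z \<bullet> x = T x \<bullet> z"
      by (metis Tself Re_hdot inner_commute)
    ultimately show "0 \<le> 2 * t * ((\<mu> *\<^sub>R x - T x) \<bullet> z) + t\<^sup>2 * (\<mu> * (z \<bullet> z) - T z \<bullet> z)"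
      using xn \<mu>_def
      by (simp add: inner_add_left inner_add_right inner_diff_left inner_commute[of z x]
          power2_eq_square algebra_simps)
  qed
  have "\<mu> *\<^sub>R x - T x \<in> V"
    using xV u(1) by (simp add: V_def hdot_diff_left scaleR_vec_complex hdot_scale_left Tself
        hdot_scale_right)
  from orth[OF this] have Tx: "T x = complex_of_real \<mu> *s x" by (simp add: scaleR_vec_complex)
  define u' d' where "u' = u(k := x)" and "d' = d(k := \<mu>)"
  have "\<forall>i\<in>insert k S. T (u' i) = complex_of_real (d' i) *s u' i"
    using 2(2) u(1) Tx by (auto simp: u'_def d'_def)
  moreover have "\<forall>i\<in>insert k S. \<forall>l\<in>insert k S. hdot (u' i) (u' l) = (if i = l then 1 else 0)"
  proof -
    have "hdot x x = 1" by (simp add: hdot_self xn)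
    moreover have "hdot x (u i) = 0" "hdot (u i) x = 0" if "i \<in> S" for i
      using xV that by (simp_all add: V_def hdot_commute[of "u i" x])
    ultimately show ?thesis using 2(2) u(2) by (auto simp: u'_def)
  qed
  ultimately show ?case unfolding T_def by blast
qed

lemma adjoint_matrix_mult: "adjoint_matrix (A ** B) = adjoint_matrix B ** adjoint_matrix A"
  by (simp add: adjoint_matrix_def matrix_matrix_mult_def vec_eq_iff mult.commute)

lemma hermitian_spectral:
  fixes P :: "complex ^ 'n ^ 'n"
  assumes "hermitian P"
  obtains A d where "unitary A" "P = diag_conj A d"
proof -
  define E where "E u d \<longleftrightarrow> (\<forall>i\<in>UNIV. u i v* P = complex_of_real (d i) *s u i) \<and>
    (\<forall>i\<in>UNIV. \<forall>l\<in>UNIV. hdot (u i) (u l) = (if i = l then 1 else 0))" for u :: "'n \<Rightarrow> complex ^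
        'n" and d
  have "\<exists>u d. E u d" unfolding E_def by (rule hermitian_eigenbasis[OF assms])
  then obtain u d where E: "E u d" by blast
  have u: "u i v* P = complex_of_real (d i) *s u i" "hdot (u i) (u l) = (if i = l then 1 else 0)"
      for i l
    using E unfolding E_def by blast+
  define A where "A = (\<chi> i. u i)"
  define D where "D = (\<chi> i j. if i = j then complex_of_real (d i) else 0)"
  have 1: "A ** adjoint_matrix A = mat 1"
    using u(2) by (simp add: vec_eq_iff A_def adjoint_matrix_def matrix_matrix_mult_def mat_def
        hdot_def)
  then have 2: "adjoint_matrix A ** A = mat 1" using matrix_left_right_inverse by blast
  have "A ** P = D ** A"
  proof -
    have "(A ** P) $ i $ k = (D ** A) $ i $ k" for i k
    proof -
      have "(A ** P) $ i $ k = (u i v* P) $ k"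
        by (simp add: A_def matrix_matrix_mult_def vector_matrix_mult_def mult.commute)
      also have "\<dots> = complex_of_real (d i) * u i $ k" by (simp add: u)
      also have "\<dots> = (D ** A) $ i $ k"
        by (simp add: matrix_matrix_mult_def D_def A_def if_distrib[of "\<lambda>x. x * _"] cong: if_cong)
      finally show ?thesis .
    qed
    then show ?thesis by (simp add: vec_eq_iff)
  qed
  then have "adjoint_matrix A ** A ** P = adjoint_matrix A ** D ** A"
    by (simp add: matrix_mul_assoc[symmetric])
  then have "P = diag_conj A d" using 2 by (simp add: diag_conj_def D_def matrix_mul_lid)
  then show ?thesis using that 1 2 unitary_def by blast
qed

lemma diag_conj_nth:
  "diag_conj A d $ j $ k = (\<Sum>i\<in>UNIV. complex_of_real (d i) * cnj (A $ i $ j) * A $ i $ k)"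
proof -
  have "(\<Sum>l\<in>UNIV. adjoint_matrix A $ j $ l * (if l = i then complex_of_real (d l) else 0))
      = complex_of_real (d i) * cnj (A $ i $ j)" for i
    by (simp add: adjoint_matrix_def if_distrib[of "\<lambda>x. _ * x"] mult.commute cong: if_cong)
  then show ?thesis
    by (simp add: diag_conj_def matrix_matrix_mult_def)
qed

lemma det_adjoint_matrix: "det (adjoint_matrix A) = cnj (det (A :: complex ^ 'n ^ 'n))"
proof -
  have "det (adjoint_matrix A) = det (\<chi> i j. cnj (A $ i $ j))"
    by (subst det_transpose[symmetric]) (simp add: transpose_def adjoint_matrix_def)
  then show ?thesis by (simp add: det_def)
qed

lemma det_unitary:
  assumes "unitary A"
  shows "det A * cnj (det A) = 1"
  using assms by (metis unitary_def det_mul det_I det_adjoint_matrix)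

lemma cmod_det_unitary:
  assumes "unitary A"
  shows "cmod (det A) = 1"
proof -
  have "(cmod (det A))\<^sup>2 = 1" using det_unitary[OF assms] complex_norm_square[of "det A"] by
      (metis of_real_eq_1_iff)
  then show ?thesis by (simp add: power2_eq_1_iff) (use norm_ge_zero[of "det A"] in linarith)
qed

lemma det_diag_conj:
  assumes "unitary A"
  shows "det (diag_conj A d) = complex_of_real (\<Prod>i\<in>UNIV. d i)"
proof -
  have "det (diag_conj A d) = cnj (det A) * (\<Prod>i\<in>UNIV. complex_of_real (d i)) * det A"
    by (simp add: diag_conj_def det_mul det_adjoint_matrix det_diagonal)
  also have "\<dots> = (det A * cnj (det A)) * (\<Prod>i\<in>UNIV. complex_of_real (d i))" by (simp add: mult_ac)
  finally show ?thesis by (simp add: det_unitary[OF assms])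
qed

lemma hform_diag_conj:
  "hform (diag_conj A d) \<xi> = (\<Sum>i\<in>UNIV. d i * (cmod (hdot \<xi> (A $ i)))\<^sup>2)"
proof -
  have "(\<Sum>j\<in>UNIV. \<Sum>k\<in>UNIV. diag_conj A d $ j $ k * \<xi> $ j * cnj (\<xi> $ k))
     = (\<Sum>j\<in>UNIV. \<Sum>k\<in>UNIV. \<Sum>i\<in>UNIV. complex_of_real (d i) * ((\<xi> $ j * cnj (A $ i $ j)) * cnj (\<xi> $ k
         * cnj (A $ i $ k))))"
    by (simp add: diag_conj_nth sum_distrib_left sum_distrib_right algebra_simps)
  also have "\<dots> = (\<Sum>j\<in>UNIV. \<Sum>i\<in>UNIV. \<Sum>k\<in>UNIV. complex_of_real (d i) * ((\<xi> $ j * cnj (A $ i $ j)) *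
      cnj (\<xi> $ k * cnj (A $ i $ k))))"
    by (intro sum.cong refl sum.swap)
  also have "\<dots> = (\<Sum>i\<in>UNIV. \<Sum>j\<in>UNIV. \<Sum>k\<in>UNIV. complex_of_real (d i) * ((\<xi> $ j * cnj (A $ i $ j)) *
      cnj (\<xi> $ k * cnj (A $ i $ k))))"
    by (rule sum.swap)
  also have "\<dots> = (\<Sum>i\<in>UNIV. complex_of_real (d i) * (hdot \<xi> (A $ i) * cnj (hdot \<xi> (A $ i))))"
  proof -
    have "hdot \<xi> a * cnj (hdot \<xi> a)
        = (\<Sum>j\<in>UNIV. \<Sum>k\<in>UNIV. (\<xi> $ j * cnj (a $ j)) * cnj (\<xi> $ k * cnj (a $ k)))" for a
      unfolding hdot_def cnj_sum by (rule sum_product)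
    then show ?thesis by (simp only: sum_distrib_left)
  qed
  also have "\<dots> = (\<Sum>i\<in>UNIV. complex_of_real (d i * (cmod (hdot \<xi> (A $ i)))\<^sup>2))"
    by (simp only: of_real_mult complex_norm_square)
  finally show ?thesis by (simp add: hform_def)
qed

text \<open>Parseval's identity, read off from \<open>hform_diag_conj\<close> with all eigenvalues
  \<open>1\<close>.\<close>

lemma sum_cmod_hdot_unitary:
  assumes "unitary A"
  shows "(\<Sum>i\<in>UNIV. (cmod (hdot \<xi> (A $ i)))\<^sup>2) = (norm \<xi>)\<^sup>2"
proof -
  have "diag_conj A (\<lambda>i. 1) = mat 1"
    using assms by (simp add: diag_conj_def unitary_def mat_def[symmetric] matrix_mul_rid)
  then have "hform (diag_conj A (\<lambda>i. 1)) \<xi> = hform (mat 1) \<xi>" by simp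
  moreover have "hform (mat 1) \<xi> = Re (hdot \<xi> \<xi>)"
    unfolding hform_def hdot_def mat_def
    by (simp add: if_distrib[of "\<lambda>x. x * _"] cong: if_cong)
  ultimately show ?thesis by (simp add: hform_diag_conj Re_hdot dot_square_norm)
qed

lemma hdot_unitary_rows:
  assumes "unitary A"
  shows "hdot (A $ i) (A $ l) = (if i = l then 1 else 0)"
proof -
  have "hdot (A $ i) (A $ l) = (A ** adjoint_matrix A) $ i $ l"
    by (simp add: hdot_def matrix_matrix_mult_def adjoint_matrix_def)
  then show ?thesis using assms by (simp add: unitary_def mat_def)
qed

lemma hform_scale: "hform P (c *s \<xi>) = (cmod c)\<^sup>2 * hform P \<xi>"
proof -
  have "(\<Sum>j\<in>UNIV. \<Sum>k\<in>UNIV. P $ j $ k * (c *s \<xi>) $ j * cnj ((c *s \<xi>) $ k))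
     = (c * cnj c) * (\<Sum>j\<in>UNIV. \<Sum>k\<in>UNIV. P $ j $ k * \<xi> $ j * cnj (\<xi> $ k))"
    by (simp add: sum_distrib_left algebra_simps)
  then show ?thesis by (simp add: hform_def complex_norm_square[symmetric] flip: of_real_power)
qed

lemma hform_diag_conj_row:
  assumes "unitary A"
  shows "hform (diag_conj A d) (A $ i) = d i"
  by (simp add: hform_diag_conj hdot_unitary_rows[OF assms] if_distrib[of cmod] if_distrib[of
      "\<lambda>x. x^2"]
      if_distrib[of "\<lambda>x. _ * x"] cong: if_cong)

lemma diag_conj_nonneg:
  assumes "unitary A" "\<And>\<xi>. 0 \<le> hform (diag_conj A d) \<xi>"
  shows "0 \<le> d i"
  using assms(2)[of "A $ i"] hform_diag_conj_row[OF assms(1)] by simp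

section \<open>Determinant bounds as families of trace bounds\<close>

lemma root_det_le_trace:
  fixes P :: "complex ^ 'n ^ 'n"
  assumes P: "hermitian P" "\<And>\<xi>. 0 \<le> hform P \<xi>"
  shows "CARD('n) * root CARD('n) (Re (det P)) \<le> (\<Sum>i\<in>UNIV. Re (P $ i $ i))"
proof -
  obtain A d where A: "unitary A" and Pd: "P = diag_conj A d" using hermitian_spectral[OF P(1)] by
      blast
  have d: "0 \<le> d i" for i using diag_conj_nonneg[OF A] P(2) Pd by blast
  have "(\<Sum>i\<in>UNIV. Re (P $ i $ i)) = (\<Sum>j\<in>UNIV. \<Sum>i\<in>UNIV. d i * (cmod (A $ i $ j))\<^sup>2)"
  proof -
    have "Re (complex_of_real r * cnj a * a) = r * (cmod a)\<^sup>2" for r a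
      unfolding cmod_power2 by (simp add: algebra_simps power2_eq_square)
    then show ?thesis unfolding Pd diag_conj_nth by (simp only: Re_sum)
  qed
  also have "\<dots> = (\<Sum>i\<in>UNIV. \<Sum>j\<in>UNIV. d i * (cmod (A $ i $ j))\<^sup>2)" by (rule sum.swap)
  also have "\<dots> = (\<Sum>i\<in>UNIV. d i)"
  proof (rule sum.cong[OF refl])
    fix i
    have "complex_of_real (\<Sum>j\<in>UNIV. (cmod (A $ i $ j))\<^sup>2) = hdot (A $ i) (A $ i)"
      by (simp only: hdot_def of_real_sum complex_norm_square)
    then have "(\<Sum>j\<in>UNIV. (cmod (A $ i $ j))\<^sup>2) = 1"
      using hdot_unitary_rows[OF A, of i i] by (metis of_real_eq_1_iff)
    then show "(\<Sum>j\<in>UNIV. d i * (cmod (A $ i $ j))\<^sup>2) = d i"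
      by (simp add: sum_distrib_left[symmetric])
  qed
  finally have tr: "(\<Sum>i\<in>UNIV. Re (P $ i $ i)) = (\<Sum>i\<in>UNIV. d i)" .
  \<comment> \<open>The inequality of arithmetic and geometric means. A zero product is treated
    apart because \<open>root\<close> is converted to \<open>powr\<close> for positive
    arguments.\<close>
  have "root CARD('n) (\<Prod>i\<in>UNIV. d i) \<le> (\<Sum>i\<in>UNIV. d i) / CARD('n)"
  proof (cases "(\<Prod>i\<in>UNIV. d i) = 0")
    case False
    then have "(\<Prod>i\<in>UNIV. d i) > 0" using d by (simp add: less_le prod_nonneg)
    then show ?thesis
      using arith_geom_mean[of UNIV d] d by (simp add: root_powr_inverse sum_divide_distrib)
  next
    case True
    show ?thesis unfolding True by (simp add: d sum_nonneg)
  qed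
  then show ?thesis unfolding tr using det_diag_conj[OF A, of d] Pd by (simp add: field_simps del:
      of_real_prod)
qed

lemma congruence_nth:
  "(A ** P ** adjoint_matrix A) $ i $ l = (\<Sum>j\<in>UNIV. \<Sum>k\<in>UNIV. P $ j $ k * A $ i $ j * cnj (A $ l $
      k))"
proof -
  have "(A ** P ** adjoint_matrix A) $ i $ l = (\<Sum>k\<in>UNIV. \<Sum>j\<in>UNIV. P $ j $ k * A $ i $ j * cnj (A $
      l $ k))"
    by (simp add: matrix_matrix_mult_def adjoint_matrix_def sum_distrib_left sum_distrib_right
        mult_ac)
  also have "\<dots> = (\<Sum>j\<in>UNIV. \<Sum>k\<in>UNIV. P $ j $ k * A $ i $ j * cnj (A $ l $ k))" by (rule sum.swap)
  finally show ?thesis .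
qed

lemma hform_congruence:
  fixes P A :: "complex ^ 'n ^ 'n"
  shows
  "hform (A ** P ** adjoint_matrix A) \<xi> = hform P (\<xi> v* A)"
proof -
  \<comment> \<open>All rows of \<open>B\<close> equal \<open>\<xi>\<close>, so every diagonal entry
    of \<open>B ** Q ** adjoint_matrix B\<close> has the form at \<open>\<xi>\<close> as its real
    part, and the identity becomes associativity of matrix multiplication.\<close>
  define B :: "complex ^ 'n ^ 'n" where "B = (\<chi> i. \<xi>)"
  have *: "hform Q \<eta> = Re ((B' ** Q ** adjoint_matrix B') $ i $ i)" if "B' $ i = \<eta>" for Q \<eta> B' and
      i :: 'n
    using that by (simp add: hform_def congruence_nth)
  have "(B ** A) $ i = \<xi> v* A" for i
    by (simp add: B_def vec_eq_iff matrix_matrix_mult_def vector_matrix_mult_def mult.commute)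
  from *[OF this, of P] have "hform P (\<xi> v* A)
      = Re ((B ** A ** P ** adjoint_matrix (B ** A)) $ i $ i)" for i .
  moreover have "hform (A ** P ** adjoint_matrix A) \<xi>
      = Re ((B ** (A ** P ** adjoint_matrix A) ** adjoint_matrix B) $ i $ i)" for i
    by (rule *) (simp add: B_def)
  ultimately show ?thesis by (simp add: adjoint_matrix_mult matrix_mul_assoc)
qed

text \<open>\<open>root_det_le_trace\<close> for the congruent matrix
  \<open>A ** P ** adjoint_matrix A\<close>: its diagonal entries are the values of the form on the
  rows of \<open>A\<close>, and its determinant picks up \<open>(cmod (det A))\<^sup>2\<close>. For
  fixed \<open>A\<close> the right-hand side is linear in \<open>P\<close>, so the bound can pass
  through averages.\<close>

lemma hermitian_trace_lower_bound:
  fixes P A :: "complex ^ 'n ^ 'n"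
  assumes P: "hermitian P" "\<And>\<xi>. 0 \<le> hform P \<xi>" and \<beta>: "\<beta> \<le> Re (det P)"
  shows "CARD('n) * root CARD('n) (\<beta> * (cmod (det A))\<^sup>2) \<le> (\<Sum>i\<in>UNIV. hform P (A $ i))"
proof -
  define Q where "Q = A ** P ** adjoint_matrix A"
  have "hermitian Q"
    unfolding hermitian_def
  proof (intro allI)
    fix j k
    have "adjoint_matrix Q = Q"
    proof -
      have "adjoint_matrix P $ j $ k = P $ j $ k" for j k
        using P(1)[unfolded hermitian_def, rule_format, of j k] by (simp add: adjoint_matrix_def)
      then have "adjoint_matrix P = P" by (simp add: vec_eq_iff)
      moreover have "adjoint_matrix (adjoint_matrix A) = A" by (simp add: adjoint_matrix_def
          vec_eq_iff)
      ultimately show ?thesis by (simp only: Q_def adjoint_matrix_mult matrix_mul_assoc)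
    qed
    then have "adjoint_matrix Q $ k $ j = Q $ k $ j" by simp
    then show "Q $ k $ j = cnj (Q $ j $ k)" by (simp add: adjoint_matrix_def)
  qed
  moreover have "0 \<le> hform Q \<xi>" for \<xi> using P(2) by (simp add: Q_def hform_congruence)
  ultimately have "CARD('n) * root CARD('n) (Re (det Q)) \<le> (\<Sum>i\<in>UNIV. Re (Q $ i $ i))"
    by (rule root_det_le_trace)
  moreover have "Re (Q $ i $ i) = hform P (A $ i)" for i
    by (simp add: Q_def congruence_nth hform_def)
  moreover have "det Q = det P * complex_of_real ((cmod (det A))\<^sup>2)"
    unfolding complex_norm_square by (simp add: Q_def det_mul det_adjoint_matrix mult_ac)
  then have "Re (det Q) = Re (det P) * (cmod (det A))\<^sup>2" by simp
  moreover have "root CARD('n) (\<beta> * (cmod (det A))\<^sup>2)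
      \<le> root CARD('n) (Re (det P) * (cmod (det A))\<^sup>2)"
    using \<beta> by (intro real_root_le_mono mult_right_mono) auto
  ultimately have "root CARD('n) (\<beta> * (cmod (det A))\<^sup>2) \<le> root CARD('n) (Re (det Q))"
    and "CARD('n) * root CARD('n) (Re (det Q)) \<le> (\<Sum>i\<in>UNIV. hform P (A $ i))"
    by simp_all
  then show ?thesis by (meson mult_left_mono of_nat_0_le_iff order_trans)
qed

text \<open>Scaling the rows of the diagonalizing unitary matrix by \<open>sqrt (e i)\<close> turns
  the hypothesis into an inequality for sums of the eigenvalues \<open>d i\<close> with arbitrary
  positive weights \<open>e i\<close>. Small weights off one index exclude a negative eigenvalue
  there. The weights \<open>1 / (d i + \<epsilon>)\<close>, which make all terms nearly equal when
  the eigenvalues are positive, give the determinant as \<open>\<epsilon>\<close> tends to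
  \<open>0\<close>.\<close>

lemma hermitian_of_trace_lower_bounds:
  fixes P :: "complex ^ 'n ^ 'n"
  assumes P: "hermitian P" and \<beta>: "0 \<le> \<beta>"
    and tr: "\<And>A. det A \<noteq> 0 \<Longrightarrow>
      CARD('n) * root CARD('n) (\<beta> * (cmod (det A))\<^sup>2) \<le> (\<Sum>i\<in>UNIV. hform P (A $ i))"
  shows "0 \<le> hform P \<xi>" "\<beta> \<le> Re (det P)"
proof -
  obtain U d where U: "unitary U" and Pd: "P = diag_conj U d" using hermitian_spectral[OF P] by
      blast
  have tr': "CARD('n) * root CARD('n) (\<beta> * (\<Prod>i\<in>UNIV. e i)) \<le> (\<Sum>i\<in>UNIV. e i * d i)"
    if e: "\<And>i. e i > 0" for e :: "'n \<Rightarrow> real"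
  proof -
    define A where "A = (\<chi> i. complex_of_real (sqrt (e i)) *s U $ i)"
    have "det A = complex_of_real (\<Prod>i\<in>UNIV. sqrt (e i)) * det U"
      unfolding A_def using det_rows_mul[of "\<lambda>i. complex_of_real (sqrt (e i))" "\<lambda>i. U $ i"] by simp
    then have cA: "cmod (det A) = (\<Prod>i\<in>UNIV. sqrt (e i))"
      using e by (simp add: norm_mult cmod_det_unitary[OF U] prod_nonneg less_imp_le flip:
          of_real_prod)
    then have "(cmod (det A))\<^sup>2 = (\<Prod>i\<in>UNIV. e i)"
      using e by (simp add: prod_power_distrib less_imp_le)
    moreover have "det A \<noteq> 0"
      using cA e by (metis norm_zero prod_zero_iff finite real_sqrt_eq_zero_cancel_iff less_irrefl)
    moreover have "hform P (A $ i) = e i * d i" for i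
      using e[of i] by (simp add: A_def hform_scale Pd hform_diag_conj_row[OF U])
    ultimately show ?thesis using tr[of A] by simp
  qed
  have d: "0 \<le> d i" for i
  proof (rule ccontr)
    assume neg: "\<not> 0 \<le> d i"
    \<comment> \<open>The other eigenvalues contribute at most \<open>\<epsilon> * D\<close>, which
      the choice of \<open>\<epsilon>\<close> makes equal to \<open>- d i / 2\<close>; the weighted
      sum is then at most \<open>d i / 2 < 0\<close>.\<close>
    define D where "D = (\<Sum>l\<in>UNIV. \<bar>d l\<bar>) + 1"
    have D: "D > 0" by (simp add: D_def add_nonneg_pos sum_nonneg)
    define \<epsilon> where "\<epsilon> = - d i / (2 * D)"
    have \<epsilon>: "\<epsilon> > 0" using neg D by (simp add: \<epsilon>_def divide_neg_pos)
    define e where "e l = (if l = i then 1 else \<epsilon>)" for l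
    have "0 \<le> \<beta> * (\<Prod>l\<in>UNIV. e l)" using \<epsilon> \<beta> by (simp add: e_def prod_nonneg)
    then have "0 \<le> CARD('n) * root CARD('n) (\<beta> * (\<Prod>l\<in>UNIV. e l))" by simp
    also have "\<dots> \<le> (\<Sum>l\<in>UNIV. e l * d l)" by (rule tr') (simp add: e_def \<epsilon>)
    also have "\<dots> = d i + (\<Sum>l\<in>UNIV - {i}. \<epsilon> * d l)"
      by (subst sum.remove[of _ i]) (auto simp: e_def)
    also have "(\<Sum>l\<in>UNIV - {i}. \<epsilon> * d l) \<le> (\<Sum>l\<in>UNIV. \<epsilon> * \<bar>d l\<bar>)"
      using \<epsilon> by (intro order_trans[OF sum_mono sum_mono2]) auto
    also have "\<dots> \<le> \<epsilon> * D" using \<epsilon> by (simp add: D_def sum_distrib_left[symmetric])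
    also have "\<epsilon> * D = - d i / 2" using D by (simp add: \<epsilon>_def)
    finally show False using neg by simp
  qed
  show "0 \<le> hform P \<xi>" unfolding Pd hform_diag_conj by (intro sum_nonneg) (simp add: d)
  have le: "\<beta> \<le> (\<Prod>i\<in>UNIV. d i + \<epsilon>)" if \<epsilon>: "\<epsilon> > 0" for \<epsilon>
  proof -
    have pos: "d i + \<epsilon> > 0" for i using d[of i] \<epsilon> by simp
    have "CARD('n) * root CARD('n) (\<beta> * (\<Prod>i\<in>UNIV. 1 / (d i + \<epsilon>))) \<le> (\<Sum>i\<in>UNIV. 1 / (d i + \<epsilon>) * d i)"
      by (rule tr') (simp add: pos)
    also have "\<dots> \<le> (\<Sum>i\<in>(UNIV::'n set). 1)"
      using pos \<epsilon> by (intro sum_mono) (simp add: divide_le_eq)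
    finally have "root CARD('n) (\<beta> * (\<Prod>i\<in>UNIV. 1 / (d i + \<epsilon>))) \<le> 1" by simp
    then have "\<beta> * (\<Prod>i\<in>UNIV. 1 / (d i + \<epsilon>)) \<le> 1" by simp
    moreover have "(\<Prod>i\<in>UNIV. d i + \<epsilon>) > 0" using pos by (intro prod_pos) auto
    ultimately show ?thesis by (simp add: prod_dividef divide_le_eq)
  qed
  have "((\<lambda>\<epsilon>. \<Prod>i\<in>UNIV. d i + \<epsilon>) \<longlongrightarrow> (\<Prod>i\<in>UNIV. d i + 0)) (at_right 0)"
    by (intro tendsto_intros)
  then have "\<beta> \<le> (\<Prod>i\<in>UNIV. d i + 0)"
    by (rule tendsto_lowerbound) (auto intro!: eventually_at_rightI[of 0 1] le)
  then show "\<beta> \<le> Re (det P)" using det_diag_conj[OF U, of d] Pd by (simp del: of_real_prod)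
qed

lemma diag_conj_add: "diag_conj A d + diag_conj A r = diag_conj A (\<lambda>i. d i + r i)"
  by (simp add: vec_eq_iff diag_conj_nth sum.distrib algebra_simps)

lemma diag_conj_const:
  assumes "unitary A"
  shows "diag_conj A (\<lambda>i. c) = mat (complex_of_real c)"
proof -
  have "diag_conj A (\<lambda>i. 1) = mat 1"
    using assms by (simp add: diag_conj_def unitary_def mat_def[symmetric] matrix_mul_rid)
  then have "diag_conj A (\<lambda>i. 1) $ j $ k = mat 1 $ j $ k" for j k by simp
  then have "complex_of_real c * diag_conj A (\<lambda>i. 1) $ j $ k = mat (complex_of_real c) $ j $ k"
      for j k
    by (simp add: mat_def)
  then show ?thesis by (simp add: vec_eq_iff diag_conj_nth sum_distrib_left mult.assoc)
qed

text \<open>The mixed terms dropped from the expanded product are nonnegative. For empty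
  \<open>I\<close> the claim would read \<open>1 + 1 \<le> 1\<close>.\<close>

lemma prod_add_ge:
  fixes d :: "'i \<Rightarrow> real"
  assumes "finite I" "I \<noteq> {}" "\<And>i. 0 \<le> d i" "0 \<le> c"
  shows "(\<Prod>i\<in>I. d i) + c ^ card I \<le> (\<Prod>i\<in>I. d i + c)"
  using assms(1,2)
proof (induction rule: finite_ne_induct)
  case (insert x I)
  have "d x * prod d I + c * c ^ card I \<le> (d x + c) * (prod d I + c ^ card I)"
    using assms(3,4) prod_nonneg[of I d] by (simp add: algebra_simps)
  also have "\<dots> \<le> (d x + c) * (\<Prod>i\<in>I. d i + c)"
    using insert assms(3,4) by (intro mult_left_mono) auto
  finally show ?case using insert by simp
qed simp

text \<open>The gain \<open>c ^ CARD('n)\<close> does not depend on \<open>P\<close>. It supplies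
  the strictness of the comparison, also where the density \<open>f\<close> vanishes.\<close>

lemma det_add_scalar_ge:
  fixes P :: "complex ^ 'n ^ 'n"
  assumes "hermitian P" "\<And>\<xi>. 0 \<le> hform P \<xi>" "0 \<le> c"
  shows "Re (det P) + c ^ CARD('n) \<le> Re (det (P + mat (complex_of_real c)))"
proof -
  obtain A d where A: "unitary A" and Pd: "P = diag_conj A d" using hermitian_spectral[OF
      assms(1)] by blast
  have d: "0 \<le> d i" for i using diag_conj_nonneg[OF A] assms(2) Pd by blast
  have "P + mat (complex_of_real c) = diag_conj A (\<lambda>i. d i + c)"
    by (simp add: Pd diag_conj_const[OF A, symmetric] diag_conj_add)
  then show ?thesis using prod_add_ge[of UNIV d c] d assms(3)
    by (simp add: det_diag_conj[OF A] Pd del: of_real_prod)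
qed

text \<open>\<open>r\<close> vanishes at one index with a negative eigenvalue and lifts every other
  eigenvalue to at least \<open>1\<close>, so the product of the shifted eigenvalues has exactly one
  negative factor.\<close>

lemma hermitian_negative_det:
  fixes P :: "complex ^ 'n ^ 'n"
  assumes "hermitian P" "hform P \<xi> < 0"
  obtains A r where "unitary A" "\<And>i. 0 \<le> r i" "Re (det (P + diag_conj A r)) < 0"
proof -
  obtain A d where A: "unitary A" and Pd: "P = diag_conj A d" using hermitian_spectral[OF
      assms(1)] by blast
  have "\<exists>i. d i < 0"
  proof (rule ccontr)
    assume "\<nexists>i. d i < 0"
    then have "0 \<le> hform P \<xi>" unfolding Pd hform_diag_conj by (intro sum_nonneg) (simp add:
        not_less)
    then show False using assms(2) by simp
  qed
  then obtain i where i: "d i < 0" by blast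
  define r where "r l = (if l = i then 0 else 1 + \<bar>d l\<bar>)" for l
  have "(\<Prod>l\<in>UNIV. d l + r l) = d i * (\<Prod>l\<in>UNIV - {i}. d l + r l)"
    by (subst prod.remove[of _ i]) (auto simp: r_def)
  moreover have "(\<Prod>l\<in>UNIV - {i}. d l + r l) > 0" by (intro prod_pos) (auto simp: r_def)
  ultimately have "(\<Prod>l\<in>UNIV. d l + r l) < 0" using i by (simp add: mult_neg_pos)
  then have "Re (det (P + diag_conj A r)) < 0"
    by (simp add: Pd diag_conj_add det_diag_conj[OF A] del: of_real_prod)
  then show ?thesis using that[of A r] A by (simp add: r_def)
qed

lemma hform_positive_definite:
  fixes P :: "complex ^ 'n ^ 'n"
  assumes "hermitian P" "\<And>\<xi>. 0 \<le> hform P \<xi>" "Re (det P) \<noteq> 0"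
  obtains c where "c > 0" "\<And>\<xi>. c * (norm \<xi>)\<^sup>2 \<le> hform P \<xi>"
proof -
  obtain A d where A: "unitary A" and Pd: "P = diag_conj A d" using hermitian_spectral[OF
      assms(1)] by blast
  have d: "0 \<le> d i" for i using diag_conj_nonneg[OF A] assms(2) Pd by blast
  have nz: "d i \<noteq> 0" for i
    using assms(3) det_diag_conj[OF A, of d] by (auto simp: Pd prod_zero_iff simp del: of_real_prod)
  have "0 < d i" for i using d[of i] nz[of i] by simp
  then have "Min (range d) > 0" by simp
  moreover have "Min (range d) * (norm \<xi>)\<^sup>2 \<le> hform P \<xi>" for \<xi>
    unfolding Pd hform_diag_conj sum_cmod_hdot_unitary[OF A, symmetric] sum_distrib_left
    by (intro sum_mono mult_right_mono) auto
  ultimately show ?thesis using that by blast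
qed

lemma hform_diff_le:
  fixes P Q :: "complex ^ 'n ^ 'n"
  shows "hform P \<xi> - hform Q \<xi> \<le> (\<Sum>j\<in>UNIV. \<Sum>k\<in>UNIV. cmod (P $ j $ k - Q $ j $ k)) * (norm \<xi>)\<^sup>2"
proof -
  have "hform P \<xi> - hform Q \<xi> = Re (\<Sum>j\<in>UNIV. \<Sum>k\<in>UNIV. (P $ j $ k - Q $ j $ k) * \<xi> $ j * cnj (\<xi> $
      k))"
    by (simp add: hform_def sum_subtractf algebra_simps)
  also have "\<dots> \<le> cmod (\<Sum>j\<in>UNIV. \<Sum>k\<in>UNIV. (P $ j $ k - Q $ j $ k) * \<xi> $ j * cnj (\<xi> $ k))"
    by (rule complex_Re_le_cmod)
  also have "\<dots> \<le> (\<Sum>j\<in>UNIV. \<Sum>k\<in>UNIV. cmod (P $ j $ k - Q $ j $ k) * (norm \<xi>)\<^sup>2)"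
    by (intro sum_norm_le)
      (auto simp: norm_mult power2_eq_square mult.assoc intro!: mult_left_mono mult_mono
          Finite_Cartesian_Product.norm_nth_le)
  finally show ?thesis by (simp add: sum_distrib_right)
qed

subsection \<open>The complex Hessian of a function of class C2\<close>

text \<open>\<open>C2_near\<close> with its witnesses as parameters and without base point, so that
  one derivative \<open>D\<close> and one Hessian \<open>H\<close> serve all points of
  \<open>U\<close>.\<close>

definition c2_data where
  "c2_data U q D H \<longleftrightarrow> open U \<and> (\<forall>z\<in>U. (q has_derivative D z) (at z) \<and>
     (\<forall>v. ((\<lambda>x. D x v) has_derivative H z v) (at z))) \<and> (\<forall>v w. continuous_on U (\<lambda>z. H z v w))"
  for q :: "'a::real_normed_vector \<Rightarrow> real"

lemma C2_near_iff: "C2_near q z0 \<longleftrightarrow> (\<exists>U D H. z0 \<in> U \<and> c2_data U q D H)"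
  unfolding C2_near_def c2_data_def by auto

lemma c2_dataD:
  assumes "c2_data U q D H"
  shows "open U" "\<And>z. z \<in> U \<Longrightarrow> (q has_derivative D z) (at z)"
    "\<And>z v. z \<in> U \<Longrightarrow> ((\<lambda>x. D x v) has_derivative H z v) (at z)"
    "\<And>v w. continuous_on U (\<lambda>z. H z v w)"
  using assms by (auto simp: c2_data_def)

lemma c2_data_subset:
  assumes "c2_data U q D H" "open V" "V \<subseteq> U"
  shows "c2_data V q D H"
  using assms unfolding c2_data_def by (meson continuous_on_subset subsetD)

lemma c2_data_add:
  assumes "c2_data U p D H" "c2_data U q E K"
  shows "c2_data U (\<lambda>z. p z + q z) (\<lambda>z v. D z v + E z v) (\<lambda>z v w. H z v w + K z v w)"
  using assms unfolding c2_data_def by (auto intro!: has_derivative_add continuous_on_add)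

lemma c2_data_cmult:
  assumes "c2_data U p D H"
  shows "c2_data U (\<lambda>z. c * p z) (\<lambda>z v. c * D z v) (\<lambda>z v w. c * H z v w)"
  using assms unfolding c2_data_def by (auto intro!: has_derivative_mult_right continuous_on_mult
      continuous_on_const)

lemma c2_data_const: "c2_data UNIV (\<lambda>z. c) (\<lambda>z v. 0) (\<lambda>z v w. 0)"
  unfolding c2_data_def by auto

lemma c2_data_quadratic:
  fixes B :: "'a::real_normed_vector \<Rightarrow> 'a \<Rightarrow> real"
  assumes B: "bounded_bilinear B" and sym: "\<And>x y. B x y = B y x"
  shows "c2_data UNIV (\<lambda>z. B (z - a) (z - a)) (\<lambda>z v. 2 * B (z - a) v) (\<lambda>z v w. 2 * B w v)"
proof -
  have "((\<lambda>z. B (z - a) (z - a)) has_derivative (\<lambda>v. 2 * B (z - a) v)) (at z)" for z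
  proof -
    have "((\<lambda>z. B (z - a) (z - a)) has_derivative (\<lambda>v. B (z - a) v + B v (z - a))) (at z)"
      by (rule bounded_bilinear.FDERIV[OF B]) (auto intro!: derivative_eq_intros)
    then show ?thesis by (simp add: sym[of _ "z - a"])
  qed
  moreover have "((\<lambda>x. 2 * B (x - a) v) has_derivative (\<lambda>w. 2 * B w v)) (at z)" for z v
  proof -
    have "((\<lambda>x. B (x - a) v) has_derivative (\<lambda>w. B (z - a) 0 + B w v)) (at z)"
      by (rule bounded_bilinear.FDERIV[OF B]) (auto intro!: derivative_eq_intros)
    then show ?thesis
      by (intro has_derivative_mult_right) (simp add: bounded_bilinear.zero_right[OF B])
  qed
  ultimately show ?thesis unfolding c2_data_def by auto
qed

lemma c2_data_polynomial_affine:
  assumes p: "real_polynomial_function p" and L: "bounded_linear L"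
  shows "c2_data UNIV (\<lambda>z. p (L (z - b))) (\<lambda>z v. pd (L v) p (L (z - b)))
    (\<lambda>z v w. pd (L w) (pd (L v) p) (L (z - b)))"
proof -
  have d: "((\<lambda>z. f (L (z - b))) has_derivative (\<lambda>v. pd (L v) f (L (z - b)))) (at z)"
    if "real_polynomial_function f" for f z
    by (rule has_derivative_compose[of "\<lambda>z. L (z - b)" L z UNIV f])
      (auto intro!: derivative_eq_intros bounded_linear.has_derivative[OF L] rpf_has_derivative
          that)
  have c: "continuous_on UNIV (\<lambda>z. f (L (z - b)))" if "real_polynomial_function f" for f
    by (intro continuous_on_compose2[OF continuous_on_polymonial_function[OF that[unfolded
        real_polynomial_function_eq], of UNIV]]
        continuous_intros bounded_linear.continuous_on[OF L]) auto
  show ?thesis unfolding c2_data_def by (auto intro!: d c rpf_pd p)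
qed

text \<open>The mean value theorem in direction \<open>v\<close> and then in direction
  \<open>w\<close>. The second difference is symmetric in the two directions, which is what the next
  lemma exploits.\<close>

lemma second_difference_mean_value:
  fixes q :: "'a::real_normed_vector \<Rightarrow> real"
  assumes c2: "c2_data U q D H" and h: "h > 0"
    and sub: "\<And>s t. 0 \<le> s \<Longrightarrow> s \<le> h \<Longrightarrow> 0 \<le> t \<Longrightarrow> t \<le> h \<Longrightarrow> z + s *\<^sub>R v + t *\<^sub>R w \<in> U"
  obtains s t where "0 \<le> s" "s \<le> h" "0 \<le> t" "t \<le> h"
    "q (z + h *\<^sub>R v + h *\<^sub>R w) - q (z + h *\<^sub>R v) - q (z + h *\<^sub>R w) + q z
        = h * h * H (z + s *\<^sub>R v + t *\<^sub>R w) v w"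
proof -
  note c = c2_dataD[OF c2]
  define g where "g s = q (z + s *\<^sub>R v + h *\<^sub>R w) - q (z + s *\<^sub>R v)" for s
  have g': "(g has_real_derivative D (z + s *\<^sub>R v + h *\<^sub>R w) v - D (z + s *\<^sub>R v) v) (at s)"
    if s: "0 \<le> s" "s \<le> h" for s
  proof -
    have *: "((\<lambda>s. q (z + s *\<^sub>R v + y)) has_real_derivative D (z + s *\<^sub>R v + y) v) (at s)"
      if "z + s *\<^sub>R v + y \<in> U" for y
    proof -
      have "((\<lambda>s. q (z + s *\<^sub>R v + y)) has_derivative (\<lambda>r. D (z + s *\<^sub>R v + y) (r *\<^sub>R v))) (at s)"
        by (rule has_derivative_compose[of "\<lambda>s. z + s *\<^sub>R v + y" "\<lambda>r. r *\<^sub>R v" s UNIV q])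
          (auto intro!: derivative_eq_intros c that)
      then show ?thesis
        using linear_scale[OF has_derivative_linear[OF c(2)[OF that]]]
        by (simp add: has_field_derivative_def mult.commute[of _ "D _ _"])
    qed
    show ?thesis unfolding g_def
      using *[of 0] *[of "h *\<^sub>R w"] sub[OF s, of 0] sub[OF s, of h] h
      by (intro DERIV_diff) auto
  qed
  obtain s where s: "0 < s" "s < h" "g h - g 0
      = (h - 0) * (D (z + s *\<^sub>R v + h *\<^sub>R w) v - D (z + s *\<^sub>R v) v)"
    using MVT2[OF h g'] by auto
  define k where "k t = D (z + s *\<^sub>R v + t *\<^sub>R w) v" for t
  have k': "(k has_real_derivative H (z + s *\<^sub>R v + t *\<^sub>R w) v w) (at t)" if t: "0 \<le> t" "t \<le> h"
      for t
  proof -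
    have U: "z + s *\<^sub>R v + t *\<^sub>R w \<in> U" using sub s t by simp
    have "((\<lambda>t. D (z + s *\<^sub>R v + t *\<^sub>R w) v) has_derivative (\<lambda>r. H (z + s *\<^sub>R v + t *\<^sub>R w) v (r
        *\<^sub>R w))) (at t)"
      by (rule has_derivative_compose[of "\<lambda>t. z + s *\<^sub>R v + t *\<^sub>R w" "\<lambda>r. r *\<^sub>R w" t UNIV
          "\<lambda>x. D x v"])
        (auto intro!: derivative_eq_intros c U)
    then show ?thesis
      using linear_scale[OF has_derivative_linear[OF c(3)[OF U, of v]]]
      by (simp add: has_field_derivative_def k_def[abs_def] mult.commute[of _ "H _ _ _"])
  qed
  obtain t where t: "0 < t" "t < h" "k h - k 0 = (h - 0) * H (z + s *\<^sub>R v + t *\<^sub>R w) v w"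
    using MVT2[OF h k'] by auto
  have "g h - g 0 = h * h * H (z + s *\<^sub>R v + t *\<^sub>R w) v w"
    using s(3) t(3) by (simp add: k_def)
  then show ?thesis using that[of s t] s(1,2) t(1,2) by (simp add: g_def algebra_simps)
qed

text \<open>Class C2 is defined without the symmetry of \<open>H\<close>. It follows by evaluating
  the same second difference in both orders on a parallelogram so small that \<open>H\<close> varies
  there by less than \<open>e\<close>, half of the supposed discrepancy.\<close>

lemma c2_data_symmetric:
  fixes q :: "'a::real_normed_vector \<Rightarrow> real"
  assumes c2: "c2_data U q D H" and z: "z \<in> U"
  shows "H z v w = H z w v"
proof (rule ccontr)
  assume ne: "H z v w \<noteq> H z w v"
  define e where "e = \<bar>H z v w - H z w v\<bar> / 2"
  have e: "e > 0" using ne by (simp add: e_def)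
  note c = c2_dataD[OF c2]
  have "\<exists>d>0. \<forall>y. dist y z < d \<longrightarrow> y \<in> U \<and> \<bar>H y a b - H z a b\<bar> < e" for a b
  proof -
    have "isCont (\<lambda>z. H z a b) z" using c(4) c(1) z by (simp add: continuous_on_eq_continuous_at)
    then have "\<forall>\<^sub>F y in at z. \<bar>H y a b - H z a b\<bar> < e"
      unfolding isCont_def dist_real_def[symmetric] by (rule tendstoD[OF _ e])
    then have "\<forall>\<^sub>F y in nhds z. \<bar>H y a b - H z a b\<bar> < e"
      using e by (simp add: eventually_nhds_conv_at)
    moreover have "\<forall>\<^sub>F y in nhds z. y \<in> U" using c(1) z by (rule eventually_nhds_in_open)
    ultimately have "\<forall>\<^sub>F y in nhds z. y \<in> U \<and> \<bar>H y a b - H z a b\<bar> < e" by eventually_elim auto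
    then show ?thesis by (simp add: eventually_nhds_metric)
  qed
  then obtain d1 d2 where d: "d1 > 0" "\<And>y. dist y z < d1 \<Longrightarrow> y \<in> U \<and> \<bar>H y v w - H z v w\<bar> < e"
    "d2 > 0" "\<And>y. dist y z < d2 \<Longrightarrow> y \<in> U \<and> \<bar>H y w v - H z w v\<bar> < e" by meson
  define r where "r = norm v + norm w + 1"
  have r: "r > 0" by (simp add: r_def add_nonneg_pos)
  define h where "h = min d1 d2 / (2 * r)"
  have h: "h > 0" using d r by (simp add: h_def)
  have near: "dist (z + s *\<^sub>R v + t *\<^sub>R w) z < min d1 d2" if "0 \<le> s" "s \<le> h" "0 \<le> t" "t \<le> h" for s t
  proof -
    have "dist (z + s *\<^sub>R v + t *\<^sub>R w) z \<le> norm (s *\<^sub>R v) + norm (t *\<^sub>R w)"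
      by (simp add: dist_norm add.assoc norm_triangle_ineq del: norm_scaleR)
    also have "\<dots> \<le> h * norm v + h * norm w" using that by (intro add_mono) (auto intro:
        mult_right_mono)
    also have "\<dots> \<le> h * r" using h by (simp add: r_def algebra_simps)
    also have "h * r = min d1 d2 / 2" using r by (simp add: h_def)
    also have "min d1 d2 / 2 < min d1 d2"
    proof -
      have "min d1 d2 > 0" using d by simp
      then show ?thesis by linarith
    qed
    finally show ?thesis .
  qed
  obtain s t where 1: "0 \<le> s" "s \<le> h" "0 \<le> t" "t \<le> h"
    "q (z + h *\<^sub>R v + h *\<^sub>R w) - q (z + h *\<^sub>R v) - q (z + h *\<^sub>R w) + q z
        = h * h * H (z + s *\<^sub>R v + t *\<^sub>R w) v w"
    using second_difference_mean_value[OF c2 h, of z v w] near d by (metis min_less_iff_conj)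
  obtain s' t' where 2: "0 \<le> s'" "s' \<le> h" "0 \<le> t'" "t' \<le> h"
    "q (z + h *\<^sub>R w + h *\<^sub>R v) - q (z + h *\<^sub>R w) - q (z + h *\<^sub>R v) + q z
        = h * h * H (z + s' *\<^sub>R w + t' *\<^sub>R v) w v"
  proof (rule second_difference_mean_value[OF c2 h, of z w v])
    fix s t assume "0 \<le> s" "s \<le> h" "0 \<le> t" "t \<le> h"
    then have "dist (z + t *\<^sub>R v + s *\<^sub>R w) z < d1" using near[of t s] by simp
    then show "z + s *\<^sub>R w + t *\<^sub>R v \<in> U" using d(2) by (simp add: add.commute add.left_commute)
  qed
  have "h * h * H (z + s *\<^sub>R v + t *\<^sub>R w) v w = h * h * H (z + t' *\<^sub>R v + s' *\<^sub>R w) w v"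
    using 1(5) 2(5) by (simp add: algebra_simps)
  then have "H (z + s *\<^sub>R v + t *\<^sub>R w) v w = H (z + t' *\<^sub>R v + s' *\<^sub>R w) w v" using h by simp
  moreover have "\<bar>H (z + s *\<^sub>R v + t *\<^sub>R w) v w - H z v w\<bar> < e" using d(2) near[OF 1(1-4)] by simp
  moreover have "\<bar>H (z + t' *\<^sub>R v + s' *\<^sub>R w) w v - H z w v\<bar> < e" using d(4) near[OF 2(3,4,1,2)]
      by simp
  ultimately have "\<bar>H z v w - H z w v\<bar> < 2 * e" by linarith
  then show False by (simp add: e_def)
qed

text \<open>Differentiability gives linearity in the last argument; linearity in \<open>v\<close>
  then comes from symmetry.\<close>

lemma c2_data_bilinear:
  assumes c2: "c2_data U q D H" and z: "z \<in> U"
  shows "linear (H z v)" "linear (\<lambda>v. H z v w)"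
proof -
  show l: "linear (H z v)" for v using c2_dataD(3)[OF c2 z] by (rule has_derivative_linear)
  have "(\<lambda>v. H z v w) = H z w" using c2_data_symmetric[OF c2 z] by auto
  then show "linear (\<lambda>v. H z v w)" using l by simp
qed

lemma complex_hessian_nth:
  fixes q :: "complex ^ 'n \<Rightarrow> real"
  assumes c2: "c2_data U q D H" and z: "z \<in> U"
  shows "complex_hessian q z $ j $ k =
    Complex ((H z (axis k 1) (axis j 1) + H z (axis k \<i>) (axis j \<i>)) / 4)
      ((H z (axis k \<i>) (axis j 1) - H z (axis k 1) (axis j \<i>)) / 4)"
proof -
  note c = c2_dataD[OF c2]
  define g where "g x = Complex (D x (axis k 1) / 2) (D x (axis k \<i>) / 2)" for x
  have fd: "frechet_derivative (\<lambda>x. complex_of_real (q x)) (at x) = (\<lambda>v. complex_of_real (D x v))"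
      if "x \<in> U" for x
    by (rule frechet_derivative_at[symmetric]) (intro has_derivative_of_real c that)
  have g: "dzbar k (\<lambda>x. complex_of_real (q x)) x = g x" if "x \<in> U" for x
    by (simp add: dzbar_def fd[OF that] g_def complex_eq_iff)
  have "(g has_derivative (\<lambda>w. Complex (H z (axis k 1) w / 2) (H z (axis k \<i>) w / 2))) (at z)"
  proof -
    have "((\<lambda>x. complex_of_real (D x (axis k 1) / 2) + \<i> * complex_of_real (D x (axis k \<i>) / 2))
        has_derivative
       (\<lambda>w. complex_of_real (H z (axis k 1) w / 2) + \<i> * complex_of_real (H z (axis k \<i>) w / 2)))
           (at z)"
      by (intro has_derivative_add has_derivative_mult_right has_derivative_of_real
          bounded_linear.has_derivative[OF bounded_linear_divide] c z)
    moreover have "complex_of_real a + \<i> * complex_of_real b = Complex a b" for a b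
      by (simp add: complex_eq_iff)
    ultimately show ?thesis by (simp only: g_def[abs_def])
  qed
  then have "(dzbar k (\<lambda>x. complex_of_real (q x)) has_derivative
      (\<lambda>w. Complex (H z (axis k 1) w / 2) (H z (axis k \<i>) w / 2))) (at z)"
    by (rule has_derivative_transform_within_open[OF _ c(1) z]) (simp add: g)
  from frechet_derivative_at[OF this, symmetric] show ?thesis
    by (simp add: complex_hessian_def dz_def complex_eq_iff)
qed

lemma hermitian_complex_hessian:
  fixes q :: "complex ^ 'n \<Rightarrow> real"
  assumes c2: "c2_data U q D H" and z: "z \<in> U"
  shows "hermitian (complex_hessian q z)"
proof -
  have "H z v w = H z w v" for v w by (rule c2_data_symmetric[OF c2 z])
  note s = this
  show ?thesis
    unfolding hermitian_def
  proof (intro allI complex_eqI)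
    fix j k
    show "Re (complex_hessian q z $ k $ j) = Re (cnj (complex_hessian q z $ j $ k))"
      using s[of "axis j 1" "axis k 1"] s[of "axis j \<i>" "axis k \<i>"]
      by (simp add: complex_hessian_nth[OF c2 z])
    show "Im (complex_hessian q z $ k $ j) = Im (cnj (complex_hessian q z $ j $ k))"
      using s[of "axis j 1" "axis k \<i>"] s[of "axis j \<i>" "axis k 1"]
      by (simp add: complex_hessian_nth[OF c2 z] field_simps)
  qed
qed

lemma linear_complex_vec_expand:
  fixes f :: "complex ^ 'n \<Rightarrow> real"
  assumes "linear f"
  shows "f x = (\<Sum>j\<in>UNIV. Re (x $ j) * f (axis j 1) + Im (x $ j) * f (axis j \<i>))"
proof -
  have "x = (\<Sum>j\<in>UNIV. Re (x $ j) *\<^sub>R axis j 1 + Im (x $ j) *\<^sub>R axis j \<i>)"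
  proof -
    have "(\<Sum>j\<in>UNIV. Re (x $ j) *\<^sub>R axis j 1 + Im (x $ j) *\<^sub>R axis j \<i>) $ i = x $ i" for i
    proof -
      have "(\<Sum>j\<in>UNIV. Re (x $ j) *\<^sub>R axis j 1 + Im (x $ j) *\<^sub>R axis j \<i>) $ i
          = (\<Sum>j\<in>UNIV. if j = i then Re (x $ i) *\<^sub>R 1 + Im (x $ i) *\<^sub>R \<i> else 0)"
        unfolding sum_component by (intro sum.cong) (auto simp: axis_def)
      then show ?thesis by (simp add: complex_eq_iff)
    qed
    then show ?thesis by (simp add: vec_eq_iff)
  qed
  then have "f x = f (\<Sum>j\<in>UNIV. Re (x $ j) *\<^sub>R axis j 1 + Im (x $ j) *\<^sub>R axis j \<i>)" by simp
  then show ?thesis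
    by (simp add: linear_sum[OF assms] linear_add[OF assms] linear_scale[OF assms])
qed

text \<open>The link between the complex Hessian and the real Laplacian: for a unit vector
  \<open>\<xi>\<close> this is a quarter of the Laplacian along the complex line spanned by
  \<open>\<xi>\<close>. Both sides are expanded in real coordinates; \<open>S\<close> gathers the
  terms symmetric in \<open>j\<close> and \<open>k\<close>, and \<open>C\<close>, added in both
  index orders, the mixed ones.\<close>

lemma hform_complex_hessian:
  fixes q :: "complex ^ 'n \<Rightarrow> real"
  assumes c2: "c2_data U q D H" and z: "z \<in> U"
  shows "hform (complex_hessian q z) \<xi> = (H z \<xi> \<xi> + H z (\<i> *s \<xi>) (\<i> *s \<xi>)) / 4"
proof -
  define B where "B = H z"
  have sym: "B v w = B w v" for v w unfolding B_def by (rule c2_data_symmetric[OF c2 z])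
  have lin: "linear (B v)" "linear (\<lambda>v. B v w)" for v w
    unfolding B_def by (rule c2_data_bilinear[OF c2 z])+
  define x y where "x j = Re (\<xi> $ j)" and "y j = Im (\<xi> $ j)" for j
  have ex: "B \<zeta> \<zeta> = (\<Sum>j\<in>UNIV. \<Sum>k\<in>UNIV.
      Re (\<zeta> $ j) * Re (\<zeta> $ k) * B (axis j 1) (axis k 1) + Re (\<zeta> $ j) * Im (\<zeta> $ k) * B (axis j 1)
          (axis k \<i>)
      + Im (\<zeta> $ j) * Re (\<zeta> $ k) * B (axis j \<i>) (axis k 1) + Im (\<zeta> $ j) * Im (\<zeta> $ k) * B (axis j \<i>)
          (axis k \<i>))" for \<zeta>
    by (subst linear_complex_vec_expand[OF lin(2), of \<zeta>], subst (1 2) linear_complex_vec_expand[OF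
        lin(1), of _ \<zeta>])
      (simp add: sum_distrib_left sum.distrib algebra_simps)
  define C where "C j k = (x j * y k - y j * x k) * B (axis j 1) (axis k \<i>)" for j k
  define S where "S j k = (x j * x k + y j * y k) * (B (axis j 1) (axis k 1) + B (axis j \<i>) (axis
      k \<i>))" for j k
  have "B \<xi> \<xi> + B (\<i> *s \<xi>) (\<i> *s \<xi>) = (\<Sum>j\<in>UNIV. \<Sum>k\<in>UNIV. S j k + C j k + C k j)"
    unfolding ex sum.distrib[symmetric]
    by (intro sum.cong refl)
      (simp add: S_def C_def x_def y_def sym[of "axis _ \<i>" "axis _ 1"] algebra_simps)
  moreover have "4 * hform (complex_hessian q z) \<xi> = (\<Sum>j\<in>UNIV. \<Sum>k\<in>UNIV. S j k + C j k + C k j)"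
    unfolding hform_def Re_sum sum_distrib_left
  proof (intro sum.cong refl)
    fix j k
    define M where "M = complex_hessian q z $ j $ k"
    have M: "4 * Re M = B (axis j 1) (axis k 1) + B (axis j \<i>) (axis k \<i>)"
      "4 * Im M = B (axis j 1) (axis k \<i>) - B (axis k 1) (axis j \<i>)"
      using sym[of "axis k 1" "axis j 1"] sym[of "axis k \<i>" "axis j \<i>"] sym[of "axis k \<i>"
          "axis j 1"]
      by (simp_all add: M_def complex_hessian_nth[OF c2 z] B_def)
    have "4 * Re (M * \<xi> $ j * cnj (\<xi> $ k))
        = (x j * x k + y j * y k) * (4 * Re M) + (x j * y k - y j * x k) * (4 * Im M)"
      by (simp add: x_def y_def algebra_simps)
    then show "4 * Re (complex_hessian q z $ j $ k * \<xi> $ j * cnj (\<xi> $ k)) = S j k + C j k + C k j"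
      unfolding M M_def[symmetric] by (simp add: S_def C_def algebra_simps)
  qed
  ultimately show ?thesis by (simp add: B_def)
qed

lemma complex_hessian_add:
  fixes p q :: "complex ^ 'n \<Rightarrow> real"
  assumes "c2_data U p D H" "c2_data U q E K" "z \<in> U"
  shows "complex_hessian (\<lambda>z. p z + q z) z = complex_hessian p z + complex_hessian q z"
  by (simp add: vec_eq_iff complex_hessian_nth[OF c2_data_add[OF assms(1,2)] assms(3)]
      complex_hessian_nth[OF assms(1,3)] complex_hessian_nth[OF assms(2,3)] complex_eq_iff
          field_simps)

lemma complex_hessian_cmult:
  fixes p :: "complex ^ 'n \<Rightarrow> real"
  assumes "c2_data U p D H" "z \<in> U"
  shows "complex_hessian (\<lambda>z. c * p z) z = (\<chi> j k. complex_of_real c * complex_hessian p z $ j $ k)"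
  by (simp add: vec_eq_iff complex_hessian_nth[OF c2_data_cmult[OF assms(1)] assms(2)]
      complex_hessian_nth[OF assms] complex_eq_iff field_simps)

lemma continuous_on_complex_hessian:
  fixes q :: "complex ^ 'n \<Rightarrow> real"
  assumes c2: "c2_data U q D H"
  shows "continuous_on U (\<lambda>z. complex_hessian q z $ j $ k)"
proof -
  have "continuous_on U (\<lambda>z. Complex ((H z (axis k 1) (axis j 1) + H z (axis k \<i>) (axis j \<i>)) / 4)
      ((H z (axis k \<i>) (axis j 1) - H z (axis k 1) (axis j \<i>)) / 4))"
    unfolding Complex_eq by (intro continuous_intros c2_dataD(4)[OF c2]) auto
  then show ?thesis
    by (rule continuous_on_cong[THEN iffD1, rotated 2]) (auto simp: complex_hessian_nth[OF c2])
qed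

lemma continuous_on_ma_density:
  fixes q :: "complex ^ 'n \<Rightarrow> real"
  assumes c2: "c2_data U q D H"
  shows "continuous_on U (ma_density q)"
  unfolding ma_density_def[abs_def] det_def
  by (intro continuous_intros continuous_on_complex_hessian[OF c2])

lemma ma_density_cmult:
  fixes p :: "complex ^ 'n \<Rightarrow> real"
  assumes "c2_data U p D H" "z \<in> U"
  shows "ma_density (\<lambda>z. c * p z) z = c ^ CARD('n) * ma_density p z"
proof -
  have "det (\<chi> j k. complex_of_real c * complex_hessian p z $ j $ k)
      = complex_of_real c ^ CARD('n) * det (complex_hessian p z)"
    using det_rows_mul[of "\<lambda>i. complex_of_real c" "\<lambda>i. complex_hessian p z $ i"]
    by (simp add: vector_scalar_mult_def)
  then show ?thesis
    unfolding ma_density_def complex_hessian_cmult[OF assms] by (simp flip: of_real_power)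
qed

lemma complex_hessian_quadratic:
  fixes B :: "complex ^ 'n \<Rightarrow> complex ^ 'n \<Rightarrow> real"
  assumes B: "bounded_bilinear B" and sym: "\<And>x y. B x y = B y x"
  shows "complex_hessian (\<lambda>z. B (z - a) (z - a)) z $ j $ k =
    Complex ((B (axis j 1) (axis k 1) + B (axis j \<i>) (axis k \<i>)) / 2)
      ((B (axis j 1) (axis k \<i>) - B (axis j \<i>) (axis k 1)) / 2)"
  by (simp add: complex_hessian_nth[OF c2_data_quadratic[OF B sym]] complex_eq_iff)

lemma complex_hessian_norm_square:
  "complex_hessian (\<lambda>z. c * (norm (z - a))\<^sup>2) z = mat (complex_of_real c)"
proof -
  have c2: "c2_data UNIV (\<lambda>z. (z - a) \<bullet> (z - a)) (\<lambda>z v. 2 * ((z - a) \<bullet> v)) (\<lambda>z v w. 2 * (w \<bullet> v))"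
    by (rule c2_data_quadratic[OF bounded_bilinear_inner inner_commute])
  show ?thesis
    unfolding power2_norm_eq_inner complex_hessian_cmult[OF c2 UNIV_I]
    by (simp add: vec_eq_iff complex_hessian_quadratic[OF bounded_bilinear_inner inner_commute]
        inner_axis_axis mat_def complex_eq_iff)
qed

lemma c2_data_norm_square:
  fixes a :: "'a::real_inner"
  shows "c2_data UNIV (\<lambda>z. c * (norm (z - a))\<^sup>2) (\<lambda>z v. c * (2 * ((z - a) \<bullet> v))) (\<lambda>z v w. c * (2 *
      (w \<bullet> v)))"
  unfolding power2_norm_eq_inner
  by (rule c2_data_cmult[OF c2_data_quadratic[OF bounded_bilinear_inner inner_commute]])

text \<open>Realizes the matrix of \<open>hermitian_negative_det\<close> as a complex Hessian. For
  nonnegative \<open>r\<close> the function is nonnegative and vanishes at \<open>a\<close>, so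
  adding it to a test function preserves touching from above.\<close>

lemma sum_cmod_hdot_quadratic:
  fixes A :: "complex ^ 'n ^ 'n" and r :: "'n \<Rightarrow> real" and a :: "complex ^ 'n"
  defines "R \<equiv> \<lambda>z. \<Sum>i\<in>UNIV. r i * (cmod (hdot (z - a) (A $ i)))\<^sup>2"
  obtains D H where "c2_data UNIV R D H" "complex_hessian R z = diag_conj A r"
proof -
  define B where "B x y = (\<Sum>i\<in>UNIV. r i * (hdot x (A $ i) \<bullet> hdot y (A $ i)))" for x y
  have sc: "hdot (c *\<^sub>R x) w = c *\<^sub>R hdot x w" for c x w
    by (simp add: scaleR_vec_complex hdot_scale_left scaleR_conv_of_real)
  have "bilinear B"
    unfolding bilinear_def B_def
    by (auto intro!: linearI
        simp: hdot_add_left sc inner_add_left inner_add_right sum.distrib sum_distrib_left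
            algebra_simps)
  then have B: "bounded_bilinear B" by (simp add: bilinear_conv_bounded_bilinear)
  have sym: "B x y = B y x" for x y by (simp add: B_def inner_commute)
  have R: "R = (\<lambda>z. B (z - a) (z - a))"
    by (simp add: R_def B_def fun_eq_iff power2_norm_eq_inner)
  have ax: "hdot (axis j c) w = c * cnj (w $ j)" for j c w
    by (simp add: hdot_def axis_def if_distrib[of "\<lambda>x. x * _"] cong: if_cong)
  have "complex_hessian R z $ j $ k = diag_conj A r $ j $ k" for j k
    unfolding R complex_hessian_quadratic[OF B sym] diag_conj_nth
    by (simp add: B_def ax complex_eq_iff inner_complex_def sum.distrib[symmetric]
        sum_subtractf[symmetric]
        sum_divide_distrib[symmetric] sum_distrib_left algebra_simps)
  then have "complex_hessian R z = diag_conj A r" by (simp add: vec_eq_iff)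
  then show ?thesis using that c2_data_quadratic[OF B sym] unfolding R by blast
qed

lemma sum_Basis_complex_vec:
  "(\<Sum>b\<in>(Basis :: (complex ^ 'n) set). f b) = (\<Sum>i\<in>UNIV. f (axis i 1) + f (axis i \<i>))"
proof -
  have "(Basis :: (complex ^ 'n) set) = (\<Union>i\<in>UNIV. {axis i 1, axis i \<i>})"
    by (auto simp: Basis_vec_def Basis_complex_def)
  moreover have "(\<Sum>b\<in>(\<Union>i\<in>UNIV. {axis i 1, axis i \<i>}). f b)
      = (\<Sum>i\<in>(UNIV::'n set). \<Sum>b\<in>{axis i 1, axis i \<i>}. f b)"
    by (rule sum.UNION_disjoint) (auto simp: axis_eq_axis complex_eq_iff)
  moreover have "(\<Sum>b\<in>{axis i 1, axis i \<i>}. f b) = f (axis i 1) + f (axis i \<i>)" for i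
    by (simp add: axis_eq_axis complex_eq_iff)
  ultimately show ?thesis by simp
qed

subsection \<open>Regularization of viscosity subsolutions of the Monge--Ampere equation\<close>

text \<open>A constant \<open>\<alpha>\<close> suffices because the comparison freezes the
  right-hand side near a point. Positivity of the Hessian of a test function is not assumed; for
  \<open>0 \<le> \<alpha>\<close> it is a consequence.\<close>

definition visc_ma_ge :: "(complex ^ 'n) set \<Rightarrow> real \<Rightarrow> (complex ^ 'n \<Rightarrow> real) \<Rightarrow> bool" where
  "visc_ma_ge S \<alpha> g \<longleftrightarrow> (\<forall>z\<in>S. \<forall>q. C2_near q z \<and> g z = q z \<and> (\<forall>\<^sub>F y in nhds z. g y \<le> q y)
     \<longrightarrow> \<alpha> \<le> ma_density q z)"

lemma ddc_nonneg_iff_hform: "ddc_nonneg q z \<longleftrightarrow> (\<forall>\<xi>. 0 \<le> hform (complex_hessian q z) \<xi>)"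
  by (simp add: ddc_nonneg_def hform_def)

text \<open>Adding to the test function a nonnegative quadratic form that is large in all but one of the
  eigendirections of its Hessian keeps it a test function, so no eigenvalue can be negative.\<close>

lemma visc_ma_ge_imp_hform_nonneg:
  fixes q :: "complex ^ 'n \<Rightarrow> real"
  assumes g: "visc_ma_ge S \<alpha> g" "0 \<le> \<alpha>" and z: "z \<in> S"
    and q: "c2_data U q D H" "z \<in> U" "g z = q z" "\<forall>\<^sub>F y in nhds z. g y \<le> q y"
  shows "0 \<le> hform (complex_hessian q z) \<xi>"
proof (rule ccontr)
  assume "\<not> 0 \<le> hform (complex_hessian q z) \<xi>"
  then obtain A r where A: "unitary A" "\<And>i. 0 \<le> r i"
      "Re (det (complex_hessian q z + diag_conj A r)) < 0"
    using hermitian_negative_det[OF hermitian_complex_hessian[OF q(1,2)], of \<xi>] by force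
  define R where "R y = (\<Sum>i\<in>UNIV. r i * (cmod (hdot (y - z) (A $ i)))\<^sup>2)" for y
  obtain E K where R: "c2_data UNIV R E K" "complex_hessian R z = diag_conj A r"
    using sum_cmod_hdot_quadratic[of r z A] unfolding R_def[abs_def] by blast
  have RU: "c2_data U R E K" using c2_data_subset[OF R(1)] c2_dataD(1)[OF q(1)] by simp
  have R0: "R y \<ge> 0" for y unfolding R_def using A(2) by (intro sum_nonneg) simp
  have "R z = 0" by (simp add: R_def hdot_def)
  then have "g z = q z + R z" using q(3) by simp
  moreover have "C2_near (\<lambda>y. q y + R y) z"
    unfolding C2_near_iff using q(2) c2_data_add[OF q(1) RU] by blast
  moreover have "\<forall>\<^sub>F y in nhds z. g y \<le> q y + R y"
    using q(4) by eventually_elim (simp add: R0 add_increasing2)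
  ultimately have "\<alpha> \<le> ma_density (\<lambda>y. q y + R y) z"
    using g(1) z unfolding visc_ma_ge_def by blast
  moreover have "ma_density (\<lambda>y. q y + R y) z < 0"
    using A(3) unfolding ma_density_def complex_hessian_add[OF q(1) RU q(2)] R(2)
    by (simp add: mult_pos_neg)
  ultimately show False using g(2) by simp
qed

lemma linear_vector_matrix: "linear (\<lambda>x. x v* (A :: complex ^ 'n ^ 'm))"
  by (auto intro!: linearI simp: vec_eq_iff vector_matrix_mult_def algebra_simps sum.distrib
      scaleR_conv_of_real[where 'a=complex] sum_distrib_left)

lemma bounded_linear_vector_matrix: "bounded_linear (\<lambda>x. x v* (A :: complex ^ 'n ^ 'm))"
  using linear_vector_matrix by (simp add: linear_conv_bounded_linear)

lemma axis_vector_matrix: "axis i c v* A = c *s (A $ i)"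
  by (simp add: vec_eq_iff vector_matrix_mult_def axis_def if_distrib[of "\<lambda>x. x * _"]
      if_distrib[of "\<lambda>x. _ * x"] mult.commute cong: if_cong)

text \<open>The test polynomial \<open>q\<close> is carried back to the original variable as
  \<open>Q\<close>. The vectors \<open>axis i 1\<close> and \<open>axis i \<i>\<close> correspond to
  \<open>A $ i\<close> and \<open>\<i> *s A $ i\<close>, so the Laplacian of \<open>q\<close> is
  four times the trace of the complex Hessian of \<open>Q\<close> along the rows of
  \<open>A\<close>, which \<open>hermitian_trace_lower_bound\<close> bounds below. Dividing
  \<open>\<alpha>\<close> by the constant of \<open>ma_density\<close> leaves a bound for the
  determinant.\<close>

lemma visc_ma_ge_imp_visc_laplacian_ge:
  fixes g :: "complex ^ 'n \<Rightarrow> real"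
  assumes g: "visc_ma_ge S \<alpha> g" "0 \<le> \<alpha>" and A: "det A \<noteq> 0"
    and S: "\<And>x. x \<in> ball 0 1 \<Longrightarrow> b + x v* A \<in> S"
  shows "visc_laplacian_ge (ball 0 1)
    (4 * (CARD('n) * root CARD('n) (\<alpha> / (4 ^ CARD('n) * fact CARD('n)) * (cmod (det A))\<^sup>2)))
    (\<lambda>x. g (b + x v* A))"
  unfolding visc_laplacian_ge_def
proof (intro ballI allI impI, elim conjE)
  fix x q
  assume x: "x \<in> ball 0 1" and q: "real_polynomial_function q" "g (b + x v* A) = q x"
    and ev: "\<forall>\<^sub>F y in nhds x. g (b + y v* A) \<le> q y"
  obtain B where B: "A ** B = mat 1" "B ** A = mat 1"
    using A invertible_det_nz[of A] unfolding invertible_def by blast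
  define L where "L z = z v* B" for z
  have L: "bounded_linear L" unfolding L_def by (rule bounded_linear_vector_matrix)
  have LA: "L (y v* A) = y" for y
    by (simp add: L_def vector_matrix_mul_assoc B vector_matrix_mul_rid)
  have AL: "L y v* A = y" for y
    by (simp add: L_def vector_matrix_mul_assoc B vector_matrix_mul_rid)
  define Q where "Q z = q (L (z - b))" for z
  define z where "z = b + x v* A"
  have Lz: "L (z - b) = x" by (simp add: z_def LA)
  define D where "D z v = pd (L v) q (L (z - b))" for z v
  define H where "H z v w = pd (L w) (pd (L v) q) (L (z - b))" for z v w
  have c2: "c2_data UNIV Q D H"
    unfolding Q_def[abs_def] D_def[abs_def] H_def[abs_def] by (rule c2_data_polynomial_affine[OF
        q(1) L])
  have zS: "z \<in> S" using S[OF x] by (simp add: z_def)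
  have gz: "g z = Q z" using q(2) unfolding Q_def Lz by (simp add: z_def)
  obtain T where T: "open T" "x \<in> T" "\<And>y. y \<in> T \<Longrightarrow> g (b + y v* A) \<le> q y"
    using ev by (auto simp: eventually_nhds)
  have "open ((\<lambda>z. L (z - b)) -` T)"
    by (intro open_vimage T(1) bounded_linear.continuous_on[OF L] continuous_intros)
  moreover have "g y \<le> Q y" if "y \<in> (\<lambda>z. L (z - b)) -` T" for y
    using T(3)[of "L (y - b)"] that by (simp add: Q_def AL)
  ultimately have evQ: "\<forall>\<^sub>F y in nhds z. g y \<le> Q y"
    unfolding eventually_nhds using T(2) Lz by (intro exI[of _ "(\<lambda>z. L (z - b)) -` T"]) auto
  have psd: "0 \<le> hform (complex_hessian Q z) \<xi>" for \<xi>
    by (rule visc_ma_ge_imp_hform_nonneg[OF g zS c2 UNIV_I gz evQ])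
  have "\<alpha> \<le> ma_density Q z"
    using g(1) zS gz evQ c2 unfolding visc_ma_ge_def C2_near_iff by blast
  then have "\<alpha> / (4 ^ CARD('n) * fact CARD('n)) \<le> Re (det (complex_hessian Q z))"
    by (simp add: ma_density_def divide_le_eq mult.commute)
  from hermitian_trace_lower_bound[OF hermitian_complex_hessian[OF c2 UNIV_I] psd this, of A]
  have "CARD('n) * root CARD('n) (\<alpha> / (4 ^ CARD('n) * fact CARD('n)) * (cmod (det A))\<^sup>2)
      \<le> (\<Sum>i\<in>UNIV. hform (complex_hessian Q z) (A $ i))" .
  also have "\<dots> = laplacian q x / 4"
  proof -
    have "L (A $ i) = axis i 1" "L (\<i> *s A $ i) = axis i \<i>" for i
      using LA[of "axis i 1"] LA[of "axis i \<i>"] by (simp_all add: axis_vector_matrix)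
    then show ?thesis
      unfolding laplacian_def sum_Basis_complex_vec hform_complex_hessian[OF c2 UNIV_I]
          sum_divide_distrib
      by (simp add: H_def Lz)
  qed
  finally show "4 * (CARD('n) * root CARD('n) (\<alpha> / (4 ^ CARD('n) * fact CARD('n)) * (cmod (det
      A))\<^sup>2))
      \<le> laplacian q x" by simp
qed

section \<open>Convolution with a truncated polynomial kernel\<close>

lemma max_zero_power_has_derivative:
  "((\<lambda>s::real. max 0 s ^ Suc (Suc k)) has_real_derivative real (Suc (Suc k)) * max 0 s ^ Suc k)
      (at s)"
proof -
  consider "s > 0" | "s < 0" | "s = 0" by linarith
  then show ?thesis
  proof cases
    case 1
    have "((\<lambda>s::real. s ^ Suc (Suc k)) has_real_derivative real (Suc (Suc k)) * s ^ Suc k) (at s)"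
      using DERIV_pow[of "Suc (Suc k)" s] by simp
    then have "((\<lambda>s::real. max 0 s ^ Suc (Suc k)) has_real_derivative real (Suc (Suc k)) * s ^ Suc
        k) (at s)"
      by (rule DERIV_cong_ev[THEN iffD1, rotated 3]) (use 1 in \<open>auto intro!:
          eventually_nhds_in_open[of "{0<..}" s, THEN eventually_mono]\<close>)
    then show ?thesis using 1 by simp
  next
    case 2
    have "((\<lambda>s::real. 0) has_real_derivative 0) (at s)" by simp
    then have "((\<lambda>s::real. max 0 s ^ Suc (Suc k)) has_real_derivative 0) (at s)"
      by (rule DERIV_cong_ev[THEN iffD1, rotated 3]) (use 2 in \<open>auto intro!:
          eventually_nhds_in_open[of "{..<0}" s, THEN eventually_mono]\<close>)
    then show ?thesis using 2 by simp
  next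
    case 3
    have "((\<lambda>h::real. max 0 h ^ Suc k) \<longlongrightarrow> max 0 0 ^ Suc k) (at 0)" by (intro tendsto_intros)
    moreover have "max 0 h ^ Suc k = (max 0 (0 + h) ^ Suc (Suc k) - max 0 0 ^ Suc (Suc k)) / h" if
        "h \<noteq> 0" for h :: real
      using that by (auto simp: max_def)
    ultimately have "(\<lambda>h::real. (max 0 (0 + h) ^ Suc (Suc k) - max 0 0 ^ Suc (Suc k)) / h) \<midarrow>0\<rightarrow> max
        0 0 ^ Suc k"
      by (subst LIM_equal[symmetric, where f="\<lambda>h. max 0 h ^ Suc k"]) auto
    then show ?thesis using 3 by (simp add: DERIV_def)
  qed
qed

lemma integral_blinfun_apply_eq:
  fixes F :: "'b::euclidean_space \<Rightarrow> 'a::real_normed_vector \<Rightarrow>\<^sub>L real"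
  assumes "continuous_on (cbox a b) F"
  shows "blinfun_apply (integral (cbox a b) F) u = integral (cbox a b) (\<lambda>t. blinfun_apply (F t) u)"
  using integral_linear[OF integrable_continuous[OF assms], of "\<lambda>f. blinfun_apply f u"]
  by (simp add: o_def blinfun.bounded_linear_left)

text \<open>The cube is the lowest integer power of the positive part with a continuous second
  derivative. All dependence on \<open>x\<close> sits in the kernel, so differentiation under the
  integral asks only continuity of \<open>g\<close>.\<close>

lemma c2_data_convolution:
  fixes g :: "'a::euclidean_space \<Rightarrow> real"
  assumes g: "continuous_on (cbox a b) g"
  shows "\<exists>D H. c2_data UNIV (\<lambda>x. integral (cbox a b) (\<lambda>t. g t * max 0 (r - (x - t) \<bullet> (x - t)) ^
      3)) D H"
proof -
  define m where "m x t = max 0 (r - (x - t) \<bullet> (x - t))" for x t :: 'a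
  have cg: "continuous_on (UNIV \<times> cbox a b) (\<lambda>p. g (snd p))"
    by (rule continuous_on_compose2[OF g]) (auto intro!: continuous_intros)
  have cm: "continuous_on X (\<lambda>p. m (fst p) (snd p))" for X
    unfolding m_def by (intro continuous_intros)
  have cgt: "continuous_on (cbox a b) (\<lambda>t. m x t)" for x
    unfolding m_def by (intro continuous_intros)
  have quad: "((\<lambda>x. r - (x - t) \<bullet> (x - t)) has_derivative (\<lambda>v. - 2 * ((x - t) \<bullet> v))) (at x)" for x t
    by (auto intro!: derivative_eq_intros simp: inner_commute)
  have dm: "((\<lambda>x. m x t ^ Suc (Suc k)) has_derivative
      (\<lambda>v. real (Suc (Suc k)) * m x t ^ Suc k * (- 2 * ((x - t) \<bullet> v)))) (at x)" for k x t
    using has_derivative_compose[OF quad, of "\<lambda>s. max 0 s ^ Suc (Suc k)"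
        "\<lambda>h. real (Suc (Suc k)) * max 0 (r - (x - t) \<bullet> (x - t)) ^ Suc k * h" x t]
      max_zero_power_has_derivative[of k, unfolded has_field_derivative_def]
    by (simp add: m_def)
  \<comment> \<open>\<open>F1\<close> and \<open>F2 v\<close> are the derivative of the integrand in
    \<open>x\<close> and the derivative of \<open>F1 x t v\<close> in \<open>x\<close>, written as
    bounded linear functionals for \<open>leibniz_rule\<close>.\<close>
  define F1 where "F1 x t = (g t * (- 6 * m x t ^ 2)) *\<^sub>R blinfun_inner_right (x - t)" for x t
  define F2 where "F2 v x t = (g t * (- 6 * m x t ^ 2)) *\<^sub>R blinfun_inner_right v
      + (g t * (24 * ((x - t) \<bullet> v) * m x t)) *\<^sub>R blinfun_inner_right (x - t)" for v x t
  have cbir: "continuous_on X (\<lambda>p. blinfun_inner_right (f p))" if "continuous_on X f" for X ::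
      "('a \<times> 'a) set" and f :: "'a \<times> 'a \<Rightarrow> 'a"
    using that by (intro bounded_linear.continuous_on[OF bounded_linear_blinfun_inner_right])
  have cF1: "continuous_on (UNIV \<times> cbox a b) (\<lambda>(x, t). F1 x t)"
    unfolding F1_def split_def by (intro continuous_intros cg cm cbir)
  have cF2: "continuous_on (UNIV \<times> cbox a b) (\<lambda>(x, t). F2 v x t)" for v
    unfolding F2_def split_def by (intro continuous_intros cg cm cbir)
  have sect: "continuous_on (cbox a b) (\<lambda>t. F x t)" if
      "continuous_on (UNIV \<times> cbox a b) (\<lambda>(x, t). F x t)"
    for F :: "'a \<Rightarrow> 'a \<Rightarrow> 'c::topological_space" and x
    by (rule continuous_on_compose2[OF that, of _ "\<lambda>t. (x, t)", simplified]) (auto intro!: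
        continuous_intros)
  define G where "G x = integral (cbox a b) (\<lambda>t. g t * m x t ^ 3)" for x
  define D where "D x v = integral (cbox a b) (\<lambda>t. F1 x t v)" for x v
  define H where "H x v w = integral (cbox a b) (\<lambda>t. F2 v x t w)" for x v w
  have G': "(G has_derivative D x) (at x)" for x
  proof -
    have "((\<lambda>x. integral (cbox a b) (\<lambda>t. g t * m x t ^ 3))
        has_derivative integral (cbox a b) (F1 x)) (at x within UNIV)"
    proof (rule leibniz_rule)
      show "((\<lambda>x. g t * m x t ^ 3) has_derivative blinfun_apply (F1 x t)) (at x within UNIV)" for
          x t
      proof -
        have "blinfun_apply (F1 x t) = (\<lambda>v. g t * (real (Suc (Suc 1)) * m x t ^ Suc 1 * (- 2 * ((x
            - t) \<bullet> v))))"
          by (rule ext) (simp add: F1_def numeral_2_eq_2 blinfun.scaleR_left blinfun.minus_left)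
        moreover have "(\<lambda>x. g t * m x t ^ 3) = (\<lambda>x. g t * m x t ^ Suc (Suc 1))" by (simp add:
            numeral_3_eq_3)
        ultimately show ?thesis using has_derivative_mult_right[OF dm[of t 1 x], of "g t"] by simp
      qed
      show "(\<lambda>t. g t * m x t ^ 3) integrable_on cbox a b" for x
        by (intro integrable_continuous continuous_intros g cgt)
    qed (use cF1 in auto)
    then show ?thesis
      unfolding G_def[abs_def] D_def integral_blinfun_apply_eq[OF sect[OF cF1], symmetric] by simp
  qed
  have D': "((\<lambda>x. D x v) has_derivative H x v) (at x)" for x v
  proof -
    have "((\<lambda>x. integral (cbox a b) (\<lambda>t. F1 x t v))
        has_derivative integral (cbox a b) (F2 v x)) (at x within UNIV)"
    proof (rule leibniz_rule)
      fix x t :: 'a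
      have "((\<lambda>x. (- 6 * g t) * (m x t ^ Suc (Suc 0) * ((x - t) \<bullet> v))) has_derivative
         (\<lambda>w. (- 6 * g t) * (m x t ^ Suc (Suc 0) * (w \<bullet> v)
            + real (Suc (Suc 0)) * m x t ^ Suc 0 * (- 2 * ((x - t) \<bullet> w)) * ((x - t) \<bullet> v)))) (at x)"
        by (intro has_derivative_mult_right has_derivative_mult dm)
          (auto intro!: derivative_eq_intros)
      moreover have "blinfun_apply (F2 v x t) = (\<lambda>w. (- 6 * g t) * (m x t ^ Suc (Suc 0) * (w \<bullet> v)
            + real (Suc (Suc 0)) * m x t ^ Suc 0 * (- 2 * ((x - t) \<bullet> w)) * ((x - t) \<bullet> v)))"
        by (rule ext) (simp add: F2_def numeral_2_eq_2 blinfun.scaleR_left blinfun.minus_left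
            blinfun.diff_left blinfun.add_left inner_commute[of v] algebra_simps)
      moreover have "(\<lambda>x. F1 x t v) = (\<lambda>x. (- 6 * g t) * (m x t ^ Suc (Suc 0) * ((x - t) \<bullet> v)))"
        by (rule ext) (simp add: F1_def numeral_2_eq_2 blinfun.scaleR_left blinfun.minus_left)
      ultimately show "((\<lambda>x. F1 x t v) has_derivative blinfun_apply (F2 v x t)) (at x within UNIV)"
        by simp
      show "(\<lambda>t. F1 x t v) integrable_on cbox a b"
        by (intro integrable_continuous continuous_intros sect[OF cF1])
    qed (use cF2 in auto)
    then show ?thesis
      unfolding D_def H_def integral_blinfun_apply_eq[OF sect[OF cF2], symmetric] by simp
  qed
  have "continuous_on UNIV (\<lambda>x. H x v w)" for v w
    unfolding H_def
    by (rule integral_continuous_on_param) (use cF2[of v] in \<open>auto simp: split_def intro!: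
        continuous_intros\<close>)
  then have "c2_data UNIV G D H" unfolding c2_data_def using G' D' by auto
  then show ?thesis unfolding G_def[abs_def] m_def by blast
qed

text \<open>\<open>G\<close> is written in two ways: over a fixed large box, with \<open>x\<close>
  in the kernel, to be differentiated; and over a small box, with \<open>x\<close> in
  \<open>g\<close>, to be an average of translates. They agree for \<open>x\<close> in the given
  ball because the kernel vanishes outside the small box.\<close>

lemma mollification:
  fixes g :: "'a::euclidean_space \<Rightarrow> real"
  assumes g: "continuous_on UNIV g" and \<epsilon>: "\<epsilon> > 0" and \<delta>: "\<delta> > 0"
  obtains G D H \<rho> a b where "c2_data UNIV G D H"
    "continuous_on (cbox a b) \<rho>" "\<And>y. 0 \<le> \<rho> y" "integral (cbox a b) \<rho> = 1" "cbox a b \<subseteq> ball 0 \<delta>"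
    "\<And>x. x \<in> cball z R \<Longrightarrow> G x = integral (cbox a b) (\<lambda>y. \<rho> y * g (x - y))"
    "\<And>x. x \<in> cball z R \<Longrightarrow> \<bar>G x - g x\<bar> \<le> \<epsilon>"
proof -
  have "uniformly_continuous_on (cball z (R + 1)) g"
    by (intro compact_uniformly_continuous continuous_on_subset[OF g]) auto
  then obtain d where d: "d > 0" "\<And>x y. x \<in> cball z (R + 1) \<Longrightarrow> y \<in> cball z (R + 1) \<Longrightarrow> dist y x < d
      \<Longrightarrow> \<bar>g y - g x\<bar> < \<epsilon>"
    unfolding uniformly_continuous_on_def using \<epsilon> by (metis dist_real_def)
  define s where "s = min (min d \<delta>) 1"
  have s: "s > 0" "s \<le> d" "s \<le> \<delta>" "s \<le> 1" using d \<delta> by (auto simp: s_def)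
  \<comment> \<open>On the box of half-side \<open>r\<close> the norm is at most
    \<open>DIM('a) * r = s / 2\<close>, and the kernel is supported in the ball of radius
    \<open>r\<close>, which lies in the box.\<close>
  define r where "r = s / (2 * DIM('a))"
  have r: "r > 0" using s by (simp add: r_def)
  define c where "c = r *\<^sub>R (One :: 'a)"
  have box: "y \<in> cbox (- c) c \<longleftrightarrow> (\<forall>b\<in>Basis. \<bar>y \<bullet> b\<bar> \<le> r)" for y
    by (auto simp: mem_box c_def inner_sum_left inner_Basis abs_le_iff minus_le_iff)
  have boxs: "norm y < s" if "y \<in> cbox (- c) c" for y
  proof -
    have "norm y \<le> (\<Sum>b\<in>Basis. \<bar>y \<bullet> b\<bar>)" by (rule norm_le_l1)
    also have "\<dots> \<le> (\<Sum>b\<in>(Basis::'a set). r)" using that box by (intro sum_mono) auto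
    also have "\<dots> = s / 2" by (simp add: r_def)
    finally show ?thesis using s by simp
  qed
  define k where "k y = max 0 (r\<^sup>2 - y \<bullet> y) ^ 3" for y :: 'a
  have k0: "k y = 0" if ny: "y \<notin> cbox (- c) c" for y
  proof -
    obtain b where b: "b \<in> Basis" "r < \<bar>y \<bullet> b\<bar>" using ny box[of y] by (auto simp: not_le)
    then have "r < norm y" using Basis_le_norm[OF b(1), of y] by simp
    then have "r\<^sup>2 \<le> y \<bullet> y" using r by (simp add: dot_square_norm power_mono)
    then show ?thesis by (simp add: k_def)
  qed
  have kc: "continuous_on X k" for X unfolding k_def by (intro continuous_intros)
  have kn: "0 \<le> k y" for y by (simp add: k_def)
  define I where "I = integral (cbox (- c) c) k"
  have ki: "(k has_integral I) (cbox (- c) c)"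
    unfolding I_def by (intro integrable_integral integrable_continuous kc)
  \<comment> \<open>Normalization asks for \<open>I > 0\<close>: a nonnegative continuous kernel
    with zero integral would vanish at the centre, where its value is
    \<open>(r\<^sup>2) ^ 3\<close>.\<close>
  have "I \<noteq> 0"
  proof
    assume "I = 0"
    have "k 0 = 0"
    proof (rule has_integral_0_cbox_imp_0[OF kc])
      show "(k has_integral 0) (cbox (- c) c)" using ki \<open>I = 0\<close> by simp
      show "0 \<in> cbox (- c) c" using r by (simp add: box)
      show "box (- c) c \<noteq> {}" using r by (simp add: box_ne_empty c_def inner_sum_left inner_Basis)
    qed (use kn in auto)
    then show False using r by (simp add: k_def)
  qed
  moreover have "I \<ge> 0" unfolding I_def by (intro integral_nonneg integrable_continuous kc kn)
  ultimately have I: "I > 0" by simp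
  define M where "M = norm z + \<bar>R\<bar> + s"
  obtain e where e: "cball 0 M \<subseteq> cbox (- e) (e::'a)"
    using bounded_subset_cbox_symmetric[OF bounded_cball] by blast
  obtain D H where DH: "c2_data UNIV (\<lambda>x. integral (cbox (- e) e) (\<lambda>t. g t * max 0 (r\<^sup>2 - (x - t)
      \<bullet> (x - t)) ^ 3)) D H"
    using c2_data_convolution[OF continuous_on_subset[OF g subset_UNIV]] by blast
  define G where "G x = (1 / I) * integral (cbox (- e) e) (\<lambda>t. g t * k (x - t))" for x
  have c2: "c2_data UNIV G (\<lambda>z v. (1 / I) * D z v) (\<lambda>z v w. (1 / I) * H z v w)"
    unfolding G_def k_def using c2_data_cmult[OF DH] .
  define \<rho> where "\<rho> y = k y / I" for y
  have G: "G x = integral (cbox (- c) c) (\<lambda>y. \<rho> y * g (x - y))" if x: "x \<in> cball z R" for x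
  proof -
    define J where "J = integral (cbox (- c) c) (\<lambda>y. k y * g (x - y))"
    have gx: "continuous_on X (\<lambda>y. g (x - y))" for X
      by (rule continuous_on_compose2[OF g]) (auto intro!: continuous_intros)
    have "((\<lambda>y. k y * g (x - y)) has_integral J) (cbox (- c) c)"
      unfolding J_def by (intro integrable_integral integrable_continuous continuous_intros kc gx)
    from has_integral_affinity[OF this, of "-1" x]
    have 1: "((\<lambda>y. k (x - y) * g y) has_integral J) ((\<lambda>y. x - y) ` cbox (- c) c)"
      by (simp add: algebra_simps)
    have "((\<lambda>y. k (x - y) * g y) has_integral J) (cbox (- e) e)"
    proof (rule has_integral_on_superset[OF 1])
      show "k (x - y) * g y = 0" if "y \<notin> (\<lambda>y. x - y) ` cbox (- c) c" for y
      proof -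
        have "x - y \<notin> cbox (- c) c"
          using that by (metis imageI diff_diff_eq2 add_diff_cancel_left' add_diff_cancel)
        then show ?thesis by (simp add: k0)
      qed
      show "(\<lambda>y. x - y) ` cbox (- c) c \<subseteq> cbox (- e) e"
      proof (rule order_trans[OF _ e], clarsimp)
        fix y assume "y \<in> cbox (- c) c"
        then have "norm y < s" by (rule boxs)
        moreover have "norm x \<le> norm z + \<bar>R\<bar>"
          using x norm_triangle_ineq2[of x z] by (simp add: dist_norm norm_minus_commute)
        ultimately show "norm (x - y) \<le> M"
          using norm_triangle_ineq4[of x y] by (simp add: M_def)
      qed
    qed
    then have "G x = (1 / I) * J" by (simp add: G_def integral_unique mult.commute)
    also have "\<dots> = integral (cbox (- c) c) (\<lambda>y. (1 / I) * (k y * g (x - y)))" by (simp add: J_def)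
    finally show ?thesis by (simp add: \<rho>_def)
  qed
  have \<rho>c: "continuous_on X \<rho>" for X unfolding \<rho>_def by (intro continuous_intros kc) (use I in auto)
  have \<rho>n: "0 \<le> \<rho> y" for y using I kn by (simp add: \<rho>_def)
  have \<rho>I: "integral (cbox (- c) c) \<rho> = 1"
    using I by (simp add: \<rho>_def[abs_def] I_def[symmetric])
  have close: "\<bar>G x - g x\<bar> \<le> \<epsilon>" if x: "x \<in> cball z R" for x
  proof -
    have gx: "continuous_on X (\<lambda>y. g (x - y))" for X
      by (rule continuous_on_compose2[OF g]) (auto intro!: continuous_intros)
    have i1: "(\<lambda>y. \<rho> y * g (x - y)) integrable_on cbox (- c) c"
      by (intro integrable_continuous continuous_intros \<rho>c gx)
    have i2: "\<rho> integrable_on cbox (- c) c" by (intro integrable_continuous \<rho>c)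
    have "G x - g x = integral (cbox (- c) c) (\<lambda>y. \<rho> y * g (x - y) - \<rho> y * g x)"
      by (simp add: G[OF x] \<rho>I integral_diff[OF i1 integrable_on_mult_left[OF i2]])
    also have "norm \<dots> \<le> integral (cbox (- c) c) (\<lambda>y. \<epsilon> * \<rho> y)"
    proof (rule integral_norm_bound_integral)
      show "(\<lambda>y. \<rho> y * g (x - y) - \<rho> y * g x) integrable_on cbox (- c) c"
        by (intro integrable_diff i1 integrable_on_mult_left i2)
      show "(\<lambda>y. \<epsilon> * \<rho> y) integrable_on cbox (- c) c" by (intro integrable_on_mult_right i2)
      fix y assume "y \<in> cbox (- c) c"
      then have y: "norm y < s" by (rule boxs)
      have "x \<in> cball z (R + 1)" using x by auto
      moreover have "dist z (x - y) \<le> R + 1"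
        using x y s dist_triangle[of z "x - y" x] by (simp add: dist_norm)
      ultimately have "\<bar>g (x - y) - g x\<bar> < \<epsilon>" using y s by (intro d(2)) (auto simp: dist_norm)
      then have "\<rho> y * \<bar>g (x - y) - g x\<bar> \<le> \<rho> y * \<epsilon>" by (intro mult_left_mono \<rho>n) simp
      then show "norm (\<rho> y * g (x - y) - \<rho> y * g x) \<le> \<epsilon> * \<rho> y"
        using \<rho>n[of y] by (simp add: right_diff_distrib[symmetric] abs_mult mult.commute)
    qed
    also have "\<dots> = \<epsilon>" by (simp add: \<rho>I)
    finally show ?thesis by simp
  qed
  have "cbox (- c) c \<subseteq> ball 0 \<delta>" using boxs s(3) by force
  then show ?thesis using that[OF c2 \<rho>c \<rho>n \<rho>I _ G close] by blast
qed

text \<open>For each invertible \<open>A\<close>, the translates of \<open>g\<close> satisfy a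
  Poisson inequality on small ellipsoids around \<open>x0\<close> shaped by \<open>A\<close>. By
  \<open>laplacian_average_ge\<close> the trace of the Hessian of \<open>G\<close> along
  \<open>A\<close> is almost large enough somewhere in the ellipsoid, and continuity brings the
  bound to \<open>x0\<close>. The bounds for all \<open>A\<close> recombine in
  \<open>hermitian_of_trace_lower_bounds\<close>. Translation and ellipsoid each use up less than
  \<open>\<rho> / 4\<close>, whence the radius \<open>\<rho> / 2\<close>.\<close>

lemma visc_ma_ge_regularization:
  fixes g :: "complex ^ 'n \<Rightarrow> real"
  assumes g: "continuous_on UNIV g" and ma: "visc_ma_ge (ball z \<rho>) \<alpha> g" "0 \<le> \<alpha>"
    and \<epsilon>: "\<epsilon> > 0" and \<rho>: "\<rho> > 0"
  obtains G D H where "c2_data UNIV G D H" "\<And>x. x \<in> cball z \<rho> \<Longrightarrow> \<bar>G x - g x\<bar> \<le> \<epsilon>"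
    "\<And>x \<xi>. x \<in> ball z (\<rho> / 2) \<Longrightarrow> 0 \<le> hform (complex_hessian G x) \<xi>"
    "\<And>x. x \<in> ball z (\<rho> / 2) \<Longrightarrow> \<alpha> \<le> ma_density G x"
proof -
  have \<rho>4: "\<rho> / 4 > 0" using \<rho> by simp
  obtain G D H w a b where c2: "c2_data UNIV G D H"
    and w: "continuous_on (cbox a b) w" "\<And>y. 0 \<le> w y" "integral (cbox a b) w = 1"
        "cbox a b \<subseteq> ball 0 (\<rho> / 4)"
    and G: "\<And>x. x \<in> cball z \<rho> \<Longrightarrow> G x = integral (cbox a b) (\<lambda>y. w y * g (x - y))"
    "\<And>x. x \<in> cball z \<rho> \<Longrightarrow> \<bar>G x - g x\<bar> \<le> \<epsilon>"
    by (rule mollification[OF g \<epsilon> \<rho>4, of z \<rho>]) (rule that)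
  note c = c2_dataD[OF c2]
  define N where "N = (4 ^ CARD('n) * fact CARD('n) :: real)"
  have N: "N > 0" by (simp add: N_def)
  have "0 \<le> hform (complex_hessian G x0) \<xi> \<and> \<alpha> / N \<le> Re (det (complex_hessian G x0))"
    if x0: "x0 \<in> ball z (\<rho> / 2)" for x0 \<xi>
  proof -
    have tr: "CARD('n) * root CARD('n) (\<alpha> / N * (cmod (det A))\<^sup>2)
        \<le> (\<Sum>i\<in>UNIV. hform (complex_hessian G x0) (A $ i))"
      if A: "det A \<noteq> 0" for A :: "complex ^ 'n ^ 'n"
    proof (rule ccontr)
      define h where "h x = (\<Sum>i\<in>UNIV. hform (complex_hessian G x) (A $ i))" for x
      define C where "C = CARD('n) * root CARD('n) (\<alpha> / N * (cmod (det A))\<^sup>2)"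
      assume "\<not> ?thesis"
      then have lt: "h x0 < C" by (simp add: h_def C_def)
      define \<eta> where "\<eta> = (C - h x0) / 2"
      have \<eta>: "\<eta> > 0" using lt by (simp add: \<eta>_def)
      have "continuous_on UNIV h"
        unfolding h_def hform_complex_hessian[OF c2 UNIV_I] by (intro continuous_intros c(4)) auto
      then have "isCont h x0" by (simp add: continuous_on_eq_continuous_at)
      then obtain d where d: "d > 0" "\<And>x. dist x x0 < d \<Longrightarrow> dist (h x) (h x0) < \<eta>"
        using \<eta> unfolding continuous_at_eps_delta by blast
      define L where "L x = x v* A" for x
      have L: "bounded_linear L" unfolding L_def by (rule bounded_linear_vector_matrix)
      obtain K where K: "K > 0" "\<And>x. norm (L x) \<le> norm x * K"
        using bounded_linear.pos_bounded[OF L] by blast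
      \<comment> \<open>The ellipsoid has radius at most \<open>s * K\<close>, below both
        \<open>d\<close>, within which \<open>h\<close> moves by less than \<open>\<eta>\<close>,
        and \<open>\<rho> / 4\<close>.\<close>
      define s where "s = min d (\<rho> / 4) / (2 * K)"
      have s: "s > 0" using d \<rho> K by (simp add: s_def)
      have sK: "s * K < d" "s * K < \<rho> / 4" using K d \<rho> by (auto simp: s_def min_def)
      have small: "norm (s *\<^sub>R L x) \<le> s * K" if "norm x \<le> 1" for x
      proof -
        have "norm (L x) \<le> K" using K(2)[of x] mult_right_mono[OF that less_imp_le[OF K(1)]]
          by linarith
        then show ?thesis using s by simp
      qed
      define As where "As = (\<chi> i. complex_of_real s *s A $ i)"
      have Ls: "x v* As = s *\<^sub>R L x" for x
        by (simp add: As_def L_def vec_eq_iff vector_matrix_mult_def scaleR_conv_of_real[where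
            'a=complex]
            sum_distrib_left algebra_simps)
      have dAs: "det As = complex_of_real s ^ CARD('n) * det A"
        unfolding As_def using det_rows_mul[of "\<lambda>i. complex_of_real s" "\<lambda>i. A $ i"] by simp
      have xs: "x0 + s *\<^sub>R L x \<in> cball z \<rho>" "x0 - y + s *\<^sub>R L x \<in> ball z \<rho>"
        if "x \<in> cball 0 1" "y \<in> cbox a b" for x y
      proof -
        have 1: "dist z x0 < \<rho> / 2" "norm y < \<rho> / 4" "norm (s *\<^sub>R L x) < \<rho> / 4"
          using x0 w(4) that small[of x] sK by auto
        have "dist z (x0 + s *\<^sub>R L x) \<le> dist z x0 + norm (s *\<^sub>R L x)"
          using dist_triangle[of z "x0 + s *\<^sub>R L x" x0] by (simp add: dist_norm)
        moreover have "dist z (x0 - y + s *\<^sub>R L x) \<le> dist z (x0 + s *\<^sub>R L x) + norm y"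
          using dist_triangle[of z "x0 - y + s *\<^sub>R L x" "x0 + s *\<^sub>R L x"] by (simp add: dist_norm)
        ultimately show "x0 + s *\<^sub>R L x \<in> cball z \<rho>" "x0 - y + s *\<^sub>R L x \<in> ball z \<rho>"
          using 1 \<rho> unfolding mem_cball mem_ball by linarith+
      qed
      have "cbox a b \<noteq> {}" using w(3) by auto
      then obtain y0 where y0: "y0 \<in> cbox a b" by blast
      define c' where "c' = 4 * (CARD('n) * root CARD('n) (\<alpha> / N * (cmod (det As))\<^sup>2))"
      \<comment> \<open>Scaling the rows of \<open>A\<close> by \<open>s\<close> multiplies the
        squared modulus of the determinant by \<open>(s\<^sup>2) ^ CARD('n)\<close> and hence its
        root by \<open>s\<^sup>2\<close>, the same factor as for the Hessian form.\<close>
      have c': "c' = 4 * s\<^sup>2 * C"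
      proof -
        have "(cmod (det As))\<^sup>2 = (s\<^sup>2) ^ CARD('n) * (cmod (det A))\<^sup>2"
          using s by (simp add: dAs norm_mult norm_power power_mult_distrib power_mult[symmetric]
              mult.commute)
        then have "root CARD('n) (\<alpha> / N * (cmod (det As))\<^sup>2)
            = root CARD('n) ((s\<^sup>2) ^ CARD('n)) * root CARD('n) (\<alpha> / N * (cmod (det A))\<^sup>2)"
          by (subst real_root_mult[symmetric]) (simp add: mult_ac)
        then show ?thesis by (simp add: c'_def C_def real_root_power_cancel)
      qed
      define E where "E x b v = H (x0 + s *\<^sub>R L x) (s *\<^sub>R L b) (s *\<^sub>R L v)" for x b v
      have "\<exists>x\<in>ball 0 1. c' - 4 * s\<^sup>2 * \<eta> < (\<Sum>b\<in>Basis. E x b b)"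
      proof (rule laplacian_average_ge[where \<rho>=w and a=a and b=b and v="\<lambda>y x. g (x0 - y + x v* As)"
            and G="\<lambda>x. G (x0 + s *\<^sub>R L x)" and D="\<lambda>x v. D (x0 + s *\<^sub>R L x) (s *\<^sub>R L v)" and E=E])
        show "2 \<le> DIM(complex ^ 'n)" by (simp add: Suc_leI)
        show "continuous_on (cbox a b \<times> cball 0 1) (\<lambda>(y, x). g (x0 - y + x v* As))"
          unfolding split_def Ls
          by (rule continuous_on_compose2[OF g]) (auto intro!: continuous_intros
              bounded_linear.continuous_on[OF L])
        show "visc_laplacian_ge (ball 0 1) c' (\<lambda>x. g (x0 - y + x v* As))" if "y \<in> cbox a b" for y
          unfolding c'_def N_def
        proof (rule visc_ma_ge_imp_visc_laplacian_ge[OF ma])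
          show "det As \<noteq> 0" using A s by (simp add: dAs)
          show "x0 - y + x v* As \<in> ball z \<rho>" if "x \<in> ball 0 1" for x
            using xs(2)[of x y] \<open>y \<in> cbox a b\<close> that by (simp add: Ls)
        qed
        show "G (x0 + s *\<^sub>R L x) = integral (cbox a b) (\<lambda>y. w y * g (x0 - y + x v* As))" if
            "x \<in> cball 0 1" for x
          using G(1)[OF xs(1)[OF that y0]] by (simp add: Ls algebra_simps)
        have lin: "((\<lambda>x. x0 + s *\<^sub>R L x) has_derivative (\<lambda>v. s *\<^sub>R L v)) (at x)" for x
          by (auto intro!: derivative_eq_intros bounded_linear.has_derivative[OF L])
        show D: "((\<lambda>x. G (x0 + s *\<^sub>R L x)) has_derivative (\<lambda>v. D (x0 + s *\<^sub>R L x) (s *\<^sub>R L v)))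
            (at x)" for x
          by (rule has_derivative_compose[OF lin c(2)[OF UNIV_I]])
        show "continuous_on (cball 0 1) (\<lambda>x. G (x0 + s *\<^sub>R L x))"
          by (rule has_derivative_continuous_on) (rule has_derivative_at_withinI[OF D])
        show "((\<lambda>x. D (x0 + s *\<^sub>R L x) (s *\<^sub>R L b)) has_derivative E x b) (at x)" for x b
          unfolding E_def by (rule has_derivative_compose[OF lin c(3)[OF UNIV_I]])
        show "0 < 4 * s\<^sup>2 * \<eta>" using s \<eta> by simp
      qed (use w in auto)
      then obtain x where x: "x \<in> ball 0 1" "c' - 4 * s\<^sup>2 * \<eta> < (\<Sum>b\<in>Basis. E x b b)" by blast
      define x' where "x' = x0 + s *\<^sub>R L x"
      have "(\<Sum>b\<in>Basis. E x b b) = 4 * s\<^sup>2 * h x'"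
      proof -
        have Hs: "H x' (s *\<^sub>R v) (s *\<^sub>R u) = s\<^sup>2 * H x' v u" for v u
          using linear_scale[OF c2_data_bilinear(1)[OF c2 UNIV_I]] linear_scale[OF
              c2_data_bilinear(2)[OF c2 UNIV_I]]
          by (simp add: power2_eq_square)
        have "L (axis i 1) = A $ i" "L (axis i \<i>) = \<i> *s A $ i" for i
          by (simp_all add: L_def axis_vector_matrix)
        then show ?thesis
          unfolding sum_Basis_complex_vec E_def x'_def[symmetric] h_def hform_complex_hessian[OF
              c2 UNIV_I] sum_distrib_left Hs
          by (intro sum.cong) (simp_all add: algebra_simps)
      qed
      with x(2) have "4 * s\<^sup>2 * (C - \<eta>) < 4 * s\<^sup>2 * h x'" by (simp add: c' algebra_simps)
      then have "C - \<eta> < h x'" using s by simp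
      moreover have "dist x' x0 < d"
        using small[of x] x(1) sK by (simp add: x'_def dist_norm)
      then have "\<bar>h x' - h x0\<bar> < \<eta>" using d(2) by (simp add: dist_real_def)
      moreover have "C = h x0 + 2 * \<eta>" unfolding \<eta>_def by (simp add: field_simps)
      ultimately show False by linarith
    qed
    show ?thesis
      using hermitian_of_trace_lower_bounds[OF hermitian_complex_hessian[OF c2 UNIV_I] _ tr] ma(2)
          N by simp
  qed
  then have "0 \<le> hform (complex_hessian G x) \<xi>" "\<alpha> \<le> ma_density G x" if "x \<in> ball z (\<rho> / 2)" for x \<xi>
    unfolding ma_density_def N_def[symmetric] using that N by (auto simp: divide_le_eq mult.commute)
  then show ?thesis using that[OF c2 G(2)] by blast
qed

section \<open>Local comparison of a subsolution with a supersolution\<close>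

definition visc_ma_le :: "(complex ^ 'n) set \<Rightarrow> real \<Rightarrow> (complex ^ 'n \<Rightarrow> real) \<Rightarrow> bool" where
  "visc_ma_le S \<beta> g \<longleftrightarrow> (\<forall>z\<in>S. \<forall>q. C2_near q z \<and> q z = g z \<and> (\<forall>\<^sub>F y in nhds z. q y \<le> g y)
      \<and> ddc_nonneg q z
     \<longrightarrow> ma_density q z \<le> \<beta>)"

text \<open>The smoothed \<open>g\<close> plus a quadratic, shifted vertically, touches
  \<open>w\<close> from below and is tested there. Of the Hessian of
  \<open>\<kappa> * (norm (z - a))\<^sup>2\<close>, half is spent on the term
  \<open>- (\<kappa> / 2) * (norm (z - z0))\<^sup>2\<close> that keeps the contact point near
  \<open>z0\<close>; the other half yields the gain
  \<open>(\<kappa> / 2) ^ CARD('n)\<close>.\<close>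

lemma visc_ma_local_comparison:
  fixes g w :: "complex ^ 'n \<Rightarrow> real"
  assumes \<rho>: "\<rho> > 0" and g: "continuous_on (cball z0 \<rho>) g" and w: "continuous_on (cball z0 \<rho>) w"
    and sub: "visc_ma_ge (ball z0 \<rho>) \<alpha> g" "0 \<le> \<alpha>" and sup: "visc_ma_le (ball z0 \<rho>) \<beta> w"
    and \<kappa>: "\<kappa> > 0"
    and max: "\<And>z. z \<in> cball z0 \<rho> \<Longrightarrow> g z + \<kappa> * (norm (z - a))\<^sup>2 - w z
        \<le> g z0 + \<kappa> * (norm (z0 - a))\<^sup>2 - w z0"
  shows "\<alpha> + 4 ^ CARD('n) * fact CARD('n) * (\<kappa> / 2) ^ CARD('n) \<le> \<beta>"
proof -
  \<comment> \<open>The regularization expects a function continuous on the whole space; composing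
    with the projection onto the ball leaves \<open>g\<close> unchanged on the ball.\<close>
  define g' where "g' z = g (closest_point (cball z0 \<rho>) z)" for z
  have g'c: "continuous_on UNIV g'"
    unfolding g'_def using \<rho>
    by (intro continuous_on_compose2[OF g continuous_on_closest_point]) (auto intro!:
        closest_point_in_set)
  have g'g: "g' z = g z" if "z \<in> cball z0 \<rho>" for z using that by (simp add: g'_def
      closest_point_self)
  have "visc_ma_ge (ball z0 \<rho>) \<alpha> g'"
    unfolding visc_ma_ge_def
  proof (intro ballI allI impI, elim conjE)
    fix z q assume z: "z \<in> ball z0 \<rho>" and q: "C2_near q z" "g' z = q z" and ev:
        "\<forall>\<^sub>F y in nhds z. g' y \<le> q y"
    have "\<forall>\<^sub>F y in nhds z. y \<in> ball z0 \<rho>" using z by (intro eventually_nhds_in_open) auto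
    with ev have "\<forall>\<^sub>F y in nhds z. g y \<le> q y" by eventually_elim (simp add: g'g less_imp_le)
    moreover have "g z = q z" using q(2) z by (simp add: g'g less_imp_le)
    ultimately show "\<alpha> \<le> ma_density q z" using sub(1) z q(1) unfolding visc_ma_ge_def by blast
  qed
  \<comment> \<open>At distance \<open>\<rho> / 4\<close> from \<open>z0\<close> the penalty is
    \<open>\<kappa> / 2 * (\<rho> / 4)\<^sup>2 = 4 * \<epsilon>\<close>. It exceeds the smoothing
    errors, at most \<open>\<epsilon>\<close> at \<open>z0\<close> and at the competing
    point.\<close>
  moreover define \<epsilon> where "\<epsilon> = \<kappa> * \<rho>\<^sup>2 / 128"
  have \<epsilon>: "\<epsilon> > 0" using \<kappa> \<rho> by (simp add: \<epsilon>_def)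
  ultimately obtain G D H where c2: "c2_data UNIV G D H"
    and G: "\<And>x. x \<in> cball z0 \<rho> \<Longrightarrow> \<bar>G x - g' x\<bar> \<le> \<epsilon>"
    "\<And>x \<xi>. x \<in> ball z0 (\<rho> / 2) \<Longrightarrow> 0 \<le> hform (complex_hessian G x) \<xi>"
    "\<And>x. x \<in> ball z0 (\<rho> / 2) \<Longrightarrow> \<alpha> \<le> ma_density G x"
    using visc_ma_ge_regularization[OF g'c _ sub(2) _ \<rho>] by blast
  have close: "\<bar>G x - g x\<bar> \<le> \<epsilon>" if "x \<in> cball z0 \<rho>" for x using G(1)[OF that] g'g[OF that] by simp
  define p where "p z = (G z + \<kappa> * (norm (z - a))\<^sup>2) + (- (\<kappa> / 2)) * (norm (z - z0))\<^sup>2" for z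
  note n2 = c2_data_norm_square[of _ "_ :: complex ^ 'n"]
  note c2a = c2_data_add[OF c2 n2[of \<kappa> a]]
  note c2p = c2_data_add[OF c2a n2[of "- (\<kappa> / 2)" z0]]
  have hp: "complex_hessian p z = complex_hessian G z + mat (complex_of_real (\<kappa> / 2))" for z
    unfolding p_def[abs_def] complex_hessian_add[OF c2a n2 UNIV_I] complex_hessian_add[OF c2 n2
        UNIV_I]
      complex_hessian_norm_square
    by (simp add: vec_eq_iff mat_def)
  define K where "K = cball z0 (\<rho> / 4)"
  have K: "K \<subseteq> cball z0 \<rho>" "K \<subseteq> ball z0 (\<rho> / 2)" using \<rho> by (auto simp: K_def)
  have "continuous_on K p"
    using c2_dataD(2)[OF c2p UNIV_I] unfolding p_def[abs_def]
    by (intro has_derivative_continuous_on) (rule has_derivative_at_withinI)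
  then have "continuous_on K (\<lambda>z. p z - w z)"
    by (intro continuous_intros continuous_on_subset[OF w K(1)])
  moreover have "compact K" "K \<noteq> {}" using \<rho> by (auto simp: K_def)
  ultimately obtain z1 where z1: "z1 \<in> K" "\<And>z. z \<in> K \<Longrightarrow> p z - w z \<le> p z1 - w z1"
    using continuous_attains_sup[of K "\<lambda>z. p z - w z"] by blast
  have "dist z0 z1 < \<rho> / 4"
  proof (rule ccontr)
    assume "\<not> dist z0 z1 < \<rho> / 4"
    then have n: "norm (z1 - z0) = \<rho> / 4" using z1(1) by (simp add: K_def dist_norm
        norm_minus_commute)
    have "p z1 = G z1 + \<kappa> * (norm (z1 - a))\<^sup>2 - 4 * \<epsilon>"
      unfolding p_def n \<epsilon>_def by (simp add: power2_eq_square)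
    moreover have "p z0 = G z0 + \<kappa> * (norm (z0 - a))\<^sup>2" by (simp add: p_def)
    moreover have "p z0 - w z0 \<le> p z1 - w z1" using z1(2)[of z0] \<rho> by (simp add: K_def)
    moreover have "\<bar>G z1 - g z1\<bar> \<le> \<epsilon>" "\<bar>G z0 - g z0\<bar> \<le> \<epsilon>" using close z1(1) K(1) \<rho> by auto
    ultimately show False using max[of z1] z1(1) K(1) \<epsilon> by (auto simp: abs_le_iff)
  qed
  then have "\<forall>\<^sub>F z in nhds z1. z \<in> ball z0 (\<rho> / 4)" by (intro eventually_nhds_in_open) auto
  then have ev: "\<forall>\<^sub>F z in nhds z1. p z + (w z1 - p z1) \<le> w z"
    by (rule eventually_mono) (use z1(2) in \<open>force simp: K_def algebra_simps\<close>)
  define q where "q z = p z + (w z1 - p z1)" for z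
  note c2q = c2_data_add[OF c2p c2_data_const[of "w z1 - p z1"]]
  have hq: "complex_hessian q z = complex_hessian G z + mat (complex_of_real (\<kappa> / 2))" for z
  proof -
    have "complex_hessian (\<lambda>z. w z1 - p z1) z = 0"
      by (simp add: vec_eq_iff complex_hessian_nth[OF c2_data_const UNIV_I] complex_eq_iff)
    then show ?thesis
      unfolding q_def[abs_def] using complex_hessian_add[OF c2p[folded p_def] c2_data_const
          UNIV_I, of "w z1 - p z1"]
      by (simp add: hp)
  qed
  have z1b: "z1 \<in> ball z0 (\<rho> / 2)" "z1 \<in> ball z0 \<rho>" using z1(1) K \<rho> by (auto simp: K_def)
  have "hform (mat (complex_of_real (\<kappa> / 2))) \<xi> \<ge> 0" for \<xi> :: "complex ^ 'n"
  proof -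
    have "0 \<le> (\<kappa> / 2 * (2 * (\<xi> \<bullet> \<xi>)) + \<kappa> / 2 * (2 * ((\<i> *s \<xi>) \<bullet> (\<i> *s \<xi>)))) / 4"
      using \<kappa> by (intro divide_nonneg_nonneg add_nonneg_nonneg mult_nonneg_nonneg) auto
    then show ?thesis
      using hform_complex_hessian[OF n2[of "\<kappa> / 2" 0] UNIV_I, of 0 \<xi>]
      unfolding complex_hessian_norm_square by (simp only:)
  qed
  then have "ddc_nonneg q z1"
    using G(2)[OF z1b(1)] unfolding ddc_nonneg_iff_hform hq
    by (simp add: hform_def distrib_right sum.distrib)
  moreover have "C2_near q z1"
    unfolding C2_near_iff by (intro exI conjI) (rule UNIV_I, rule c2q[folded p_def, folded q_def])
  ultimately have "ma_density q z1 \<le> \<beta>"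
    using sup z1b(2) ev unfolding visc_ma_le_def q_def[abs_def] by auto
  moreover have "ma_density G z1 + 4 ^ CARD('n) * fact CARD('n) * (\<kappa> / 2) ^ CARD('n)
      \<le> ma_density q z1"
    unfolding ma_density_def hq distrib_left[symmetric]
    using det_add_scalar_ge[OF hermitian_complex_hessian[OF c2 UNIV_I] G(2)[OF z1b(1)], of
        "\<kappa> / 2"] \<kappa>
    by (intro mult_left_mono) auto
  ultimately show ?thesis using G(3)[OF z1b(1)] by simp
qed

subsection \<open>Test functions with separated variables\<close>

text \<open>In its uses \<open>c\<close> is the time scale \<open>l\<close> for the subsolution and
  \<open>1\<close> for the supersolution. All time dependence is in \<open>A\<close>, so the time
  derivative of the test function is \<open>A'\<close> at every \<open>z\<close>.\<close>

lemma C12_near_separated: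
  fixes q :: "complex ^ 'n \<Rightarrow> real"
  assumes q: "C2_near q z0" and A: "\<And>s. (A has_real_derivative A' s) (at s)" "continuous_on UNIV A'"
  shows "C12_near (\<lambda>s z. c * q z + A s) t0 z0"
proof -
  obtain U D H where z0: "z0 \<in> U" and c2: "c2_data U q D H" using q unfolding C2_near_iff by blast
  note d = c2_dataD[OF c2]
  have cD: "continuous_on U (\<lambda>z. D z v)" for v
    by (rule has_derivative_continuous_on) (rule has_derivative_at_withinI[OF d(3)])
  have "((\<lambda>s. c * q z + A s) has_real_derivative A' s) (at s)" for s z
    using DERIV_add[OF DERIV_const A(1)[of s]] by simp
  moreover have "((\<lambda>z. c * q z + A s) has_derivative (\<lambda>v. c * D z v)) (at z)" if "z \<in> U" for s z
    using has_derivative_add[OF has_derivative_mult_right[OF d(2)[OF that]] has_derivative_const]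
        by simp
  moreover have "((\<lambda>z. c * D z v) has_derivative (\<lambda>w. c * H z v w)) (at z)" if "z \<in> U" for z v
    by (intro has_derivative_mult_right d that)
  moreover have "continuous_on (UNIV \<times> U) (\<lambda>p. A' (fst p))"
    by (rule continuous_on_compose2[OF A(2)]) (auto intro!: continuous_intros)
  moreover have "continuous_on (UNIV \<times> U) (\<lambda>p. c * D (snd p) v)" for v
    by (intro continuous_intros continuous_on_compose2[OF cD[of v]]) auto
  moreover have "continuous_on (UNIV \<times> U) (\<lambda>p. c * H (snd p) v w)" for v w
    by (intro continuous_intros continuous_on_compose2[OF d(4)[of v w]]) auto
  ultimately show ?thesis
    unfolding C12_near_def using z0 d(1)
    by (intro exI[of _ "(UNIV :: real set) \<times> U"] exI[of _ "\<lambda>p. A' (fst p)"] exI[of _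
        "\<lambda>p v. c * D (snd p) v"]
        exI[of _ "\<lambda>p v w. c * H (snd p) v w"]) (auto intro: open_Times)
qed

lemma complex_hessian_affine:
  fixes q :: "complex ^ 'n \<Rightarrow> real"
  assumes "C2_near q z"
  shows "complex_hessian (\<lambda>z. c * q z + d) z = complex_hessian (\<lambda>z. c * q z) z"
    "ma_density (\<lambda>z. c * q z + d) z = c ^ CARD('n) * ma_density q z"
proof -
  obtain U D H where z: "z \<in> U" and c2: "c2_data U q D H" using assms unfolding C2_near_iff by blast
  have "c2_data U (\<lambda>z. d) (\<lambda>z v. 0) (\<lambda>z v w. 0)"
    by (rule c2_data_subset[OF c2_data_const c2_dataD(1)[OF c2]]) simp
  from complex_hessian_add[OF c2_data_cmult[OF c2] this z]
  have "complex_hessian (\<lambda>z. c * q z + d) z = complex_hessian (\<lambda>z. c * q z) z + complex_hessian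
      (\<lambda>z. d) z" .
  moreover have "complex_hessian (\<lambda>z. d) z = 0"
    by (simp add: vec_eq_iff complex_hessian_nth[OF c2_data_const UNIV_I] complex_eq_iff)
  ultimately show 1: "complex_hessian (\<lambda>z. c * q z + d) z = complex_hessian (\<lambda>z. c * q z) z" by simp
  show "ma_density (\<lambda>z. c * q z + d) z = c ^ CARD('n) * ma_density q z"
    using ma_density_cmult[OF c2 z, of c] unfolding ma_density_def 1 .
qed

lemma visc_subsolution_separated:
  fixes q :: "complex ^ 'n \<Rightarrow> real"
  assumes u: "visc_subsolution_eq \<Omega> T F f u" and s1: "0 < s1" "s1 < T" and z1: "z1 \<in> \<Omega>"
    and q: "C2_near q z1" and A: "\<And>s. (A has_real_derivative A' s) (at s)" "continuous_on UNIV A'"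
    and eq: "u s1 z1 = c * q z1 + A s1" and ev: "\<forall>\<^sub>F (s, z) in nhds (s1, z1). u s z \<le> c * q z + A s"
  shows "exp (A' s1 + F z1 (u s1 z1)) * f z1 \<le> c ^ CARD('n) * ma_density q z1"
proof -
  have "upper_test (\<lambda>s z. c * q z + A s) u s1 z1"
    unfolding upper_test_def using C12_near_separated[OF q A] eq ev by simp
  then have "exp (deriv (\<lambda>s. c * q z1 + A s) s1 + F z1 (c * q z1 + A s1)) * f z1
      \<le> ma_density (\<lambda>z. c * q z + A s1) z1"
    using u s1 z1 unfolding visc_subsolution_eq_def by fastforce
  moreover have "((\<lambda>s. c * q z1 + A s) has_real_derivative A' s1) (at s1)"
    using DERIV_add[OF DERIV_const A(1)[of s1]] by simp
  then have "deriv (\<lambda>s. c * q z1 + A s) s1 = A' s1" by (rule DERIV_imp_deriv)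
  ultimately show ?thesis using complex_hessian_affine(2)[OF q] eq by simp
qed

lemma visc_supersolution_separated:
  fixes q :: "complex ^ 'n \<Rightarrow> real"
  assumes u: "visc_supersolution_eq \<Omega> T F f u" and s1: "0 < s1" "s1 < T" and z1: "z1 \<in> \<Omega>"
    and q: "C2_near q z1" "ddc_nonneg q z1" and A: "\<And>s. (A has_real_derivative A' s) (at s)"
        "continuous_on UNIV A'"
    and eq: "u s1 z1 = q z1 + A s1" and ev: "\<forall>\<^sub>F (s, z) in nhds (s1, z1). q z + A s \<le> u s z"
  shows "ma_density q z1 \<le> exp (A' s1 + F z1 (u s1 z1)) * f z1"
proof -
  have "lower_test (\<lambda>s z. 1 * q z + A s) u s1 z1"
    unfolding lower_test_def using C12_near_separated[OF q(1) A, of 1] eq ev by simp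
  moreover have "ddc_nonneg (\<lambda>z. 1 * q z + A s1) z1"
    using q(2) unfolding ddc_nonneg_def complex_hessian_affine(1)[OF q(1)] by simp
  ultimately have "ma_density (\<lambda>z. 1 * q z + A s1) z1
      \<le> exp (deriv (\<lambda>s. 1 * q z1 + A s) s1 + F z1 (1 * q z1 + A s1)) * f z1"
    using u s1 z1 unfolding visc_supersolution_eq_def by fastforce
  moreover have "((\<lambda>s. 1 * q z1 + A s) has_real_derivative A' s1) (at s1)"
    using DERIV_add[OF DERIV_const A(1)[of s1]] by simp
  then have "deriv (\<lambda>s. 1 * q z1 + A s) s1 = A' s1" by (rule DERIV_imp_deriv)
  ultimately show ?thesis using complex_hessian_affine(2)[OF q(1), of 1] eq by simp
qed

subsection \<open>Comparison by doubling the time variable\<close>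

text \<open>The last property says that maximizers cannot jump: near \<open>z0\<close> the values of
  \<open>h\<close> change little, so a maximizer stays where the quadratic peak at \<open>r0\<close>
  loses little. This keeps maximizers inside the time interval, as a test function requires.\<close>

lemma marginal_max:
  fixes h :: "real \<Rightarrow> 'a::metric_space \<Rightarrow> real"
  assumes h: "continuous_on (cball r0 \<tau> \<times> K) (\<lambda>(r, z). h r z)" and K: "compact K" "z0 \<in> K"
    and \<tau>: "\<tau> > 0" and k: "k > 0"
    and peak: "\<And>r. r \<in> cball r0 \<tau> \<Longrightarrow> h r z0 \<le> h r0 z0 - k * (r - r0)\<^sup>2"
  obtains g where "continuous_on K g" "\<And>r z. r \<in> cball r0 \<tau> \<Longrightarrow> z \<in> K \<Longrightarrow> h r z \<le> g z"
    "\<And>z. z \<in> K \<Longrightarrow> \<exists>r\<in>cball r0 \<tau>. g z = h r z"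
    "\<And>e. e > 0 \<Longrightarrow> \<exists>d>0. \<forall>z\<in>K. \<forall>r\<in>cball r0 \<tau>. dist z z0 < d \<and> g z = h r z \<longrightarrow> \<bar>r - r0\<bar> < e"
proof -
  have "\<exists>r\<in>cball r0 \<tau>. \<forall>r'\<in>cball r0 \<tau>. h r' z \<le> h r z" if "z \<in> K" for z
  proof (rule continuous_attains_sup)
    show "continuous_on (cball r0 \<tau>) (\<lambda>r. h r z)"
      by (rule continuous_on_compose2[OF h, of _ "\<lambda>r. (r, z)", simplified]) (auto intro!:
          continuous_intros that)
  qed (use \<tau> in auto)
  then obtain R where R: "\<And>z. z \<in> K \<Longrightarrow> R z \<in> cball r0 \<tau>"
    "\<And>z r. z \<in> K \<Longrightarrow> r \<in> cball r0 \<tau> \<Longrightarrow> h r z \<le> h (R z) z" by metis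
  define g where "g z = h (R z) z" for z
  have "uniformly_continuous_on (cball r0 \<tau> \<times> K) (\<lambda>(r, z). h r z)"
    by (intro compact_uniformly_continuous h compact_Times K compact_cball)
  then have unif: "\<exists>d>0. \<forall>r\<in>cball r0 \<tau>. \<forall>z\<in>K. \<forall>z'\<in>K. dist z z' < d \<longrightarrow> \<bar>h r z - h r z'\<bar> < e" if
      "e > 0" for e
    using that unfolding uniformly_continuous_on_def by (force simp: dist_Pair_Pair dist_real_def)
  have "continuous_on K g"
    unfolding continuous_on_iff
  proof (intro ballI allI impI)
    fix z and e :: real assume z: "z \<in> K" and e: "0 < e"
    obtain d where d: "d > 0" "\<And>r z z'. r \<in> cball r0 \<tau> \<Longrightarrow> z \<in> K \<Longrightarrow> z' \<in> K \<Longrightarrow> dist z z' < d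
        \<Longrightarrow> \<bar>h r z - h r z'\<bar> < e"
      using unif[OF e] by blast
    have "dist (g z') (g z) < e" if z': "z' \<in> K" "dist z' z < d" for z'
    proof -
      have "g z' < g z + e" using d(2)[OF R(1)[OF z'(1)] z'(1) z z'(2)] R(2)[OF z R(1)[OF z'(1)]]
          by (simp add: g_def)
      moreover have "g z < g z' + e" using d(2)[OF R(1)[OF z] z'(1) z z'(2)] R(2)[OF z'(1) R(1)[OF
          z]] by (simp add: g_def)
      ultimately show ?thesis by (simp add: dist_real_def)
    qed
    then show "\<exists>d>0. \<forall>z'\<in>K. dist z' z < d \<longrightarrow> dist (g z') (g z) < e" using d(1) by blast
  qed
  moreover have "\<exists>d>0. \<forall>z\<in>K. \<forall>r\<in>cball r0 \<tau>. dist z z0 < d \<and> g z = h r z \<longrightarrow> \<bar>r - r0\<bar> < e" if e: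
      "e > 0" for e
  proof -
    \<comment> \<open>The change of \<open>h\<close> enters twice, each time below half of
      \<open>k * e\<^sup>2\<close>, against the loss \<open>k * (r - r0)\<^sup>2\<close> at the
      peak.\<close>
    have "k * e\<^sup>2 / 2 > 0" using k e by simp
    from unif[OF this] obtain d where d: "d > 0"
      "\<And>r z z'. r \<in> cball r0 \<tau> \<Longrightarrow> z \<in> K \<Longrightarrow> z' \<in> K \<Longrightarrow> dist z z' < d \<Longrightarrow> \<bar>h r z - h r z'\<bar> < k * e\<^sup>2 / 2"
          by blast
    have "\<bar>r - r0\<bar> < e" if "z \<in> K" "r \<in> cball r0 \<tau>" "dist z z0 < d" "g z = h r z" for z r
    proof -
      have r0: "r0 \<in> cball r0 \<tau>" using \<tau> by simp
      have "h r0 z \<le> h r z" using R(2)[OF that(1) r0] that(4) by (simp add: g_def)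
      then have "k * (r - r0)\<^sup>2 < k * e\<^sup>2"
        using d(2)[OF that(2,1) K(2) that(3)] d(2)[OF r0 that(1) K(2) that(3)] peak[OF that(2)] by
            linarith
      then have "(r - r0)\<^sup>2 < e\<^sup>2" using k by simp
      then show ?thesis using e power2_less_imp_less[of "\<bar>r - r0\<bar>" e] by simp
    qed
    then show ?thesis using d(1) by blast
  qed
  ultimately show ?thesis using that[of g] R unfolding g_def by blast
qed

lemma eventually_nhds_prod_snd:
  assumes "\<forall>\<^sub>F z in nhds z1. P z"
  shows "\<forall>\<^sub>F p in nhds (s1, z1). P (snd p)"
proof -
  have "(snd \<longlongrightarrow> z1) (nhds (s1, z1))" using tendsto_snd[OF filterlim_ident, of "(s1, z1)"] by simp
  with assms show ?thesis by (rule eventually_compose_filterlim)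
qed

lemma eventually_nhds_prod_fst:
  assumes "\<forall>\<^sub>F s in nhds s1. P s"
  shows "\<forall>\<^sub>F p in nhds (s1, z1). P (fst p)"
proof -
  have "(fst \<longlongrightarrow> s1) (nhds (s1, z1))" using tendsto_fst[OF filterlim_ident, of "(s1, z1)"] by simp
  with assms show ?thesis by (rule eventually_compose_filterlim)
qed

text \<open>At an interior maximum of the doubled function the penalization \<open>k (r - t)\<^sup>2\<close> is replaced by a
  larger separated function of \<open>r\<close> and \<open>t\<close> with the same slope \<open>p\<close> in both variables; partial
  maximization in each time variable then leaves an elliptic comparison in \<open>z\<close> alone.\<close>

lemma parabolic_doubling_contradiction:
  fixes u :: "real \<Rightarrow> complex ^ 'n \<Rightarrow> real" and \<Omega> :: "(complex ^ 'n) set"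
  assumes sub: "visc_subsolution_eq \<Omega> T F f u" and sup: "visc_supersolution_eq \<Omega> T F f u"
    and \<Omega>: "open \<Omega>" and f: "\<And>z. z \<in> \<Omega> \<Longrightarrow> 0 \<le> f z" "continuous_on \<Omega> f"
    and F: "continuous_on (\<Omega> \<times> UNIV) (\<lambda>(z, r). F z r)" "mono (F z0)"
    and u: "continuous_on ({0<..<T} \<times> \<Omega>) (\<lambda>(t, z). u t z)"
    and l: "l > 0" and r0: "0 < l * r0" "l * r0 < T" and t0: "0 < t0" "t0 < T" and z0: "z0 \<in> \<Omega>"
    and k: "k > 0" and \<kappa>: "\<kappa> > 0"
    and \<theta>: "\<And>r. (\<theta> has_real_derivative \<theta>' r) (at r)" "continuous_on UNIV \<theta>'"
      "\<And>r. CARD('n) * ln l \<le> \<theta>' r"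
    and \<sigma>: "\<sigma> > 0"
    and max: "\<And>r t z. \<bar>r - r0\<bar> \<le> \<sigma> \<Longrightarrow> \<bar>t - t0\<bar> \<le> \<sigma> \<Longrightarrow> norm (z - z0) \<le> \<sigma> \<Longrightarrow>
      u (l * r) z / l - u t z - \<theta> r + \<kappa> * (norm z)\<^sup>2 - k * (r - t)\<^sup>2
      \<le> u (l * r0) z0 / l - u t0 z0 - \<theta> r0 + \<kappa> * (norm z0)\<^sup>2 - k * (r0 - t0)\<^sup>2"
    and ge: "u t0 z0 \<le> u (l * r0) z0"
  shows False
proof -
  \<comment> \<open>\<open>p\<close> is the slope of \<open>k * (r - t)\<^sup>2\<close> in
    \<open>r\<close> at the maximum, and minus its slope in \<open>t\<close>. In
    \<open>3 * k\<close>, the part \<open>2 * k\<close> dominates the coupling of \<open>r\<close>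
    and \<open>t\<close>, and the remaining \<open>k\<close> makes each peak strict.\<close>
  define p where "p = 2 * k * (r0 - t0)"
  define a where "a r = \<theta> r + p * (r - r0) + 3 * k * (r - r0)\<^sup>2" for r
  define a' where "a' r = \<theta>' r + p + 6 * k * (r - r0)" for r
  define b where "b t = - p * (t - t0) + 3 * k * (t - t0)\<^sup>2" for t
  define b' where "b' t = - p + 6 * k * (t - t0)" for t
  have a': "(a has_real_derivative a' r) (at r)" for r
    unfolding a_def a'_def by (auto intro!: derivative_eq_intros \<theta>)
  have b': "(b has_real_derivative b' t) (at t)" for t
    unfolding b_def b'_def by (auto intro!: derivative_eq_intros)
  obtain \<rho>1 where \<rho>1: "\<rho>1 > 0" "cball z0 \<rho>1 \<subseteq> \<Omega>" using \<Omega> z0 open_contains_cball by blast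
  define \<rho>0 where "\<rho>0 = min \<rho>1 \<sigma>"
  define K where "K = cball z0 \<rho>0"
  have \<rho>0: "\<rho>0 > 0" using \<rho>1 \<sigma> by (simp add: \<rho>0_def)
  have K\<Omega>: "K \<subseteq> \<Omega>" using \<rho>1 by (force simp: K_def \<rho>0_def)
  have K: "compact K" "z0 \<in> K" using \<rho>0 by (auto simp: K_def)
  have Kn: "norm (z - z0) \<le> \<sigma>" if "z \<in> K" for z using that by (simp add: K_def \<rho>0_def dist_norm
      norm_minus_commute)
  define \<tau> where "\<tau> = min \<sigma> (min (min (r0 / 2) ((T / l - r0) / 2)) (min (t0 / 2) ((T - t0) / 2)))"
  have r0': "0 < r0" "r0 < T / l" using r0 l by (auto simp: zero_less_mult_iff field_simps)
  have \<tau>: "\<tau> > 0" "\<tau> \<le> \<sigma>" using \<sigma> r0' t0 by (auto simp: \<tau>_def)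
  have \<tau>r: "0 < l * r \<and> l * r < T" if "r \<in> cball r0 \<tau>" for r
  proof -
    have "\<tau> \<le> r0 / 2" "\<tau> \<le> (T / l - r0) / 2" by (simp_all only: \<tau>_def min_le_iff_disj order_refl
        simp_thms)
    then have "0 < r" "r < T / l" using that r0' by (auto simp: dist_real_def)
    then show ?thesis using l by (simp add: field_simps)
  qed
  have \<tau>t: "0 < t \<and> t < T" if "t \<in> cball t0 \<tau>" for t
  proof -
    have "\<tau> \<le> t0 / 2" "\<tau> \<le> (T - t0) / 2" by (simp_all only: \<tau>_def min_le_iff_disj order_refl
        simp_thms)
    then show ?thesis using that t0 by (auto simp: dist_real_def)
  qed
  define h where "h r z = u (l * r) z / l - a r" for r z
  define e where "e t z = - (u t z + b t)" for t z
  have cu1: "continuous_on (cball r0 \<tau> \<times> K) (\<lambda>p. u (l * fst p) (snd p))"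
    by (rule continuous_on_compose2[OF u, of _ "\<lambda>p. (l * fst p, snd p)", simplified])
      (use \<tau>r K\<Omega> in \<open>auto intro!: continuous_intros\<close>)
  have cu2: "continuous_on (cball t0 \<tau> \<times> K) (\<lambda>p. u (fst p) (snd p))"
    by (rule continuous_on_subset[OF u[unfolded split_def]]) (use \<tau>t K\<Omega> in auto)
  have ca: "continuous_on X a" "continuous_on X b" for X
    by (rule DERIV_continuous_on[OF has_field_derivative_at_within[OF a']],
        rule DERIV_continuous_on[OF has_field_derivative_at_within[OF b']])
  have ca2: "continuous_on X (\<lambda>p. a (fst p))" "continuous_on X (\<lambda>p. b (fst p))" for X ::
      "(real \<times> (complex ^ 'n)) set"
    by (auto intro!: continuous_on_compose2[OF ca(1)[of UNIV]] continuous_on_compose2[OF ca(2)[of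
        UNIV]] continuous_intros)
  have ch: "continuous_on (cball r0 \<tau> \<times> K) (\<lambda>(r, z). h r z)"
    unfolding h_def split_def using l by (intro continuous_intros cu1 ca2) auto
  have ce: "continuous_on (cball t0 \<tau> \<times> K) (\<lambda>(t, z). e t z)"
    unfolding e_def split_def by (intro continuous_intros cu2 ca2)
  have sep: "h r z + e t z + \<kappa> * (norm z)\<^sup>2 + k * (r - r0)\<^sup>2 + k * (t - t0)\<^sup>2
      \<le> h r0 z0 + e t0 z0 + \<kappa> * (norm z0)\<^sup>2"
    if "r \<in> cball r0 \<tau>" "t \<in> cball t0 \<tau>" "z \<in> K" for r t z
  proof -
    \<comment> \<open>This square is the difference between twice the sum of the squares of
      \<open>r - r0\<close> and \<open>t - t0\<close> and the square of their difference, which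
      decouples the two times.\<close>
    have "0 \<le> k * ((r - r0) + (t - t0))\<^sup>2" using k by simp
    then have "k * (r - t)\<^sup>2 \<le> k * (r0 - t0)\<^sup>2 + p * ((r - r0) - (t - t0)) + 2 * k * (r - r0)\<^sup>2 +
        2 * k * (t - t0)\<^sup>2"
      by (simp add: p_def power2_eq_square algebra_simps)
    moreover have "\<bar>r - r0\<bar> \<le> \<sigma>" "\<bar>t - t0\<bar> \<le> \<sigma>" using that \<tau> by (auto simp: dist_real_def)
    from max[OF this Kn[OF that(3)]]
    have "u (l * r) z / l - u t z - \<theta> r + \<kappa> * (norm z)\<^sup>2 - k * (r - t)\<^sup>2
      \<le> u (l * r0) z0 / l - u t0 z0 - \<theta> r0 + \<kappa> * (norm z0)\<^sup>2 - k * (r0 - t0)\<^sup>2" .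
    ultimately show ?thesis by (simp add: h_def e_def a_def b_def algebra_simps)
  qed
  have rr: "r0 \<in> cball r0 \<tau>" "t0 \<in> cball t0 \<tau>" using \<tau> by auto
  have peak1: "h r z0 \<le> h r0 z0 - k * (r - r0)\<^sup>2" if "r \<in> cball r0 \<tau>" for r
    using sep[OF that rr(2) K(2)] by simp
  have peak2: "e t z0 \<le> e t0 z0 - k * (t - t0)\<^sup>2" if "t \<in> cball t0 \<tau>" for t
    using sep[OF rr(1) that K(2)] by simp
  obtain g where g: "continuous_on K g" "\<And>r z. r \<in> cball r0 \<tau> \<Longrightarrow> z \<in> K \<Longrightarrow> h r z \<le> g z"
    "\<And>z. z \<in> K \<Longrightarrow> \<exists>r\<in>cball r0 \<tau>. g z = h r z"
    "\<And>e. e > 0 \<Longrightarrow> \<exists>d>0. \<forall>z\<in>K. \<forall>r\<in>cball r0 \<tau>. dist z z0 < d \<and> g z = h r z \<longrightarrow> \<bar>r - r0\<bar> < e"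
    by (rule marginal_max[OF ch K \<tau>(1) k peak1]) (assumption, rule that)
  obtain w where w: "continuous_on K w" "\<And>r z. r \<in> cball t0 \<tau> \<Longrightarrow> z \<in> K \<Longrightarrow> e r z \<le> w z"
    "\<And>z. z \<in> K \<Longrightarrow> \<exists>r\<in>cball t0 \<tau>. w z = e r z"
    "\<And>\<epsilon>. \<epsilon> > 0 \<Longrightarrow> \<exists>d>0. \<forall>z\<in>K. \<forall>r\<in>cball t0 \<tau>. dist z z0 < d \<and> w z = e r z \<longrightarrow> \<bar>r - t0\<bar> < \<epsilon>"
    by (rule marginal_max[OF ce K \<tau>(1) k peak2]) (assumption, rule that)
  \<comment> \<open>\<open>E1\<close> and \<open>E2\<close> are the densities that the two
    inequalities give at times where \<open>g\<close> and \<open>w\<close> are attained,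
    \<open>E1\<close> after the factor \<open>l ^ CARD('n)\<close> has been absorbed. At the base
    points both have slope \<open>p\<close>, so they differ only in the argument of
    \<open>F\<close>.\<close>
  define E1 where "E1 p' = exp (p + 6 * k * (fst p' - r0) + F (snd p') (u (l * fst p') (snd p')))
      * f (snd p')" for p'
  define E2 where "E2 p' = exp (p - 6 * k * (fst p' - t0) + F (snd p') (u (fst p') (snd p'))) * f
      (snd p')" for p'
  have cf: "continuous_on (X \<times> K) (\<lambda>p. f (snd p))" for X :: "real set"
    using K\<Omega> by (intro continuous_on_compose2[OF f(2)] continuous_intros) auto
  have cF: "continuous_on (X \<times> K) (\<lambda>p'. F (snd p') (v p'))" if "continuous_on (X \<times> K) v" for X ::
      "real set" and v
    by (rule continuous_on_compose2[OF F(1), of _ "\<lambda>p'. (snd p', v p')", simplified])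
      (use that K\<Omega> in \<open>auto intro!: continuous_intros\<close>)
  have cE1: "continuous_on (cball r0 \<tau> \<times> K) E1"
    unfolding E1_def[abs_def] by (intro continuous_intros cf cF cu1)
  have cE2: "continuous_on (cball t0 \<tau> \<times> K) E2"
    unfolding E2_def[abs_def] by (intro continuous_intros cf cF cu2)
  define E where "E = E1 (r0, z0)"
  have E2le: "E2 (t0, z0) \<le> E"
    using monoD[OF F(2) ge] f(1)[OF z0] by (auto simp: E1_def E2_def E_def intro!: mult_right_mono)
  \<comment> \<open>A quarter of the gain from the quadratic:
    \<open>E - \<gamma> + 4 * \<gamma> \<le> E + \<gamma>\<close> is impossible.\<close>
  define \<gamma> where "\<gamma> = 4 ^ CARD('n) * fact CARD('n) * (\<kappa> / 2) ^ CARD('n) / 4"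
  have \<gamma>: "\<gamma> > 0" using \<kappa> by (simp add: \<gamma>_def)
  obtain d1 where d1: "d1 > 0" "\<And>p'. p' \<in> cball r0 \<tau> \<times> K \<Longrightarrow> dist p' (r0, z0) < d1 \<Longrightarrow> dist (E1 p') E
      < \<gamma>"
    using cE1 rr(1) K(2) \<gamma> unfolding continuous_on_iff E_def by (metis SigmaI)
  obtain d2 where d2: "d2 > 0" "\<And>p'. p' \<in> cball t0 \<tau> \<times> K \<Longrightarrow> dist p' (t0, z0) < d2
      \<Longrightarrow> dist (E2 p') (E2 (t0, z0)) < \<gamma>"
    using cE2 rr(2) K(2) \<gamma> unfolding continuous_on_iff by (metis SigmaI)
  obtain d3 where d3: "d3 > 0" "\<And>z r. z \<in> K \<Longrightarrow> r \<in> cball r0 \<tau> \<Longrightarrow> dist z z0 < d3 \<Longrightarrow> g z = h r z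
      \<Longrightarrow> \<bar>r - r0\<bar> < min \<tau> (d1 / 2)"
    using g(4)[of "min \<tau> (d1 / 2)"] \<tau> d1(1) by (metis half_gt_zero min_less_iff_conj)
  obtain d4 where d4: "d4 > 0" "\<And>z r. z \<in> K \<Longrightarrow> r \<in> cball t0 \<tau> \<Longrightarrow> dist z z0 < d4 \<Longrightarrow> w z = e r z
      \<Longrightarrow> \<bar>r - t0\<bar> < min \<tau> (d2 / 2)"
    using w(4)[of "min \<tau> (d2 / 2)"] \<tau> d2(1) by (metis half_gt_zero min_less_iff_conj)
  define \<rho> where "\<rho> = min \<rho>0 (min (min (d1 / 2) (d2 / 2)) (min d3 d4))"
  have \<rho>: "\<rho> > 0" "\<rho> \<le> \<rho>0" using \<rho>0 d1 d2 d3 d4 by (auto simp: \<rho>_def)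
  have \<rho>K: "cball z0 \<rho> \<subseteq> K" using \<rho>(2) by (auto simp: K_def)
  have near: "z \<in> K" "dist z z0 < d1 / 2" "dist z z0 < d2 / 2" "dist z z0 < d3" "dist z z0 < d4"
    "\<forall>\<^sub>F z in nhds z. z \<in> K" if "z \<in> ball z0 \<rho>" for z
  proof -
    show "z \<in> K" "dist z z0 < d1 / 2" "dist z z0 < d2 / 2" "dist z z0 < d3" "dist z z0 < d4"
      using that \<rho>K by (auto simp: \<rho>_def dist_commute)
    show "\<forall>\<^sub>F z in nhds z. z \<in> K"
      using eventually_nhds_in_open[OF open_ball that] by (rule eventually_mono) (use \<rho>K in auto)
  qed
  have dp: "dist (r, z) (s, z') < d" if "\<bar>r - s\<bar> < d / 2" "dist z z' < d / 2" for r s d and z z'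
      :: "complex ^ 'n"
  proof -
    have "dist (r, z) (s, z') \<le> \<bar>r - s\<bar> + dist z z'"
      unfolding dist_Pair_Pair dist_real_def by (rule order_trans[OF sqrt_sum_squares_le_sum_abs])
          simp
    then show ?thesis using that by linarith
  qed
  \<comment> \<open>Truncation at \<open>0\<close> meets the sign condition of the smoothing lemma,
    and it is harmless because \<open>E1\<close> is nonnegative.\<close>
  have "visc_ma_ge (ball z0 \<rho>) (max 0 (E - \<gamma>)) g"
    unfolding visc_ma_ge_def
  proof (intro ballI allI impI, elim conjE)
    fix z1 q assume z1: "z1 \<in> ball z0 \<rho>" and q: "C2_near q z1" "g z1 = q z1" and ev:
        "\<forall>\<^sub>F y in nhds z1. g y \<le> q y"
    note n = near[OF z1]
    obtain r1 where r1: "r1 \<in> cball r0 \<tau>" "g z1 = h r1 z1" using g(3)[OF n(1)] by blast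
    have r1d: "\<bar>r1 - r0\<bar> < \<tau>" "\<bar>r1 - r0\<bar> < d1 / 2" using d3(2)[OF n(1) r1(1) n(4) r1(2)] by auto
    \<comment> \<open>The inequality \<open>u (l * r) z / l \<le> q z + a r\<close> is multiplied by
      \<open>l\<close> and read in the time \<open>s = l * r\<close> of \<open>u\<close>; the factor
      \<open>l\<close> cancels the inner \<open>1 / l\<close> in the derivative.\<close>
    define A where "A s = l * a (s / l)" for s
    have A': "(A has_real_derivative a' (s / l)) (at s)" for s
      unfolding A_def using l by (auto intro!: derivative_eq_intros DERIV_chain2[OF a'])
    have cA': "continuous_on UNIV (\<lambda>s. a' (s / l))"
      unfolding a'_def using l by (intro continuous_intros continuous_on_compose2[OF \<theta>(2)]) auto
    have eq: "u (l * r1) z1 = l * q z1 + A (l * r1)"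
      using q(2) r1(2) l by (simp add: h_def A_def field_simps)
    have "((\<lambda>s. s / l) \<longlongrightarrow> l * r1 / l) (nhds (l * r1))"
      using l by (intro tendsto_intros filterlim_ident) auto
    then have lim: "((\<lambda>s. s / l) \<longlongrightarrow> r1) (nhds (l * r1))" using l by simp
    have "\<forall>\<^sub>F r in nhds r1. r \<in> ball r0 \<tau>"
      by (intro eventually_nhds_in_open) (use r1d(1) in \<open>auto simp: dist_real_def
          abs_minus_commute\<close>)
    from eventually_compose_filterlim[OF this lim]
    have "\<forall>\<^sub>F s in nhds (l * r1). s / l \<in> ball r0 \<tau>" .
    from eventually_nhds_prod_fst[OF this, of z1] eventually_nhds_prod_snd[OF ev, of "l * r1"]
      eventually_nhds_prod_snd[OF n(6), of "l * r1"]
    have "\<forall>\<^sub>F p in nhds (l * r1, z1). u (fst p) (snd p) \<le> l * q (snd p) + A (fst p)"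
    proof eventually_elim
      case (elim p)
      have "h (fst p / l) (snd p) \<le> q (snd p)"
        using g(2)[of "fst p / l" "snd p"] elim by auto
      then show ?case using l by (simp add: h_def A_def field_simps)
    qed
    then have ev': "\<forall>\<^sub>F (s, z) in nhds (l * r1, z1). u s z \<le> l * q z + A s" by (simp add: split_def)
    have "exp (a' (l * r1 / l) + F z1 (u (l * r1) z1)) * f z1 \<le> l ^ CARD('n) * ma_density q z1"
      by (rule visc_subsolution_separated[OF sub _ _ _ q(1) A' cA' eq ev']) (use \<tau>r[OF r1(1)] n(1)
          K\<Omega> in auto)
    \<comment> \<open>The slope \<open>CARD('n) * ln l\<close> contained in \<open>\<theta>'\<close>
      pays for the factor \<open>l ^ CARD('n)\<close> that the test function \<open>l * q\<close>
      produces.\<close>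
    moreover have "l ^ CARD('n) * E1 (r1, z1) \<le> exp (a' (l * r1 / l) + F z1 (u (l * r1) z1)) * f z1"
    proof -
      have "l ^ CARD('n) = exp (CARD('n) * ln l)" using l by (simp add: exp_of_nat_mult)
      then have "l ^ CARD('n) * E1 (r1, z1)
          = exp (CARD('n) * ln l + (p + 6 * k * (r1 - r0) + F z1 (u (l * r1) z1))) * f z1"
        by (simp only: E1_def exp_add fst_conv snd_conv mult.assoc)
      also have "\<dots> \<le> exp (a' (l * r1 / l) + F z1 (u (l * r1) z1)) * f z1"
        using \<theta>(3)[of r1] l f(1)[of z1] n(1) K\<Omega> by (intro mult_right_mono) (auto simp: a'_def)
      finally show ?thesis .
    qed
    ultimately have "l ^ CARD('n) * E1 (r1, z1) \<le> l ^ CARD('n) * ma_density q z1" by linarith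
    then have le: "E1 (r1, z1) \<le> ma_density q z1" using l by simp
    have "0 \<le> E1 (r1, z1)" using f(1)[of z1] n(1) K\<Omega> by (auto simp: E1_def)
    moreover have "dist (E1 (r1, z1)) E < \<gamma>"
      by (rule d1(2)) (use r1 n(1) dp[OF r1d(2) n(2)] in auto)
    ultimately show "max 0 (E - \<gamma>) \<le> ma_density q z1" using le by (auto simp: dist_real_def)
  qed
  \<comment> \<open>\<open>- w\<close> is the minimum over \<open>t\<close> of
    \<open>u t z + b t\<close>, so a function touching it from below, minus \<open>b\<close>,
    touches \<open>u\<close> from below at a minimizing time.\<close>
  moreover have "visc_ma_le (ball z0 \<rho>) (E + \<gamma>) (\<lambda>z. - w z)"
    unfolding visc_ma_le_def
  proof (intro ballI allI impI, elim conjE)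
    fix z1 q assume z1: "z1 \<in> ball z0 \<rho>" and q: "C2_near q z1" "q z1 = - w z1"
      and ev: "\<forall>\<^sub>F y in nhds z1. q y \<le> - w y" and dd: "ddc_nonneg q z1"
    note n = near[OF z1]
    obtain t1 where t1: "t1 \<in> cball t0 \<tau>" "w z1 = e t1 z1" using w(3)[OF n(1)] by blast
    have t1d: "\<bar>t1 - t0\<bar> < \<tau>" "\<bar>t1 - t0\<bar> < d2 / 2" using d4(2)[OF n(1) t1(1) n(5) t1(2)] by auto
    have A': "((\<lambda>t. - b t) has_real_derivative - b' t) (at t)" for t by (intro DERIV_minus b')
    have cA': "continuous_on UNIV (\<lambda>t. - b' t)" unfolding b'_def by (intro continuous_intros)
    have eq: "u t1 z1 = q z1 + - b t1" using q(2) t1(2) by (simp add: e_def)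
    have "\<forall>\<^sub>F t in nhds t1. t \<in> ball t0 \<tau>"
      by (intro eventually_nhds_in_open) (use t1d(1) in \<open>auto simp: dist_real_def
          abs_minus_commute\<close>)
    from eventually_nhds_prod_fst[OF this, of z1] eventually_nhds_prod_snd[OF ev, of t1]
      eventually_nhds_prod_snd[OF n(6), of t1]
    have "\<forall>\<^sub>F p in nhds (t1, z1). q (snd p) + - b (fst p) \<le> u (fst p) (snd p)"
    proof eventually_elim
      case (elim p)
      have "e (fst p) (snd p) \<le> w (snd p)" using w(2)[of "fst p" "snd p"] elim by auto
      then show ?case using elim(2) by (simp add: e_def)
    qed
    then have ev': "\<forall>\<^sub>F (t, z) in nhds (t1, z1). q z + - b t \<le> u t z" by (simp add: split_def)
    have "ma_density q z1 \<le> exp (- b' t1 + F z1 (u t1 z1)) * f z1"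
      by (rule visc_supersolution_separated[OF sup _ _ _ q(1) dd A' cA' eq ev']) (use \<tau>t[OF t1(1)]
          n(1) K\<Omega> in auto)
    also have "\<dots> = E2 (t1, z1)" by (simp add: E2_def b'_def)
    also have "dist (E2 (t1, z1)) (E2 (t0, z0)) < \<gamma>"
      by (rule d2(2)) (use t1 n(1) dp[OF t1d(2) n(3)] in auto)
    then have "E2 (t1, z1) \<le> E + \<gamma>" using E2le by (auto simp: dist_real_def)
    finally show "ma_density q z1 \<le> E + \<gamma>" .
  qed
  moreover have "g z + \<kappa> * (norm (z - 0))\<^sup>2 - - w z \<le> g z0 + \<kappa> * (norm (z0 - 0))\<^sup>2 - - w z0" if z:
      "z \<in> cball z0 \<rho>" for z
  proof -
    have zK: "z \<in> K" using z \<rho>K by blast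
    obtain r t where rt: "r \<in> cball r0 \<tau>" "g z = h r z" "t \<in> cball t0 \<tau>" "w z = e t z"
      using g(3)[OF zK] w(3)[OF zK] by blast
    have "0 \<le> k * (r - r0)\<^sup>2" "0 \<le> k * (t - t0)\<^sup>2" using k by auto
    then show ?thesis
      using sep[OF rt(1,3) zK] g(2)[OF rr(1) K(2)] w(2)[OF rr(2) K(2)] rt by simp
  qed
  moreover have "continuous_on (cball z0 \<rho>) g" "continuous_on (cball z0 \<rho>) (\<lambda>z. - w z)"
    using continuous_on_subset[OF g(1) \<rho>K] continuous_on_subset[OF w(1) \<rho>K] by (auto intro:
        continuous_intros)
  ultimately have "max 0 (E - \<gamma>) + 4 ^ CARD('n) * fact CARD('n) * (\<kappa> / 2) ^ CARD('n) \<le> E + \<gamma>"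
    by (intro visc_ma_local_comparison[OF \<rho>(1), of z0 g "\<lambda>z. - w z", where a=0 and \<kappa>=\<kappa>]) (use \<kappa> in
        auto)
  moreover have "4 ^ CARD('n) * fact CARD('n) * (\<kappa> / 2) ^ CARD('n) = 4 * \<gamma>" by (simp add: \<gamma>_def)
  moreover have "E - \<gamma> \<le> max 0 (E - \<gamma>)" by simp
  ultimately show False using \<gamma> by linarith
qed

lemma usc_lsc_imp_continuous_on:
  assumes "usc_on S g" "lsc_on S g"
  shows "continuous_on S g"
  using assms unfolding usc_on_def lsc_on_def continuous_on_def by (auto intro!: order_tendstoI)

text \<open>The function \<open>u(l t, z) / l\<close> solves the same equation as \<open>u\<close> up to the factor \<open>l\<^sup>n\<close> and the
  argument of \<open>F\<close>. The slope \<open>n ln l\<close> in time absorbs the former; the latter is harmless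
  because \<open>F\<close> is monotone and \<open>u(l t, z) \<ge> u(t, z)\<close> wherever the claim fails.\<close>

lemma time_scaling_bound:
  fixes u :: "real \<Rightarrow> complex ^ 'n \<Rightarrow> real" and \<Omega> :: "(complex ^ 'n) set"
  assumes sub: "visc_subsolution_eq \<Omega> T F f u" and sup: "visc_supersolution_eq \<Omega> T F f u"
    and \<Omega>: "open \<Omega>" "bounded \<Omega>" and f: "\<And>z. z \<in> \<Omega> \<Longrightarrow> 0 \<le> f z" "continuous_on \<Omega> f"
    and F: "continuous_on (closure \<Omega> \<times> UNIV) (\<lambda>(z, r). F z r)" "\<And>z. z \<in> closure \<Omega> \<Longrightarrow> mono (F z)"
    and bdry: "\<And>t z. 0 \<le> t \<Longrightarrow> t < T \<Longrightarrow> z \<in> frontier \<Omega> \<Longrightarrow> u t z = \<phi> z"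
    and T: "0 < T1" "T1 < T2" "T2 < T"
    and M: "\<And>t z. 0 \<le> t \<Longrightarrow> t \<le> T2 \<Longrightarrow> z \<in> closure \<Omega> \<Longrightarrow> \<bar>u t z\<bar> \<le> M"
    and l: "l > 1" and ts: "0 \<le> ts" "l * ts \<le> T1" and zs: "zs \<in> closure \<Omega>"
  shows "u (l * ts) zs / l - u ts zs \<le> (l - 1) * M + CARD('n) * ln l * ts"
proof (rule ccontr)
  assume neg: "\<not> ?thesis"
  define \<delta> where "\<delta> = u (l * ts) zs / l - u ts zs - ((l - 1) * M + CARD('n) * ln l * ts)"
  have \<delta>: "\<delta> > 0" using neg by (simp add: \<delta>_def)
  have u: "continuous_on ({0..<T} \<times> closure \<Omega>) (\<lambda>(t, z). u t z)"
    using sub sup unfolding visc_subsolution_eq_def visc_supersolution_eq_def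
    by (intro usc_lsc_imp_continuous_on) auto
  have T2: "T2 > 0" using T by simp
  have M0: "M \<ge> 0" using M[of 0 zs] T2 zs by simp
  \<comment> \<open>\<open>C0\<close> bounds \<open>x / l - x\<close> for
    \<open>\<bar>x\<bar> \<le> M\<close>. This excludes a maximum on the boundary, where both values
    agree, and at initial times, where they nearly agree.\<close>
  define C0 where "C0 = (l - 1) * M"
  define \<nu> where "\<nu> = CARD('n) * ln l"
  have C0: "C0 \<ge> 0" and \<nu>: "\<nu> \<ge> 0" using l M0 by (auto simp: C0_def \<nu>_def)
  \<comment> \<open>The exponential in \<open>\<theta>\<close> stands in for a condition at the
    final time: it costs at most \<open>\<delta> / 4\<close> while \<open>l * r \<le> T1\<close>,
    and at \<open>l * r = T2\<close> this \<open>N\<close> makes \<open>\<theta>\<close> exceed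
    every possible difference of values.\<close>
  define N where "N = (8 * M / \<delta> + 8) / (T2 - T1)"
  have N: "N \<ge> 0" using M0 \<delta> T by (simp add: N_def)
  define \<theta> where "\<theta> r = C0 + \<nu> * r + \<delta> / 4 * exp (N * (l * r - T1))" for r
  define \<theta>' where "\<theta>' r = \<nu> + \<delta> / 4 * (N * l * exp (N * (l * r - T1)))" for r
  have \<theta>': "(\<theta> has_real_derivative \<theta>' r) (at r)" for r
    unfolding \<theta>_def \<theta>'_def by (auto intro!: derivative_eq_intros)
  have big: "2 * M + 2 * \<delta> \<le> \<delta> / 4 * exp (N * (T2 - T1))"
  proof -
    have "N * (T2 - T1) = 8 * M / \<delta> + 8" using T by (simp add: N_def)
    then have "8 * M / \<delta> + 8 \<le> exp (N * (T2 - T1))" using exp_ge_add_one_self[of "N * (T2 - T1)"]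
        by linarith
    then have "\<delta> / 4 * (8 * M / \<delta> + 8) \<le> \<delta> / 4 * exp (N * (T2 - T1))" using \<delta> by (intro
        mult_left_mono) auto
    moreover have "\<delta> / 4 * (8 * M / \<delta> + 8) = 2 * M + 2 * \<delta>" using \<delta> by (simp add: field_simps)
    ultimately show ?thesis by simp
  qed
  obtain R where R: "R > 0" "\<And>z. z \<in> closure \<Omega> \<Longrightarrow> norm z \<le> R"
    using bounded_closure[OF \<Omega>(2)] unfolding bounded_pos by blast
  \<comment> \<open>The quadratic is at most \<open>\<delta> / 4\<close> on the closure, so it
    leaves \<open>\<delta> / 2\<close> of the \<open>3 / 4 * \<delta>\<close> attained at
    \<open>(ts, ts, zs)\<close>.\<close>
  define \<kappa> where "\<kappa> = \<delta> / (4 * R\<^sup>2)"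
  have \<kappa>: "\<kappa> > 0" using \<delta> R by (simp add: \<kappa>_def)
  have \<kappa>R: "\<kappa> * (norm z)\<^sup>2 \<le> \<delta> / 4" if "z \<in> closure \<Omega>" for z
  proof -
    have "\<kappa> * (norm z)\<^sup>2 \<le> \<kappa> * R\<^sup>2" using R(2)[OF that] \<kappa> by (intro mult_left_mono power_mono) auto
    then show ?thesis using R by (simp add: \<kappa>_def)
  qed
  have cl: "compact (closure \<Omega>)" using \<Omega>(2) by (simp add: compact_closure)
  have u2: "continuous_on ({0..T2} \<times> closure \<Omega>) (\<lambda>(t, z). u t z)"
    by (rule continuous_on_subset[OF u]) (use T in auto)
  then have "uniformly_continuous_on ({0..T2} \<times> closure \<Omega>) (\<lambda>(t, z). u t z)"
    by (intro compact_uniformly_continuous compact_Times cl) auto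
  moreover have "\<delta> / 8 > 0" using \<delta> by simp
  ultimately obtain d where d: "d > 0" "\<And>p p'. p \<in> {0..T2} \<times> closure \<Omega> \<Longrightarrow> p' \<in> {0..T2} \<times> closure \<Omega> \<Longrightarrow>
      dist p' p < d \<Longrightarrow> dist ((\<lambda>(t, z). u t z) p') ((\<lambda>(t, z). u t z) p) < \<delta> / 8"
    unfolding uniformly_continuous_on_def by metis
  have ud: "\<bar>u t' z - u t z\<bar> < \<delta> / 8" if "0 \<le> t" "t \<le> T2" "0 \<le> t'" "t' \<le> T2" "z \<in> closure \<Omega>"
      "\<bar>t' - t\<bar> < d" for t t' z
    using d(2)[of "(t, z)" "(t', z)"] that by (simp add: dist_Pair_Pair dist_real_def)
  \<comment> \<open>The first entry keeps \<open>l * \<bar>r0 - t0\<bar>\<close> below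
    \<open>d\<close>, the range of uniform continuity; the second excludes \<open>t0 = T2\<close>,
    because \<open>r0 \<le> T2 / l\<close>.\<close>
  define d' where "d' = min (d / l) (T2 - T2 / l)"
  have d': "d' > 0" using d(1) l T2 by (simp add: d'_def field_simps)
  define k where "k = (2 * M + \<delta>) / d'\<^sup>2"
  have k: "k > 0" using M0 \<delta> d' by (simp add: k_def)
  define \<Phi> where "\<Phi> r t z = u (l * r) z / l - u t z - \<theta> r + \<kappa> * (norm z)\<^sup>2 - k * (r - t)\<^sup>2" for r
      t z
  define X where "X = {0..T2 / l} \<times> {0..T2} \<times> closure \<Omega>"
  have lr: "0 \<le> l * r" "l * r \<le> T2" if "r \<in> {0..T2 / l}" for r
    using that l by (auto simp: field_simps)
  have "continuous_on X (\<lambda>p. \<Phi> (fst p) (fst (snd p)) (snd (snd p)))"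
  proof -
    have "continuous_on X (\<lambda>p. u (l * fst p) (snd (snd p)))"
      by (rule continuous_on_compose2[OF u2[unfolded split_def], of X
          "\<lambda>p. (l * fst p, snd (snd p))", simplified])
        (use lr in \<open>auto simp: X_def intro!: continuous_intros\<close>)
    moreover have "continuous_on X (\<lambda>p. u (fst (snd p)) (snd (snd p)))"
      by (rule continuous_on_compose2[OF u2[unfolded split_def], of X snd])
        (auto simp: X_def intro!: continuous_intros)
    ultimately show ?thesis
      unfolding \<Phi>_def \<theta>_def using l by (intro continuous_intros) auto
  qed
  moreover have "compact X" unfolding X_def by (intro compact_Times cl) auto
  moreover have tsX: "(ts, ts, zs) \<in> X"
  proof -
    have "ts \<le> T2 / l" using ts T l by (simp add: field_simps)
    moreover have "T2 / l \<le> T2" using l T2 by (simp add: field_simps)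
    ultimately show ?thesis using ts zs by (simp add: X_def)
  qed
  ultimately obtain p where p: "p \<in> X" "\<And>p'. p' \<in> X \<Longrightarrow> \<Phi> (fst p') (fst (snd p')) (snd (snd p'))
      \<le> \<Phi> (fst p) (fst (snd p)) (snd (snd p))"
    using continuous_attains_sup[of X "\<lambda>p. \<Phi> (fst p) (fst (snd p)) (snd (snd p))"] by blast
  obtain r0 t0 z0 where p0: "p = (r0, t0, z0)" by (cases p) auto
  have r0: "0 \<le> r0" "r0 \<le> T2 / l" and t0: "0 \<le> t0" "t0 \<le> T2" and z0: "z0 \<in> closure \<Omega>"
    using p(1) by (auto simp: X_def p0)
  have max: "\<Phi> r t z \<le> \<Phi> r0 t0 z0" if "0 \<le> r" "r \<le> T2 / l" "0 \<le> t" "t \<le> T2" "z \<in> closure \<Omega>" for r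
      t z
    using p(2)[of "(r, t, z)"] that by (simp add: X_def p0)
  have \<Phi>s: "\<Phi> ts ts zs \<ge> 3 / 4 * \<delta>"
  proof -
    have "exp (N * (l * ts - T1)) \<le> 1" using N ts by (simp add: mult_nonneg_nonpos)
    then have "\<delta> / 4 * exp (N * (l * ts - T1)) \<le> \<delta> / 4" using \<delta> by simp
    moreover have "0 \<le> \<kappa> * (norm zs)\<^sup>2" using \<kappa> by simp
    moreover have "u (l * ts) zs / l - u ts zs = \<delta> + C0 + \<nu> * ts" by (simp add: \<delta>_def C0_def \<nu>_def)
    then have "\<Phi> ts ts zs = \<delta> + \<kappa> * (norm zs)\<^sup>2 - \<delta> / 4 * exp (N * (l * ts - T1))"
      by (simp add: \<Phi>_def \<theta>_def)
    ultimately show ?thesis by linarith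
  qed
  define a0 b0 where "a0 = u (l * r0) z0" and "b0 = u t0 z0"
  have a0M: "\<bar>a0\<bar> \<le> M" and b0M: "\<bar>b0\<bar> \<le> M"
    using M lr[of r0] r0 t0 z0 by (auto simp: a0_def b0_def)
  have main: "a0 / l - b0 - \<theta> r0 - k * (r0 - t0)\<^sup>2 \<ge> \<delta> / 2"
  proof -
    have "\<Phi> ts ts zs \<le> \<Phi> r0 t0 z0" using max[of ts ts zs] tsX by (simp add: X_def)
    moreover have "\<Phi> r0 t0 z0 = a0 / l - b0 - \<theta> r0 + \<kappa> * (norm z0)\<^sup>2 - k * (r0 - t0)\<^sup>2"
      by (simp add: \<Phi>_def a0_def b0_def)
    ultimately show ?thesis using \<Phi>s \<kappa>R[OF z0] by linarith
  qed
  have kr: "0 \<le> k * (r0 - t0)\<^sup>2" using k by simp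
  have \<theta>C: "\<theta> r0 \<ge> C0" using \<nu> r0 \<delta> by (simp add: \<theta>_def)
  have ab: "a0 / l - b0 \<ge> C0 + \<delta> / 2" using main kr \<theta>C by linarith
  have Ml: "M \<le> M * l" using mult_left_mono[of 1 l M] l M0 by simp
  have inl: "x / l - x \<le> C0" if "\<bar>x\<bar> \<le> M" for x
  proof -
    have "x / l - x = (l - 1) * (- x / l)" using l by (simp add: field_simps)
    moreover have "- x \<le> M * l" using that Ml by linarith
    then have "- x / l \<le> M" using l by (subst pos_divide_le_eq) auto
    then have "(l - 1) * (- x / l) \<le> (l - 1) * M" using l by (intro mult_left_mono) auto
    ultimately show ?thesis by (simp add: C0_def)
  qed
  have a0l: "a0 / l \<le> M" using a0M Ml l by (subst pos_divide_le_eq) auto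
  have "k * (r0 - t0)\<^sup>2 < k * d'\<^sup>2"
  proof -
    have "k * (r0 - t0)\<^sup>2 < 2 * M + \<delta>" using main \<theta>C C0 a0l b0M \<delta> by linarith
    then show ?thesis using d' by (simp add: k_def)
  qed
  then have rt: "\<bar>r0 - t0\<bar> < d'" using k d' power2_less_imp_less[of "\<bar>r0 - t0\<bar>" d'] by simp
  have ld': "l * d' \<le> d" "d' \<le> d" "d' \<le> T2 - T2 / l"
  proof -
    have "d' \<le> d / l" by (simp add: d'_def)
    then show "l * d' \<le> d" using l by (simp add: field_simps)
    then show "d' \<le> d" using l d' by (smt (verit) mult_le_cancel_right1)
    show "d' \<le> T2 - T2 / l" by (simp add: d'_def)
  qed
  have z0\<Omega>: "z0 \<in> \<Omega>"
  proof (rule ccontr)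
    assume "z0 \<notin> \<Omega>"
    then have "z0 \<in> frontier \<Omega>" using z0 \<Omega>(1) by (simp add: frontier_def interior_open)
    then have "a0 = b0" using bdry lr[of r0] r0 t0 T by (simp add: a0_def b0_def)
    then show False using inl[OF b0M] ab \<delta> by simp
  qed
  have "r0 \<noteq> 0"
  proof
    assume r: "r0 = 0"
    then have "\<bar>t0 - 0\<bar> < d" using rt ld' by simp
    then have "\<bar>b0 - a0\<bar> < \<delta> / 8" using ud[of 0 t0 z0] t0 T2 z0 by (simp add: a0_def b0_def r)
    then show False using inl[OF a0M] ab \<delta> by linarith
  qed
  have "t0 \<noteq> 0"
  proof
    assume t: "t0 = 0"
    have "l * \<bar>r0\<bar> < l * d'" using rt t l by simp
    moreover have "\<bar>l * r0 - 0\<bar> = l * \<bar>r0\<bar>" using l by (simp add: abs_mult)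
    ultimately have "\<bar>l * r0 - 0\<bar> < d" using ld'(1) by linarith
    then have "\<bar>a0 - b0\<bar> < \<delta> / 8" using ud[of 0 "l * r0" z0] lr[of r0] r0 T2 z0 by (simp add:
        a0_def b0_def t)
    then have "a0 \<le> b0 + \<delta> / 8" by linarith
    then have "a0 / l \<le> (b0 + \<delta> / 8) / l" using l by (intro divide_right_mono) auto
    then have "a0 / l \<le> b0 / l + \<delta> / 8 / l" by (simp only: add_divide_distrib)
    moreover have "\<delta> / 8 / l \<le> \<delta> / 8" using l \<delta> by (simp add: field_simps)
    ultimately show False using inl[OF b0M] ab \<delta> by linarith
  qed
  have "r0 \<noteq> T2 / l"
  proof
    assume r: "r0 = T2 / l"
    then have "l * r0 = T2" using l by simp
    then have "\<theta> r0 \<ge> 2 * M + 2 * \<delta>" using big C0 \<nu> r0 by (simp add: \<theta>_def add_increasing)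
    then show False using main kr a0l b0M \<delta> by linarith
  qed
  have "t0 \<noteq> T2" using rt ld' r0 by auto
  have r0s: "0 < r0" "r0 < T2 / l" and t0s: "0 < t0" "t0 < T2"
    using r0 t0 \<open>r0 \<noteq> 0\<close> \<open>t0 \<noteq> 0\<close> \<open>r0 \<noteq> T2 / l\<close> \<open>t0 \<noteq> T2\<close> by auto
  \<comment> \<open>Since \<open>l * (b0 + C0) = b0 + (l - 1) * (b0 + l * M)\<close> and
    \<open>b0 \<ge> - M\<close>, undoing the division by \<open>l\<close> keeps the order that the
    monotonicity of \<open>F\<close> calls for.\<close>
  have ge: "b0 \<le> a0"
  proof -
    have "b0 + C0 \<le> a0 / l" using ab \<delta> by simp
    then have "l * (b0 + C0) \<le> a0" using l by (simp add: field_simps)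
    moreover have "0 \<le> (l - 1) * (b0 + l * M)"
    proof -
      have "M \<le> l * M" using l M0 by (simp add: mult_le_cancel_right1)
      then show ?thesis using l b0M by (intro mult_nonneg_nonneg) (auto simp: abs_le_iff)
    qed
    ultimately show ?thesis by (simp add: C0_def algebra_simps)
  qed
  obtain \<rho> where \<rho>: "\<rho> > 0" "cball z0 \<rho> \<subseteq> \<Omega>" using \<Omega>(1) z0\<Omega> open_contains_cball by blast
  define \<sigma> where "\<sigma> = min \<rho> (min (min r0 (T2 / l - r0)) (min t0 (T2 - t0)))"
  have \<sigma>: "\<sigma> > 0" using \<rho> r0s t0s by (simp add: \<sigma>_def)
  have \<sigma>le: "\<sigma> \<le> \<rho>" "\<sigma> \<le> r0" "\<sigma> \<le> T2 / l - r0" "\<sigma> \<le> t0" "\<sigma> \<le> T2 - t0"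
    by (simp_all only: \<sigma>_def min_le_iff_disj order_refl simp_thms)
  show False
  proof (rule parabolic_doubling_contradiction[OF sub sup \<Omega>(1) f, where l=l and \<theta>=\<theta> and \<theta>'=\<theta>' and
      ?r0.0=r0 and ?t0.0=t0
        and ?z0.0=z0 and k=k and \<kappa>=\<kappa> and \<sigma>=\<sigma>])
    show "continuous_on (\<Omega> \<times> UNIV) (\<lambda>(z, r). F z r)"
      by (rule continuous_on_subset[OF F(1)]) (use closure_subset in auto)
    show "mono (F z0)" by (rule F(2)[OF z0])
    show "continuous_on ({0<..<T} \<times> \<Omega>) (\<lambda>(t, z). u t z)"
      by (rule continuous_on_subset[OF u]) (use closure_subset in auto)
    show "0 < l * r0" "l * r0 < T" using l r0s T by (auto simp: field_simps)
    show "continuous_on UNIV \<theta>'" unfolding \<theta>'_def by (intro continuous_intros)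
    show "real CARD('n) * ln l \<le> \<theta>' r" for r
      using \<delta> N l by (simp add: \<theta>'_def \<nu>_def)
    show "u (l * r) z / l - u t z - \<theta> r + \<kappa> * (norm z)\<^sup>2 - k * (r - t)\<^sup>2
      \<le> u (l * r0) z0 / l - u t0 z0 - \<theta> r0 + \<kappa> * (norm z0)\<^sup>2 - k * (r0 - t0)\<^sup>2"
      if "\<bar>r - r0\<bar> \<le> \<sigma>" "\<bar>t - t0\<bar> \<le> \<sigma>" "norm (z - z0) \<le> \<sigma>" for r t z
    proof -
      have "z \<in> cball z0 \<rho>" using that \<sigma>le by (simp add: dist_norm norm_minus_commute)
      then have "z \<in> closure \<Omega>" using \<rho>(2) closure_subset by blast
      then show ?thesis
        using max[of r t z] that \<sigma>le unfolding \<Phi>_def by (auto simp: abs_le_iff)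
    qed
    show "u t0 z0 \<le> u (l * r0) z0" using ge by (simp add: a0_def b0_def)
  qed (use l t0s T z0\<Omega> k \<kappa> \<theta>' \<sigma> in auto)
qed

section \<open>From a bound on the time slope to the elliptic inequality\<close>

lemma det_diff_scalar_tendsto:
  fixes P :: "complex ^ 'n ^ 'n"
  shows "((\<lambda>\<epsilon>. Re (det (P - mat (complex_of_real \<epsilon>)))) \<longlongrightarrow> Re (det P)) (at_right 0)"
proof -
  have "isCont (\<lambda>\<epsilon>. Re (det (P - mat (complex_of_real \<epsilon>)))) 0"
  proof -
    have eq: "(P - mat (complex_of_real \<epsilon>)) $ i $ j
        = P $ i $ j - complex_of_real \<epsilon> * mat 1 $ i $ j" for \<epsilon> i j
      by (simp add: mat_def)
    have "continuous_on UNIV (\<lambda>\<epsilon>. Re (det (P - mat (complex_of_real \<epsilon>))))"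
      unfolding det_def eq by (intro continuous_intros)
    then show ?thesis by (simp add: continuous_on_eq_continuous_at)
  qed
  moreover have "P - mat (complex_of_real 0) = P" by (simp add: vec_eq_iff mat_def)
  ultimately show ?thesis
    by (simp add: isCont_def filterlim_at_split)
qed

text \<open>A test function in \<open>z\<close> at time \<open>t0\<close> becomes a parabolic one
  after subtracting a large multiple of \<open>(t - t0)\<^sup>2\<close>, at the price of moving the
  contact point slightly. There its time slope is bounded by the forward difference quotients of
  \<open>u\<close>, hence by \<open>C\<close>; an upper bound is enough because \<open>exp\<close>
  is increasing.\<close>

lemma elliptic_visc_le_of_time_slope:
  fixes u :: "real \<Rightarrow> complex ^ 'n \<Rightarrow> real" and \<Omega> :: "(complex ^ 'n) set"
  assumes sup: "visc_supersolution_eq \<Omega> T F f u" and \<Omega>: "open \<Omega>"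
    and f: "\<And>z. z \<in> \<Omega> \<Longrightarrow> 0 \<le> f z" "continuous_on \<Omega> f"
    and u: "continuous_on ({0<..<T} \<times> \<Omega>) (\<lambda>(t, z). u t z)"
    and \<tau>: "\<tau> > 0" "0 < t0 - \<tau>" "t0 + \<tau> < T"
    and slope: "\<And>t h z. \<bar>t - t0\<bar> < \<tau> \<Longrightarrow> 0 < h \<Longrightarrow> t + h < t0 + \<tau> \<Longrightarrow> z \<in> \<Omega> \<Longrightarrow> u (t + h) z - u t z \<le> C * h"
    and B: "\<And>t z. \<bar>t - t0\<bar> < \<tau> \<Longrightarrow> z \<in> \<Omega> \<Longrightarrow> F z (u t z) \<le> B"
  shows "elliptic_visc_le \<Omega> (u t0) (exp (C + B)) f"
  unfolding elliptic_visc_le_def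
proof (intro ballI allI impI, elim conjE)
  fix z0 q assume z0: "z0 \<in> \<Omega>" and q: "C2_near q z0" "q z0 = u t0 z0" "\<forall>\<^sub>F z in nhds z0. q z
      \<le> u t0 z"
    and dd: "ddc_nonneg q z0"
  show "ma_density q z0 \<le> exp (C + B) * f z0"
  proof (rule ccontr)
    assume "\<not> ma_density q z0 \<le> exp (C + B) * f z0"
    then have gt: "exp (C + B) * f z0 < ma_density q z0" by simp
    obtain U D H where zU: "z0 \<in> U" and c2: "c2_data U q D H" using q(1) unfolding C2_near_iff by
        blast
    define P where "P = complex_hessian q z0"
    have hP: "hermitian P" unfolding P_def by (rule hermitian_complex_hessian[OF c2 zU])
    have psd: "0 \<le> hform P \<xi>" for \<xi> using dd by (simp add: ddc_nonneg_iff_hform P_def)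
    have "0 \<le> exp (C + B) * f z0" using f(1)[OF z0] by simp
    \<comment> \<open>If the claim fails the density is positive, so the Hessian is positive
      definite. This leaves room to subtract \<open>\<epsilon> * (norm (z - z0))\<^sup>2\<close> and
      keep a nonnegative Hessian at nearby points.\<close>
    then have "Re (det P) \<noteq> 0" using gt unfolding ma_density_def P_def by auto
    from hform_positive_definite[OF hP psd this]
    obtain c where c: "c > 0" "\<And>\<xi>. c * (norm \<xi>)\<^sup>2 \<le> hform P \<xi>" by blast
    define N where "N = (4 ^ CARD('n) * fact CARD('n) :: real)"
    have "((\<lambda>\<epsilon>. N * Re (det (P - mat (complex_of_real \<epsilon>)))) \<longlongrightarrow> N * Re (det P)) (at_right 0)"
      by (intro tendsto_intros det_diff_scalar_tendsto)
    moreover have "exp (C + B) * f z0 < N * Re (det P)" using gt by (simp add: ma_density_def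
        P_def N_def)
    ultimately have "\<forall>\<^sub>F \<epsilon> in at_right 0. exp (C + B) * f z0
        < N * Re (det (P - mat (complex_of_real \<epsilon>)))"
      by (rule order_tendstoD(1))
    moreover have "\<forall>\<^sub>F \<epsilon> in at_right 0. \<epsilon> < c / 2" using c(1) by (intro order_tendstoD(2)[of
        "\<lambda>x. x" 0]) (auto intro: tendsto_ident_at)
    moreover have "\<forall>\<^sub>F \<epsilon> in at_right 0. (0::real) < \<epsilon>" by (simp add: eventually_at_right_less)
    ultimately have "\<forall>\<^sub>F \<epsilon> in at_right 0. exp (C + B) * f z0
        < N * Re (det (P - mat (complex_of_real \<epsilon>))) \<and> \<epsilon> < c / 2 \<and> 0 < \<epsilon>"
      by eventually_elim simp
    then obtain \<epsilon> where \<epsilon>: "exp (C + B) * f z0 < N * Re (det (P - mat (complex_of_real \<epsilon>)))" "\<epsilon>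
        < c / 2" "0 < \<epsilon>"
      using eventually_happens' trivial_limit_at_right_real by blast
    define qe where "qe z = q z + (- \<epsilon>) * (norm (z - z0))\<^sup>2" for z
    note n2 = c2_data_subset[OF c2_data_norm_square[of "- \<epsilon>" z0] c2_dataD(1)[OF c2] subset_UNIV]
    note c2e = c2_data_add[OF c2 n2]
    have he: "complex_hessian qe z = complex_hessian q z + mat (complex_of_real (- \<epsilon>))" if "z \<in> U"
        for z
      unfolding qe_def[abs_def] complex_hessian_add[OF c2 n2 that] complex_hessian_norm_square ..
    have he0: "complex_hessian qe z0 = P - mat (complex_of_real \<epsilon>)"
      using he[OF zU] by (simp add: P_def vec_eq_iff mat_def)
    have C2e: "C2_near qe z" if "z \<in> U" for z
      unfolding C2_near_iff qe_def[abs_def] using c2e that by blast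
    have pos0: "c / 2 * (norm \<xi>)\<^sup>2 \<le> hform (complex_hessian qe z0) \<xi>" for \<xi>
    proof -
      have "hform (complex_hessian qe z0) \<xi> = hform P \<xi> - \<epsilon> * (norm \<xi>)\<^sup>2"
      proof -
        have "hform (complex_hessian (\<lambda>z. - \<epsilon> * (norm (z - z0))\<^sup>2) z0) \<xi> = - \<epsilon> * (norm \<xi>)\<^sup>2"
        proof -
          have "(norm (\<i> *s \<xi>))\<^sup>2 = (norm \<xi>)\<^sup>2"
            by (simp add: norm_vec_def L2_set_def norm_mult)
          then show ?thesis
            unfolding hform_complex_hessian[OF c2_data_norm_square UNIV_I]
            by (simp add: power2_norm_eq_inner)
        qed
        then show ?thesis
          unfolding he[OF zU] complex_hessian_norm_square P_def[symmetric]
          by (simp add: hform_def distrib_right sum.distrib)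
      qed
      moreover have "\<epsilon> * (norm \<xi>)\<^sup>2 \<le> c / 2 * (norm \<xi>)\<^sup>2" using \<epsilon> by (intro mult_right_mono) auto
      ultimately show ?thesis using c(2)[of \<xi>] by (simp add: algebra_simps)
    qed
    define S where "S z = (\<Sum>j\<in>UNIV. \<Sum>k\<in>UNIV. cmod (complex_hessian qe z0 $ j $ k - complex_hessian
        qe z $ j $ k))" for z
    have "continuous_on U S"
      unfolding S_def by (intro continuous_intros continuous_on_complex_hessian[OF c2e[folded
          qe_def]])
    moreover have "S z0 = 0" by (simp add: S_def)
    moreover have oU: "open U" by (rule c2_dataD(1)[OF c2])
    ultimately have "(S \<longlongrightarrow> 0) (at z0)"
      using zU by (metis continuous_on_eq_continuous_at isCont_def)
    then have "\<forall>\<^sub>F z in at z0. S z < c / 2" using c(1) by (intro order_tendstoD(2)) auto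
    then have evS: "\<forall>\<^sub>F z in nhds z0. S z < c / 2" using \<open>S z0 = 0\<close> c(1) by (simp add:
        eventually_nhds_conv_at)
    define G where "G z = ma_density qe z - exp (C + B) * f z" for z
    have "continuous_on (U \<inter> \<Omega>) G"
      unfolding G_def
      by (intro continuous_intros continuous_on_subset[OF continuous_on_ma_density[OF c2e[folded
          qe_def]]]
          continuous_on_subset[OF f(2)]) auto
    moreover have G0: "G z0 > 0" using \<epsilon>(1) by (simp add: G_def ma_density_def he0 N_def)
    moreover have "open (U \<inter> \<Omega>)" "z0 \<in> U \<inter> \<Omega>" using oU \<Omega> zU z0 by auto
    ultimately have "(G \<longlongrightarrow> G z0) (at z0)"
      by (metis continuous_on_eq_continuous_at isCont_def)
    then have "\<forall>\<^sub>F z in at z0. G z > 0" using G0 by (rule order_tendstoD(1))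
    then have evG: "\<forall>\<^sub>F z in nhds z0. G z > 0" using G0 by (simp add: eventually_nhds_conv_at)
    have "\<forall>\<^sub>F z in nhds z0. S z < c / 2 \<and> G z > 0 \<and> q z \<le> u t0 z \<and> z \<in> U \<and> z \<in> \<Omega>"
      using evS evG q(3) eventually_nhds_in_open[OF oU zU] eventually_nhds_in_open[OF \<Omega> z0]
      by eventually_elim simp
    then obtain \<rho>' where \<rho>': "\<rho>' > 0"
      "\<And>z. dist z z0 < \<rho>' \<Longrightarrow> S z < c / 2 \<and> G z > 0 \<and> q z \<le> u t0 z \<and> z \<in> U \<and> z \<in> \<Omega>"
      unfolding eventually_nhds_metric by blast
    define \<rho> where "\<rho> = \<rho>' / 2"
    have \<rho>: "\<rho> > 0" using \<rho>' by (simp add: \<rho>_def)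
    have ball: "S z < c / 2" "G z > 0" "q z \<le> u t0 z" "z \<in> U" "z \<in> \<Omega>" if "z \<in> cball z0 \<rho>" for z
      using \<rho>'(2)[of z] that \<rho>'(1) by (auto simp: \<rho>_def dist_commute)
    have ddz: "ddc_nonneg qe z" if z: "z \<in> cball z0 \<rho>" for z
      unfolding ddc_nonneg_iff_hform
    proof
      fix \<xi>
      have "hform (complex_hessian qe z0) \<xi> - hform (complex_hessian qe z) \<xi> \<le> S z * (norm \<xi>)\<^sup>2"
        unfolding S_def by (rule hform_diff_le)
      also have "\<dots> \<le> c / 2 * (norm \<xi>)\<^sup>2" using ball(1)[OF z] by (intro mult_right_mono) auto
      finally show "0 \<le> hform (complex_hessian qe z) \<xi>" using pos0[of \<xi>] by simp
    qed
    define J where "J = cball t0 (\<tau> / 2) \<times> cball z0 \<rho>"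
    have JT: "\<bar>t - t0\<bar> < \<tau>" "0 < t" "t < T" if "t \<in> cball t0 (\<tau> / 2)" for t
      using that \<tau> unfolding mem_cball dist_real_def by linarith+
    have cJ: "compact J" unfolding J_def by (intro compact_Times compact_cball)
    have uJ: "continuous_on J (\<lambda>(t, z). u t z)"
      by (rule continuous_on_subset[OF u]) (use JT ball(5) in \<open>auto simp: J_def\<close>)
    have ceU: "continuous_on U qe"
      by (rule has_derivative_continuous_on) (rule has_derivative_at_withinI[OF c2_dataD(2)[OF
          c2e[folded qe_def]]])
    have qJ: "continuous_on J (\<lambda>p. qe (snd p))"
      by (rule continuous_on_compose2[OF ceU]) (use ball(4) in \<open>auto simp: J_def intro!:
          continuous_intros\<close>)
    \<comment> \<open>\<open>\<eta>\<close> bounds the change of \<open>u\<close> between the times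
      \<open>t0\<close> and \<open>t1\<close>; being below
      \<open>\<epsilon> * \<rho>\<^sup>2\<close>, it keeps the contact point inside the
      ball.\<close>
    define \<eta> where "\<eta> = \<epsilon> * \<rho>\<^sup>2 / 2"
    have \<eta>: "\<eta> > 0" using \<epsilon> \<rho> by (simp add: \<eta>_def)
    have "uniformly_continuous_on J (\<lambda>(t, z). u t z)" by (rule compact_uniformly_continuous[OF uJ
        cJ])
    then obtain d where d: "d > 0" "\<And>p p'. p \<in> J \<Longrightarrow> p' \<in> J \<Longrightarrow> dist p' p < d \<Longrightarrow>
        dist ((\<lambda>(t, z). u t z) p') ((\<lambda>(t, z). u t z) p) < \<eta>"
      unfolding uniformly_continuous_on_def using \<eta> by metis
    have ud: "\<bar>u t z - u t0 z\<bar> < \<eta>" if "t \<in> cball t0 (\<tau> / 2)" "z \<in> cball z0 \<rho>" "\<bar>t - t0\<bar> < d" for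
        t z
      using d(2)[of "(t0, z)" "(t, z)"] that \<tau> by (simp add: J_def dist_Pair_Pair dist_real_def)
    have "continuous_on J (\<lambda>p. qe (snd p) - u (fst p) (snd p))"
      using qJ uJ by (auto simp: split_def intro!: continuous_intros)
    moreover have J0: "(t0, z0) \<in> J" using \<tau> \<rho> by (simp add: J_def)
    ultimately obtain pb where "pb \<in> J" "\<And>p. p \<in> J \<Longrightarrow> qe (snd p) - u (fst p) (snd p)
        \<le> qe (snd pb) - u (fst pb) (snd pb)"
      using continuous_attains_sup[OF cJ, of "\<lambda>p. qe (snd p) - u (fst p) (snd p)"] by blast
    then obtain b where b: "\<And>p. p \<in> J \<Longrightarrow> qe (snd p) - u (fst p) (snd p) \<le> b" by blast
    have b0: "b \<ge> 0" using b[OF J0] q(2) by (simp add: qe_def)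
    define e where "e = min d (\<tau> / 2)"
    have e: "e > 0" using d \<tau> by (simp add: e_def)
    \<comment> \<open>\<open>b\<close> bounds \<open>qe - u\<close> on \<open>J\<close>, so at the
      minimum \<open>k * (t1 - t0)\<^sup>2 \<le> b < k * e\<^sup>2\<close>.\<close>
    define k where "k = (b + 1) / e\<^sup>2"
    have k: "k > 0" using b0 e by (simp add: k_def)
    define \<Psi> where "\<Psi> p = u (fst p) (snd p) - qe (snd p) + k * (fst p - t0)\<^sup>2" for p
    have "continuous_on J \<Psi>"
      unfolding \<Psi>_def using qJ uJ by (auto simp: split_def intro!: continuous_intros)
    then obtain p1 where p1: "p1 \<in> J" "\<And>p. p \<in> J \<Longrightarrow> \<Psi> p1 \<le> \<Psi> p"
      using continuous_attains_inf[OF cJ, of \<Psi>] J0 by blast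
    obtain t1 z1 where p1e: "p1 = (t1, z1)" by (cases p1)
    have t1: "t1 \<in> cball t0 (\<tau> / 2)" and z1: "z1 \<in> cball z0 \<rho>" using p1(1) by (auto simp: p1e J_def)
    have "\<Psi> (t0, z0) = 0" using q(2) by (simp add: \<Psi>_def qe_def)
    then have \<Psi>0: "u t1 z1 - qe z1 + k * (t1 - t0)\<^sup>2 \<le> 0" using p1(2)[OF J0] by (simp add: p1e
        \<Psi>_def)
    have "k * (t1 - t0)\<^sup>2 < k * e\<^sup>2"
      using \<Psi>0 b[OF p1(1)] e by (simp add: p1e k_def)
    then have t1e: "\<bar>t1 - t0\<bar> < e" using k e power2_less_imp_less[of "\<bar>t1 - t0\<bar>" e] by simp
    have "\<bar>u t1 z1 - u t0 z1\<bar> < \<eta>" by (rule ud[OF t1 z1]) (use t1e in \<open>simp add: e_def\<close>)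
    moreover have "0 \<le> k * (t1 - t0)\<^sup>2" using k by simp
    ultimately have "\<epsilon> * (norm (z1 - z0))\<^sup>2 < \<eta>"
      using \<Psi>0 ball(3)[OF z1] by (simp add: qe_def abs_less_iff)
    also have "\<eta> \<le> \<epsilon> * \<rho>\<^sup>2" using \<epsilon> by (simp add: \<eta>_def)
    finally have z1b: "norm (z1 - z0) < \<rho>" using \<epsilon>(3) \<rho> power2_less_imp_less[of "norm (z1 - z0)"
        \<rho>] by simp
    define A where "A t = u t1 z1 - qe z1 + k * (t1 - t0)\<^sup>2 - k * (t - t0)\<^sup>2" for t
    define A' where "A' t = - 2 * k * (t - t0)" for t
    have A': "(A has_real_derivative A' t) (at t)" for t
      unfolding A_def A'_def by (auto intro!: derivative_eq_intros)
    have low: "qe z + A t \<le> u t z" if "t \<in> cball t0 (\<tau> / 2)" "z \<in> cball z0 \<rho>" for t z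
      using p1(2)[of "(t, z)"] that by (simp add: p1e \<Psi>_def A_def J_def)
    have "\<forall>\<^sub>F t in nhds t1. t \<in> ball t0 (\<tau> / 2)"
      by (intro eventually_nhds_in_open) (use t1e in \<open>auto simp: e_def dist_real_def
          abs_minus_commute\<close>)
    moreover have "\<forall>\<^sub>F z in nhds z1. z \<in> ball z0 \<rho>"
      by (intro eventually_nhds_in_open) (use z1b in \<open>auto simp: dist_norm norm_minus_commute\<close>)
    ultimately have "\<forall>\<^sub>F p in nhds (t1, z1). fst p \<in> ball t0 (\<tau> / 2) \<and> snd p \<in> ball z0 \<rho>"
      using eventually_nhds_prod_fst[of "\<lambda>t. t \<in> ball t0 (\<tau> / 2)" t1 z1]
        eventually_nhds_prod_snd[of "\<lambda>z. z \<in> ball z0 \<rho>" z1 t1] by (intro eventually_conj) auto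
    then have "\<forall>\<^sub>F p in nhds (t1, z1). qe (snd p) + A (fst p) \<le> u (fst p) (snd p)"
      by eventually_elim (auto intro!: low)
    then have ev': "\<forall>\<^sub>F (t, z) in nhds (t1, z1). qe z + A t \<le> u t z" by (simp add: split_def)
    have cA: "continuous_on UNIV A'" unfolding A'_def by (intro continuous_intros)
    have eq: "u t1 z1 = qe z1 + A t1" by (simp add: A_def)
    have "ma_density qe z1 \<le> exp (A' t1 + F z1 (u t1 z1)) * f z1"
      by (rule visc_supersolution_separated[OF sup JT(2,3)[OF t1] ball(5)[OF z1] C2e[OF ball(4)[OF
          z1]] ddz[OF z1] A' cA eq ev'])
    also have "\<dots> \<le> exp (C + B) * f z1"
    proof (intro mult_right_mono f(1) ball(5) z1)
      \<comment> \<open>At fixed \<open>z1\<close> the function \<open>qe z1 + A\<close> touches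
        \<open>u\<close> from below at \<open>t1\<close>, so its forward quotient
        \<open>A' t1 - k * h\<close> is at most \<open>C\<close>; the error \<open>k * h\<close> is
        brought below any given \<open>r\<close>.\<close>
      have "A' t1 \<le> C"
      proof (rule field_le_epsilon)
        fix r :: real assume r: "r > 0"
        define h where "h = min (r / k) ((t0 + \<tau> / 2 - t1) / 2)"
        have t1a: "\<bar>t1 - t0\<bar> < \<tau> / 2" using t1e by (simp add: e_def)
        then have t1h: "t0 + \<tau> / 2 - t1 > 0" by linarith
        have h: "h > 0" using r k t1h by (simp add: h_def)
        have h2: "h \<le> r / k" "h \<le> (t0 + \<tau> / 2 - t1) / 2"
          by (simp_all only: h_def min_le_iff_disj order_refl simp_thms)
        have "t0 - (t1 + h) \<le> \<tau> / 2" using h t1a by linarith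
        moreover have "- (t0 - (t1 + h)) \<le> \<tau> / 2" using h2(2) t1h by argo
        ultimately have "t1 + h \<in> cball t0 (\<tau> / 2)"
          unfolding mem_cball dist_real_def abs_le_iff by blast
        from low[OF this z1] have "A (t1 + h) - A t1 \<le> u (t1 + h) z1 - u t1 z1" using eq by simp
        also have "\<dots> \<le> C * h"
          using slope[OF JT(1)[OF t1] h _ ball(5)[OF z1]] h2 t1h \<tau> by simp
        finally have "h * (A' t1 - k * h) \<le> h * C"
          by (simp add: A_def A'_def power2_eq_square algebra_simps)
        then have "A' t1 - k * h \<le> C" using h by simp
        moreover have "k * h \<le> r" using h2 k by (simp add: field_simps)
        ultimately show "A' t1 \<le> C + r" by simp
      qed
      then show "exp (A' t1 + F z1 (u t1 z1)) \<le> exp (C + B)"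
        using B[OF JT(1)[OF t1] ball(5)[OF z1]] by simp
    qed
    finally show False using ball(2)[OF z1] by (simp add: G_def)
  qed
qed

lemma elliptic_visc_le_add_const:
  assumes "elliptic_visc_le \<Omega> w C f"
  shows "elliptic_visc_le \<Omega> (\<lambda>z. w z + d) C f"
  unfolding elliptic_visc_le_def
proof (intro ballI allI impI, elim conjE)
  fix z0 q assume z0: "z0 \<in> \<Omega>" and q: "C2_near q z0" "q z0 = w z0 + d" "\<forall>\<^sub>F z in nhds z0. q z
      \<le> w z + d" "ddc_nonneg q z0"
  note h = complex_hessian_affine[OF q(1), of 1 "- d", simplified]
  obtain U D H where U: "z0 \<in> U" "c2_data U q D H" using q(1) unfolding C2_near_iff by blast
  have "c2_data U (\<lambda>z. - d) (\<lambda>z v. 0) (\<lambda>z v w. 0)"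
    by (rule c2_data_subset[OF c2_data_const c2_dataD(1)[OF U(2)]]) simp
  from c2_data_add[OF U(2) this] have "C2_near (\<lambda>z. q z - d) z0"
    unfolding C2_near_iff using U(1) by (simp, blast)
  moreover have "\<forall>\<^sub>F z in nhds z0. q z - d \<le> w z" using q(3) by eventually_elim simp
  moreover have "ddc_nonneg (\<lambda>z. q z - d) z0" using q(4) h(1) by (simp add: ddc_nonneg_def)
  ultimately have "ma_density (\<lambda>z. q z - d) z0 \<le> C * f z0"
    using assms z0 q(2) unfolding elliptic_visc_le_def by auto
  then show "ma_density q z0 \<le> C * f z0" using h(2) by simp
qed

lemma elliptic_visc_le_slice:
  fixes u :: "real \<Rightarrow> complex ^ 'n \<Rightarrow> real" and \<Omega> :: "(complex ^ 'n) set"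
  assumes sub: "visc_subsolution_eq \<Omega> T F f u" and sup: "visc_supersolution_eq \<Omega> T F f u"
    and \<Omega>: "open \<Omega>" "bounded \<Omega>" and f: "\<And>z. z \<in> \<Omega> \<Longrightarrow> 0 \<le> f z" "continuous_on \<Omega> f"
    and F: "continuous_on (closure \<Omega> \<times> UNIV) (\<lambda>(z, r). F z r)" "\<And>z. z \<in> closure \<Omega> \<Longrightarrow> mono (F z)"
    and bdry: "\<And>t z. 0 \<le> t \<Longrightarrow> t < T \<Longrightarrow> z \<in> frontier \<Omega> \<Longrightarrow> u t z = \<phi> z"
    and t0: "0 < t0" "t0 < T"
  shows "\<exists>C>0. elliptic_visc_le \<Omega> (u t0) C f"
proof -
  have u: "continuous_on ({0..<T} \<times> closure \<Omega>) (\<lambda>(t, z). u t z)"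
    using sub sup unfolding visc_subsolution_eq_def visc_supersolution_eq_def
    by (intro usc_lsc_imp_continuous_on) auto
  \<comment> \<open>The interval from \<open>t0\<close> to \<open>T\<close> is cut into thirds:
    times \<open>l * t\<close> may go up to \<open>T1\<close>, and the exponential penalty grows
    between \<open>T1\<close> and \<open>T2\<close>.\<close>
  define T1 T2 where "T1 = (2 * t0 + T) / 3" and "T2 = (t0 + 2 * T) / 3"
  have T: "0 < T1" "t0 < T1" "T1 < T2" "T2 < T" using t0 by (auto simp: T1_def T2_def)
  define K where "K = {0..T2} \<times> closure \<Omega>"
  have cK: "compact K" unfolding K_def using \<Omega>(2) by (intro compact_Times) (auto simp:
      compact_closure)
  have uK: "continuous_on K (\<lambda>(t, z). u t z)"
    by (rule continuous_on_subset[OF u]) (use T in \<open>auto simp: K_def\<close>)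
  obtain M where M: "M > 0" "\<And>p. p \<in> K \<Longrightarrow> \<bar>u (fst p) (snd p)\<bar> \<le> M"
    using compact_imp_bounded[OF compact_continuous_image[OF uK cK]] unfolding bounded_pos by
        (auto simp: split_def)
  have M': "\<bar>u t z\<bar> \<le> M" if "0 \<le> t" "t \<le> T2" "z \<in> closure \<Omega>" for t z
    using M(2)[of "(t, z)"] that by (simp add: K_def)
  have "continuous_on K (\<lambda>p. (\<lambda>(z, r). F z r) (snd p, u (fst p) (snd p)))"
    by (rule continuous_on_compose2[OF F(1)]) (use uK in \<open>auto simp: K_def split_def intro!:
        continuous_intros\<close>)
  from compact_imp_bounded[OF compact_continuous_image[OF this cK]]
  obtain B where B: "\<And>p. p \<in> K \<Longrightarrow> \<bar>F (snd p) (u (fst p) (snd p))\<bar> \<le> B"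
    unfolding bounded_pos by auto
  define n where "n = real CARD('n)"
  \<comment> \<open>From \<open>u (t + h) z - u t z \<le> (l - 1) * (u t z + l * (M + n *
    T))\<close> with \<open>l - 1 = h / t \<le> 2 * h / t0\<close> and
    \<open>l \<le> 2 * T / t0\<close>, both by \<open>t \<ge> t0 / 2\<close>.\<close>
  define C where "C = 2 / t0 * (M + 2 * T / t0 * (M + n * T))"
  define \<tau> where "\<tau> = min (t0 / 2) (T1 - t0)"
  have \<tau>: "\<tau> > 0" "\<tau> \<le> t0 / 2" "\<tau> \<le> T1 - t0"
    using t0 T by (simp add: \<tau>_def) (simp_all only: \<tau>_def min_le_iff_disj order_refl simp_thms)
  have slope: "u (t + h) z - u t z \<le> C * h"
    if t: "\<bar>t - t0\<bar> < \<tau>" and h: "0 < h" "t + h < t0 + \<tau>" and z: "z \<in> \<Omega>" for t h z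
  proof -
    have t2: "t0 / 2 \<le> t" "0 < t" "t + h \<le> T1" using t h \<tau> t0 by auto
    define l where "l = (t + h) / t"
    have l: "l > 1" "l * t = t + h" "l - 1 = h / t" using t2 h by (auto simp: l_def field_simps)
    have zc: "z \<in> closure \<Omega>" using z closure_subset by blast
    have "u (l * t) z / l - u t z \<le> (l - 1) * M + CARD('n) * ln l * t"
      by (rule time_scaling_bound[OF sub sup \<Omega>(1,2) f F bdry T(1,3,4) M' l(1) _ _ zc]) (use t2 l
          in auto)
    also have "CARD('n) * ln l * t \<le> (l - 1) * (n * T)"
    proof -
      have "ln l \<le> l - 1" using l(1) by (intro ln_le_minus_one) auto
      moreover have "t \<le> T" "0 \<le> ln l" using t2 T h l(1) by auto
      ultimately have "ln l * t \<le> (l - 1) * T" using t2 l(1) by (intro mult_mono) auto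
      then show ?thesis by (simp add: n_def mult.assoc mult.left_commute)
    qed
    finally have "u (t + h) z / l - u t z \<le> (l - 1) * (M + n * T)" by (simp add: l(2) algebra_simps)
    then have "u (t + h) z \<le> l * (u t z + (l - 1) * (M + n * T))" using l(1) by (simp add:
        field_simps)
    then have "u (t + h) z - u t z \<le> (l - 1) * (u t z + l * (M + n * T))" by (simp add:
        algebra_simps)
    also have "\<dots> \<le> (l - 1) * (M + 2 * T / t0 * (M + n * T))"
    proof (intro mult_left_mono add_mono mult_right_mono)
      show "u t z \<le> M" using M'[of t z] t2 T h zc by (auto simp: abs_le_iff)
      have "t + h \<le> T" using t2 T by simp
      then have "l \<le> T / t" using t2 by (simp add: l_def divide_right_mono)
      also have "\<dots> \<le> T / (t0 / 2)" using t2 t0 by (intro divide_left_mono) auto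
      finally show "l \<le> 2 * T / t0" by (simp add: mult.commute)
      show "0 \<le> M + n * T" using M(1) t0 by (simp add: n_def)
    qed (use l in auto)
    also have "\<dots> \<le> h * (2 / t0) * (M + 2 * T / t0 * (M + n * T))"
    proof (intro mult_right_mono)
      have "h / t \<le> h / (t0 / 2)" using t2 t0 h by (intro divide_left_mono) auto
      then show "l - 1 \<le> h * (2 / t0)" by (simp add: l(3))
      show "0 \<le> M + 2 * T / t0 * (M + n * T)" using M(1) t0 by (simp add: n_def)
    qed
    finally show ?thesis by (simp add: C_def mult_ac)
  qed
  have "elliptic_visc_le \<Omega> (u t0) (exp (C + B)) f"
  proof (rule elliptic_visc_le_of_time_slope[OF sup \<Omega>(1) f _ \<tau>(1) _ _ slope])
    show "continuous_on ({0<..<T} \<times> \<Omega>) (\<lambda>(t, z). u t z)"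
      by (rule continuous_on_subset[OF u]) (use closure_subset in auto)
    show "0 < t0 - \<tau>" "t0 + \<tau> < T" using \<tau> t0 T by auto
    show "F z (u t z) \<le> B" if "\<bar>t - t0\<bar> < \<tau>" "z \<in> \<Omega>" for t z
    proof -
      have "(t, z) \<in> K" using that \<tau> T t0 closure_subset by (auto simp: K_def)
      from B[OF this] show ?thesis by (simp add: abs_le_iff)
    qed
  qed
  then show ?thesis by (intro exI[of _ "exp (C + B)"]) simp
qed

theorem corollary3p6:
  fixes \<Omega> :: "(complex ^ 'n) set"
    and T :: real
    and F :: "complex ^ 'n \<Rightarrow> real \<Rightarrow> real"
    and f \<phi> u0 :: "complex ^ 'n \<Rightarrow> real"
    and u :: "real \<Rightarrow> complex ^ 'n \<Rightarrow> real"
  assumes "open \<Omega>" and "connected \<Omega>" and "\<Omega> \<noteq> {}" and "bounded \<Omega>"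
    and "0 < T"
    and "continuous_on (closure \<Omega> \<times> UNIV) (\<lambda>(z, r). F z r)"
    and "\<And>z. z \<in> closure \<Omega> \<Longrightarrow> mono (F z)"
    and "\<And>z. z \<in> \<Omega> \<Longrightarrow> 0 \<le> f z" and "bounded (f ` \<Omega>)" and "continuous_on \<Omega> f"
    and "continuous_on (frontier \<Omega>) \<phi>"
    and "continuous_on (closure \<Omega>) u0" and "plurisubharmonic_on \<Omega> u0"
    and "\<And>z. z \<in> frontier \<Omega> \<Longrightarrow> u0 z = \<phi> z"
    and "visc_solution \<Omega> T F f \<phi> u0 u"
  shows "(\<forall>t. 0 < t \<and> t < T \<longrightarrow> (\<exists>Ct>0. elliptic_visc_le \<Omega> (u t) Ct f)) \<and> admissible \<Omega> u0 f"
proof -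
  have sub: "visc_subsolution_eq \<Omega> T F f u" and sup: "visc_supersolution_eq \<Omega> T F f u"
    and le: "\<And>t z. t \<in> {0..<T} \<Longrightarrow> z \<in> frontier \<Omega> \<Longrightarrow> u t z \<le> \<phi> z" "\<And>z. z \<in> \<Omega> \<Longrightarrow> u 0 z \<le> u0 z"
    and ge: "\<And>t z. t \<in> {0..<T} \<Longrightarrow> z \<in> frontier \<Omega> \<Longrightarrow> \<phi> z \<le> u t z" "\<And>z. z \<in> \<Omega> \<Longrightarrow> u0 z \<le> u 0 z"
    using assms(15) unfolding visc_solution_def visc_subsolution_def visc_supersolution_def by
        blast+
  have bdry: "u t z = \<phi> z" if "0 \<le> t" "t < T" "z \<in> frontier \<Omega>" for t z
    using le(1)[of t z] ge(1)[of t z] that by simp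
  have slice: "\<exists>C>0. elliptic_visc_le \<Omega> (u t) C f" if "0 < t" "t < T" for t
    by (rule elliptic_visc_le_slice[OF sub sup assms(1,4,8,10,6,7) bdry that])
  \<comment> \<open>The initial condition is imposed in \<open>\<Omega>\<close>; on the frontier the
    value at time \<open>0\<close> comes from the boundary condition and
    \<open>u0 = \<phi>\<close>.\<close>
  have init: "u 0 z = u0 z" if "z \<in> closure \<Omega>" for z
  proof (cases "z \<in> \<Omega>")
    case False
    then have "z \<in> frontier \<Omega>" using that assms(1) by (simp add: frontier_def interior_open)
    then show ?thesis using bdry[of 0 z] assms(5,14) by simp
  qed (use le ge in force)
  have u: "continuous_on ({0..<T} \<times> closure \<Omega>) (\<lambda>(t, z). u t z)"
    using sub sup unfolding visc_subsolution_eq_def visc_supersolution_eq_def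
    by (intro usc_lsc_imp_continuous_on) auto
  have "admissible \<Omega> u0 f"
    unfolding admissible_def
  proof (intro allI impI)
    fix \<epsilon> :: real assume \<epsilon>: "0 < \<epsilon>"
    have "continuous_on ({0..T / 2} \<times> closure \<Omega>) (\<lambda>(t, z). u t z)"
      by (rule continuous_on_subset[OF u]) (use assms(5) in auto)
    then have "uniformly_continuous_on ({0..T / 2} \<times> closure \<Omega>) (\<lambda>(t, z). u t z)"
      using assms(4) by (intro compact_uniformly_continuous compact_Times) (auto simp:
          compact_closure)
    moreover have "\<epsilon> / 2 > 0" using \<epsilon> by simp
    ultimately obtain d where d: "d > 0" "\<And>p p'. p \<in> {0..T / 2} \<times> closure \<Omega>
        \<Longrightarrow> p' \<in> {0..T / 2} \<times> closure \<Omega> \<Longrightarrow>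
        dist p' p < d \<Longrightarrow> dist ((\<lambda>(t, z). u t z) p') ((\<lambda>(t, z). u t z) p) < \<epsilon> / 2"
      unfolding uniformly_continuous_on_def by metis
    define t where "t = min (T / 2) (d / 2)"
    have t: "0 < t" "t < T" "t \<le> T / 2" "t < d" using d(1) assms(5) by (auto simp: t_def)
    have close: "\<bar>u t z - u0 z\<bar> < \<epsilon> / 2" if "z \<in> closure \<Omega>" for z
      using d(2)[of "(0, z)" "(t, z)"] that t init[OF that] by (simp add: dist_Pair_Pair
          dist_real_def)
    obtain C where C: "C > 0" "elliptic_visc_le \<Omega> (u t) C f" using slice[OF t(1,2)] by blast
    \<comment> \<open>The maximum with \<open>1\<close> makes \<open>Ce\<close> positive also when
      \<open>C \<le> 1\<close>; enlarging the constant is harmless since \<open>f\<close> is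
      nonnegative.\<close>
    define Ce where "Ce = max 1 (ln C)"
    have "C \<le> exp Ce" using C(1) by (simp add: Ce_def flip: ln_le_cancel_iff)
    then have "C * f z \<le> exp Ce * f z" if "z \<in> \<Omega>" for z using assms(8)[OF that] by (intro
        mult_right_mono)
    then have "elliptic_visc_le \<Omega> (\<lambda>z. u t z + \<epsilon> / 2) (exp Ce) f"
      using elliptic_visc_le_add_const[OF C(2), of "\<epsilon> / 2"] unfolding elliptic_visc_le_def by
          (meson order_trans)
    moreover have "continuous_on (closure \<Omega>) (\<lambda>z. u t z + \<epsilon> / 2)"
    proof -
      have "continuous_on (closure \<Omega>) (\<lambda>z. (\<lambda>(t, z). u t z) (t, z))"
        by (rule continuous_on_compose2[OF u]) (use t in \<open>auto intro!: continuous_intros\<close>)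
      then show ?thesis by (intro continuous_intros) simp
    qed
    moreover have "u0 z \<le> u t z + \<epsilon> / 2 \<and> u t z + \<epsilon> / 2 \<le> u0 z + \<epsilon>" if "z \<in> closure \<Omega>" for z
      using close[OF that] unfolding abs_less_iff by (intro conjI; linarith)
    moreover have "Ce > 0" by (simp add: Ce_def)
    ultimately show "\<exists>ue Ce. Ce > 0 \<and> continuous_on (closure \<Omega>) ue \<and>
        (\<forall>z\<in>closure \<Omega>. u0 z \<le> ue z \<and> ue z \<le> u0 z + \<epsilon>) \<and> elliptic_visc_le \<Omega> ue (exp Ce) f"
      by blast
  qed
  with slice show ?thesis by blast
qed

end
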